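(* Let $\mathbb{K}$ be an algebraically closed field of characteristic not equal to $2$, let $V$ be a finite-dimensional $\mathbb{K}$-vector space equipped with a nondegenerate quadratic form, and put $p=\lfloor \frac{\dim V}{2}\rfloor$. Set $(q,m)=(3,7)$ if $\dim V$ is odd and $(q,m)=(4,8)$ if $\dim V$ is even. Then the isotropic Grassmannian $Gr_{\mathrm{iso}}(p,V)\subseteq \mathbb{P}(\bigwedge^p V)$ in its Plücker embedding is defined set-theoretically by the pullbacks of the defining equations of $Gr_{\mathrm{iso}}(q,m)$ along isotropic Grassmann cone preserving maps. That is, for nonzero $\omega\in\bigwedge^p V$, the point $[\omega]$ lies in $Gr_{\mathrm{iso}}(p,V)$ if and only if $F(\Phi(\omega))=0$ for every isotropic Grassmann cone preserving linear map $\Phi:\bigwedge^p V\to\bigwedge^q\mathbb{K}^m$ and every polynomial $F$ on $\bigwedge^q\mathbb{K}^m$ vanishing on the isotropic Grassmann cone $\hat{Gr}_{\mathrm{iso}}(q,\mathbb{K}^m)$.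
   Context: For a finite-dimensional vector space $U$ over a field of characteristic not $2$ with a nondegenerate quadratic form and associated symmetric bilinear form $\langle\cdot,\cdot\rangle$, a subspace $L\subseteq U$ is isotropic if $\langle u,v\rangle=0$ for all $u,v\in L$. The isotropic Grassmann cone is $$\hat{Gr}_{\mathrm{iso}}(k,U)=\{v_1\wedge\cdots\wedge v_k \mid v_1,\dots,v_k\in U,\ \langle v_i,v_j\rangle=0 \text{ for all } i,j\}\subset \bigwedge\nolimits^k U,$$ and the isotropic Grassmannian $Gr_{\mathrm{iso}}(k,U)\subset\mathbb{P}(\bigwedge^k U)$ in its Plücker embedding is its projectivization. $Gr_{\mathrm{iso}}(k,m)$ denotes $Gr_{\mathrm{iso}}(k,\mathbb{K}^m)$, where $\mathbb{K}^m$ carries a nondegenerate quadratic form (unique up to isometry as $\mathbb{K}$ is algebraically closed of characteristic not $2$). A linear map $\Phi:\bigwedge^k U\to\bigwedge^{q}W$, where $U$ and $W$ are both equipped with nondegenerate quadratic forms, is isotropic Grassmann cone preserving (IGCP) if $\Phi(\hat{Gr}_{\mathrm{iso}}(k,U))\subseteq\hat{Gr}_{\mathrm{iso}}(q,W)$. *)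

theory Defs
  imports
    "HOL-Analysis.Cartesian_Space"
    "HOL-Computational_Algebra.Polynomial"
begin

text \<open>
  A vector space over a field \<open>'a\<close> is a type with a scalar multiplication satisfying the locale
  \<^locale>\<open>vector_space\<close> of the library; \<open>(*)\<close> is the scalar multiplication of \<open>'a\<close> over itself.
\<close>

section \<open>Exterior powers\<close>

text \<open>
  A \<open>k\<close>-tuple of vectors is a list of length \<open>k\<close>; values on lists of other lengths are irrelevant.
  For \<open>k = 0\<close> there is no condition.
\<close>

definition alternating_multilinear ::
  "('a::field \<Rightarrow> 'v::ab_group_add \<Rightarrow> 'v) \<Rightarrow> ('a \<Rightarrow> 'e::ab_group_add \<Rightarrow> 'e) \<Rightarrow> nat
    \<Rightarrow> ('v list \<Rightarrow> 'e) \<Rightarrow> bool" where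
  "alternating_multilinear sV sE k f \<longleftrightarrow>
     (\<forall>vs i. length vs = k \<longrightarrow> i < k \<longrightarrow> Vector_Spaces.linear sV sE (\<lambda>x. f (vs[i := x]))) \<and>
     (\<forall>vs i j. length vs = k \<longrightarrow> i < j \<longrightarrow> j < k \<longrightarrow> vs ! i = vs ! j \<longrightarrow> f vs = 0)"

text \<open>
  \<open>'e\<close> with scalar multiplication \<open>sE\<close> is the \<open>k\<close>-th exterior power of \<open>'v\<close>, and
  \<open>wedge [v\<^sub>1, \<dots>, v\<^sub>k]\<close> is the product of \<open>v\<^sub>1, \<dots>, v\<^sub>k\<close>, when \<open>wedge\<close> is the universal alternating
  multilinear map.  A locale cannot quantify over the target of the maps to be factored, so the
  universal property is required for scalar-valued maps; the lemma \<open>universal_property\<close>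
  below derives it for an arbitrary target space.
\<close>

locale exterior_power =
  V: vector_space sV + E: vector_space sE
  for sV :: "'a::field \<Rightarrow> 'v::ab_group_add \<Rightarrow> 'v"
    and sE :: "'a \<Rightarrow> 'e::ab_group_add \<Rightarrow> 'e"
    and k :: nat
    and wedge :: "'v list \<Rightarrow> 'e" +
  assumes alternating_multilinear_wedge: "alternating_multilinear sV sE k wedge"
    and universal_scalar: "alternating_multilinear sV (*) k f \<Longrightarrow>
      \<exists>!g. Vector_Spaces.linear sE (*) g \<and> (\<forall>vs. length vs = k \<longrightarrow> g (wedge vs) = f vs)"

lemma alternating_multilinear_compose:
  assumes f: "alternating_multilinear sV sE k f" and h: "Vector_Spaces.linear sE sX h"
  shows "alternating_multilinear sV sX k (\<lambda>vs. h (f vs))"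
proof -
  interpret h: Vector_Spaces.linear sE sX h by (rule h)
  have "Vector_Spaces.linear sV sX (\<lambda>x. h (f (vs[i := x])))" if "length vs = k" "i < k" for vs i
    using f that Vector_Spaces.linear_compose[OF _ h, of sV "\<lambda>x. f (vs[i := x])"]
    unfolding alternating_multilinear_def o_def by blast
  then show ?thesis
    using f h.zero unfolding alternating_multilinear_def by metis
qed

lemma ex_linear_functional:
  fixes sX :: "'a::field \<Rightarrow> 'x::ab_group_add \<Rightarrow> 'x"
  assumes "vector_space sX" "d \<noteq> 0"
  shows "\<exists>\<phi>. Vector_Spaces.linear sX (*) \<phi> \<and> \<phi> d \<noteq> 0"
proof -
  interpret X: vector_space sX by fact
  interpret vector_space_pair sX "(*) :: 'a \<Rightarrow> 'a \<Rightarrow> 'a"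
    by (intro vector_space_pair.intro assms vector_space_over_itself.vector_space_axioms)
  have "X.independent {d}" using assms(2) by simp
  from linear_independent_extend[OF this, of "\<lambda>_. 1"] show ?thesis by auto
qed

lemma (in exterior_power) universal_property:
  fixes sX :: "'a \<Rightarrow> 'x::ab_group_add \<Rightarrow> 'x"
  assumes X: "vector_space sX" and f: "alternating_multilinear sV sX k f"
  shows "\<exists>!g. Vector_Spaces.linear sE sX g \<and> (\<forall>vs. length vs = k \<longrightarrow> g (wedge vs) = f vs)"
proof -
  interpret EX: vector_space_pair sE sX
    by (intro vector_space_pair.intro X E.vector_space_axioms)
  interpret EK: vector_space_pair sE "(*) :: 'a \<Rightarrow> 'a \<Rightarrow> 'a"
    by (intro vector_space_pair.intro E.vector_space_axioms
        vector_space_over_itself.vector_space_axioms)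
  interpret X: vector_space sX by fact
  define W where "W = wedge ` {vs. length vs = k}"
  obtain B where B: "B \<subseteq> W" "E.independent B" "W \<subseteq> E.span B"
    using E.maximal_independent_subset[of W] by blast
  have "\<forall>b\<in>B. \<exists>vs. length vs = k \<and> wedge vs = b" using B(1) unfolding W_def by blast
  then obtain r where r: "length (r b) = k" "wedge (r b) = b" if "b \<in> B" for b by metis
  obtain g where g: "Vector_Spaces.linear sE sX g" "\<And>b. b \<in> B \<Longrightarrow> g b = f (r b)"
    using EX.linear_independent_extend[OF B(2), of "\<lambda>b. f (r b)"] by blast
  have "g (wedge vs) = f vs" if vs: "length vs = k" for vs
  proof (rule ccontr)
    assume "g (wedge vs) \<noteq> f vs"
    then obtain \<phi> where \<phi>: "Vector_Spaces.linear sX (*) \<phi>" "\<phi> (g (wedge vs) - f vs) \<noteq> 0"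
      using ex_linear_functional[OF X, of "g (wedge vs) - f vs"] by auto
    interpret \<phi>: Vector_Spaces.linear sX "(*)" \<phi> by (rule \<phi>(1))
    obtain \<psi> where \<psi>: "Vector_Spaces.linear sE (*) \<psi>"
        "\<And>us. length us = k \<Longrightarrow> \<psi> (wedge us) = \<phi> (f us)"
      using universal_scalar[OF alternating_multilinear_compose[OF f \<phi>(1)]] by blast
    have "Vector_Spaces.linear sE (*) (\<lambda>x. \<phi> (g x))"
      using Vector_Spaces.linear_compose[OF g(1) \<phi>(1)] by (simp add: o_def)
    moreover have "\<phi> (g b) = \<psi> b" if "b \<in> B" for b
      using \<psi>(2)[of "r b"] r[OF that] g(2)[OF that] by simp
    moreover have "wedge vs \<in> E.span B" using vs B(3) unfolding W_def by blast
    ultimately have "\<phi> (g (wedge vs)) = \<psi> (wedge vs)"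
      using EK.linear_eq_on[OF _ \<psi>(1)] by blast
    then show False using \<phi>(2) \<psi>(2)[OF vs] by (simp add: \<phi>.diff)
  qed
  moreover have "g1 = g2"
    if g1: "Vector_Spaces.linear sE sX g1" "\<forall>vs. length vs = k \<longrightarrow> g1 (wedge vs) = f vs"
      and g2: "Vector_Spaces.linear sE sX g2" "\<forall>vs. length vs = k \<longrightarrow> g2 (wedge vs) = f vs"
    for g1 g2
  proof (rule ccontr)
    assume "g1 \<noteq> g2"
    then obtain x where "g1 x - g2 x \<noteq> 0" by auto
    then obtain \<phi> where \<phi>: "Vector_Spaces.linear sX (*) \<phi>" "\<phi> (g1 x - g2 x) \<noteq> 0"
      using ex_linear_functional[OF X] by blast
    interpret \<phi>: Vector_Spaces.linear sX "(*)" \<phi> by (rule \<phi>(1))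
    have "\<phi> \<circ> g1 = \<phi> \<circ> g2"
      using universal_scalar[OF alternating_multilinear_compose[OF f \<phi>(1)]]
        Vector_Spaces.linear_compose[OF g1(1) \<phi>(1)]
        Vector_Spaces.linear_compose[OF g2(1) \<phi>(1)] g1(2) g2(2)
      by (metis comp_apply)
    then have "\<phi> (g1 x) = \<phi> (g2 x)" by (metis comp_apply)
    then show False using \<phi>(2) by (simp add: \<phi>.diff)
  qed
  ultimately show ?thesis using g(1) by blast
qed

section \<open>Quadratic forms\<close>

text \<open>The normalisation is \<open>\<langle>v, v\<rangle> = Q v\<close>; it is meaningful in characteristic different from 2.\<close>

definition assoc_form :: "('v::ab_group_add \<Rightarrow> 'a::field) \<Rightarrow> 'v \<Rightarrow> 'v \<Rightarrow> 'a" where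
  "assoc_form Q u v = (Q (u + v) - Q u - Q v) / 2"

text \<open>By symmetry of \<^const>\<open>assoc_form\<close>, linearity in one argument is bilinearity.\<close>

definition quadratic_form ::
  "('a::field \<Rightarrow> 'v::ab_group_add \<Rightarrow> 'v) \<Rightarrow> ('v \<Rightarrow> 'a) \<Rightarrow> bool" where
  "quadratic_form s Q \<longleftrightarrow>
     (\<forall>c v. Q (s c v) = c\<^sup>2 * Q v) \<and> (\<forall>u. Vector_Spaces.linear s (*) (assoc_form Q u))"

definition nondegenerate_quadratic_form ::
  "('a::field \<Rightarrow> 'v::ab_group_add \<Rightarrow> 'v) \<Rightarrow> ('v \<Rightarrow> 'a) \<Rightarrow> bool" where
  "nondegenerate_quadratic_form s Q \<longleftrightarrow>
     quadratic_form s Q \<and> (\<forall>u. (\<forall>v. assoc_form Q u v = 0) \<longrightarrow> u = 0)"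

section \<open>Isotropic Grassmannians\<close>

definition iso_grassmann_cone ::
  "('v::ab_group_add \<Rightarrow> 'a::field) \<Rightarrow> nat \<Rightarrow> ('v list \<Rightarrow> 'e) \<Rightarrow> 'e set" where
  "iso_grassmann_cone Q k wedge =
     {wedge vs | vs. length vs = k \<and> (\<forall>u\<in>set vs. \<forall>v\<in>set vs. assoc_form Q u v = 0)}"

text \<open>
  The projective point of \<open>x \<noteq> 0\<close> is the line spanned by \<open>x\<close>.
  For \<open>k = 0\<close> the set \<^const>\<open>iso_grassmann_cone\<close> is just \<open>{wedge []}\<close>, which is not closed under
  scaling; its projectivization is still the single point of the projective space.
\<close>

definition proj_point ::
  "('a::field \<Rightarrow> 'e::ab_group_add \<Rightarrow> 'e) \<Rightarrow> 'e \<Rightarrow> 'e set" where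
  "proj_point sE x = module.span sE {x}"

definition iso_grassmannian ::
  "('a::field \<Rightarrow> 'e::ab_group_add \<Rightarrow> 'e) \<Rightarrow> ('v::ab_group_add \<Rightarrow> 'a) \<Rightarrow> nat
    \<Rightarrow> ('v list \<Rightarrow> 'e) \<Rightarrow> 'e set set" where
  "iso_grassmannian sE Q k wedge = {proj_point sE x | x. x \<in> iso_grassmann_cone Q k wedge \<and> x \<noteq> 0}"

definition igcp ::
  "('a::field \<Rightarrow> 'e::ab_group_add \<Rightarrow> 'e) \<Rightarrow> ('v::ab_group_add \<Rightarrow> 'a) \<Rightarrow> nat \<Rightarrow> ('v list \<Rightarrow> 'e)
    \<Rightarrow> ('a \<Rightarrow> 'f::ab_group_add \<Rightarrow> 'f) \<Rightarrow> ('w::ab_group_add \<Rightarrow> 'a) \<Rightarrow> nat \<Rightarrow> ('w list \<Rightarrow> 'f)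
    \<Rightarrow> ('e \<Rightarrow> 'f) \<Rightarrow> bool" where
  "igcp sE QV k wedgeV sF QW q wedgeW \<Phi> \<longleftrightarrow>
     Vector_Spaces.linear sE sF \<Phi> \<and>
     \<Phi> ` iso_grassmann_cone QV k wedgeV \<subseteq> iso_grassmann_cone QW q wedgeW"

section \<open>Polynomials on a vector space\<close>

text \<open>
  The algebra of functions generated by the constants and the linear functionals.  Over an infinite
  field, in particular over an algebraically closed one, polynomials on a finite-dimensional space
  may be identified with the functions they induce.
\<close>

inductive polynomial_on ::
  "('a::field \<Rightarrow> 'e::ab_group_add \<Rightarrow> 'e) \<Rightarrow> ('e \<Rightarrow> 'a) \<Rightarrow> bool"
  for sE where
  const: "polynomial_on sE (\<lambda>_. c)"
| linear: "Vector_Spaces.linear sE (*) l \<Longrightarrow> polynomial_on sE l"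
| add: "polynomial_on sE F \<Longrightarrow> polynomial_on sE G \<Longrightarrow> polynomial_on sE (\<lambda>x. F x + G x)"
| mult: "polynomial_on sE F \<Longrightarrow> polynomial_on sE G \<Longrightarrow> polynomial_on sE (\<lambda>x. F x * G x)"

end

theory Submission
  imports Defs "Jordan_Normal_Form.Determinant"
begin

text \<open>
  Pairing with \<open>u\<^sub>1 \<and> \<dots> \<and> u\<^sub>k\<close> turns an element of the exterior power into an alternating \<open>k\<close>-form \<open>f\<close> on the
  quadratic space.  Its support is the span of the vectors representing the linear forms \<open>f(\<cdot>, u\<^sub>2, \<dots>, u\<^sub>k)\<close>.
  If \<open>k\<close> is half the dimension, rounded down, and the support is isotropic, then the support has dimension at
  most \<open>k\<close>, so \<open>f\<close> is a determinant: the cone over the maximal isotropic Grassmannian is cut out by the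
  quadratic equations saying that the support is isotropic, without further Pluecker relations.

  For isotropic mutually orthogonal \<open>g\<^sub>1, \<dots>, g\<^sub>r\<close> and a nondegenerate subspace \<open>T\<close> orthogonal to them, of
  dimension 7 or 8, the form \<open>f(g\<^sub>1, \<dots>, g\<^sub>r, \<dots>)\<close> on \<open>T\<close> is the image of \<open>f\<close> under an isotropic Grassmann
  cone preserving map.  By induction on \<open>r\<close> it remains to see that \<open>f\<close> has isotropic support if all its
  contractions with isotropic vectors do.  One nonzero contraction yields a hyperbolic basis \<open>e\<^sub>i, g\<^sub>i\<close> (and \<open>h\<close>
  in odd dimension) in which \<open>\<plusminus>e\<^sub>i\<close> represents \<open>f(\<cdot>, g\<^sub>1, \<dots>, g\<^sub>k)\<close> with \<open>g\<^sub>i\<close> omitted; contractions with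
  \<open>g\<^sub>i - e\<^sub>i / 2 \<plusminus> h\<close> (odd dimension), respectively with \<open>g\<^sub>i + e\<^sub>i\<close> (even dimension), show that \<open>f\<close> is
  annihilated by all \<open>e\<^sub>i\<close> and \<open>h\<close>.  In smaller dimensions one embeds the space isometrically into
  the one of dimension 7 or 8 and wedges with further isotropic vectors instead.
\<close>

section \<open>Alternating multilinear maps\<close>

text \<open>The dimensions 7 and 8 come from the step that assembles the contractions. Replacing
  \<open>g i\<close> by a deformed vector \<open>g i + a e i + c h\<close> preserves the form
  represented by \<open>e k\<close> only if some index remains besides \<open>i\<close>,
  \<open>k\<close> and the index of one free argument. Four indices are thus required, so the odd
  descent works from dimension 9 on and stops at 7.

  In even dimension there is no \<open>h\<close>, and the only isotropic lines in the plane of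
  \<open>e i\<close> and \<open>g i\<close> are the two axes. The deformed vector
  \<open>g i + e i\<close> is therefore not isotropic, and isotropy of the contraction with it has
  to be imported from the odd case in its orthogonal complement. That space has one hyperbolic pair
  less, so five indices are needed and the even descent stops at 8.

  A contraction preserves the cone because the vectors of the orthogonal complement of
  \<open>T\<close> that are orthogonal to all \<open>g i\<close> lie in the span of the
  \<open>g i\<close>; this condition is carried through the induction on \<open>r\<close>.\<close>

lemma alternating_linear_append:
  assumes f: "alternating_multilinear sV sE k f" and k: "Suc (length xs + length ys) = k"
  shows "Vector_Spaces.linear sV sE (\<lambda>x. f (xs @ x # ys))"
proof -
  have "length (xs @ 0 # ys) = k" "length xs < k" using k by auto
  then have "Vector_Spaces.linear sV sE (\<lambda>x. f ((xs @ 0 # ys)[length xs := x]))"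
    using f unfolding alternating_multilinear_def by blast
  then show ?thesis by (simp add: list_update_append)
qed

lemma alternating_add:
  assumes "alternating_multilinear sV sE k f" and "Suc (length xs + length ys) = k"
  shows "f (xs @ (a + b) # ys) = f (xs @ a # ys) + f (xs @ b # ys)"
proof -
  interpret Vector_Spaces.linear sV sE "\<lambda>x. f (xs @ x # ys)"
    using assms by (rule alternating_linear_append)
  show ?thesis by (rule add)
qed

lemma alternating_scale:
  assumes "alternating_multilinear sV sE k f" and "Suc (length xs + length ys) = k"
  shows "f (xs @ (sV c a) # ys) = sE c (f (xs @ a # ys))"
proof -
  interpret Vector_Spaces.linear sV sE "\<lambda>x. f (xs @ x # ys)"
    using assms by (rule alternating_linear_append)
  show ?thesis by (rule scale)
qed

lemma alternating_zero:
  assumes "alternating_multilinear sV sE k f" and "length vs = k" and "0 \<in> set vs"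
  shows "f vs = 0"
proof -
  obtain xs ys where vs: "vs = xs @ 0 # ys" using assms(3) by (meson split_list)
  interpret Vector_Spaces.linear sV sE "\<lambda>x. f (xs @ x # ys)"
    by (rule alternating_linear_append[OF assms(1)]) (use assms(2) vs in simp)
  show ?thesis using zero vs by simp
qed

lemma alternating_not_distinct:
  assumes "alternating_multilinear sV sE k f" and "length vs = k" and "\<not> distinct vs"
  shows "f vs = 0"
proof -
  obtain i j where "i < k" "j < k" "i \<noteq> j" "vs ! i = vs ! j"
    using assms(2,3) by (auto simp: distinct_conv_nth)
  then show ?thesis
    using assms(1,2) unfolding alternating_multilinear_def by (metis linorder_neqE_nat)
qed

lemma alternating_multilinearI:
  fixes f :: "'v::ab_group_add list \<Rightarrow> 'e::ab_group_add"
  assumes "\<And>xs ys. Suc (length xs + length ys) = k \<Longrightarrow>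
      Vector_Spaces.linear sV sE (\<lambda>x. f (xs @ x # ys))"
    and "\<And>vs i j. length vs = k \<Longrightarrow> i < j \<Longrightarrow> j < k \<Longrightarrow> vs ! i = vs ! j \<Longrightarrow> f vs = 0"
  shows "alternating_multilinear sV sE k f"
  unfolding alternating_multilinear_def
proof (intro conjI allI impI)
  fix vs :: "'v list" and i assume "length vs = k" "i < k"
  then show "Vector_Spaces.linear sV sE (\<lambda>x. f (vs[i := x]))"
    using assms(1)[of "take i vs" "drop (Suc i) vs"] by (simp add: upd_conv_take_nth_drop)
qed (use assms(2) in blast)

lemma alternating_append:
  fixes f :: "'v::ab_group_add list \<Rightarrow> 'e::ab_group_add"
  assumes "alternating_multilinear sV sE (length gs + k) f"
  shows "alternating_multilinear sV sE k (\<lambda>us. f (gs @ us))"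
proof (rule alternating_multilinearI)
  fix xs ys :: "'v list" assume "Suc (length xs + length ys) = k"
  then show "Vector_Spaces.linear sV sE (\<lambda>x. f (gs @ xs @ x # ys))"
    using alternating_linear_append[OF assms, of "gs @ xs" ys] by simp
next
  fix vs :: "'v list" and i j
  assume "length vs = k" "i < j" "j < k" "vs ! i = vs ! j"
  then have "\<not> distinct vs" by (metis distinct_conv_nth less_irrefl less_trans)
  then show "f (gs @ vs) = 0"
    using alternating_not_distinct[OF assms, of "gs @ vs"] \<open>length vs = k\<close> by simp
qed

lemma alternating_Cons:
  assumes "alternating_multilinear sV sE (Suc k) f"
  shows "alternating_multilinear sV sE k (\<lambda>us. f (g # us))"
  using alternating_append[of sV sE "[g]" k f] assms by simp

lemma alternating_map:
  fixes T :: "'u::ab_group_add \<Rightarrow> 'v::ab_group_add"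
  assumes f: "alternating_multilinear sV sE k f" and T: "Vector_Spaces.linear sU sV T"
  shows "alternating_multilinear sU sE k (\<lambda>us. f (map T us))"
proof (rule alternating_multilinearI)
  fix xs ys :: "'u list" assume "Suc (length xs + length ys) = k"
  then have "Vector_Spaces.linear sV sE (\<lambda>x. f (map T xs @ x # map T ys))"
    by (intro alternating_linear_append[OF f]) simp
  from Vector_Spaces.linear_compose[OF T this]
  show "Vector_Spaces.linear sU sE (\<lambda>x. f (map T (xs @ x # ys)))" by (simp add: o_def)
next
  fix vs :: "'u list" and i j
  assume "length vs = k" "i < j" "j < k" "vs ! i = vs ! j"
  then have "\<not> distinct (map T vs)" by (metis distinct_conv_nth less_irrefl less_trans length_map nth_map)
  then show "f (map T vs) = 0"
    using alternating_not_distinct[OF f, of "map T vs"] \<open>length vs = k\<close> by simp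
qed

lemma linear_functional_diff:
  assumes "Vector_Spaces.linear sV ((*) :: 'a::field \<Rightarrow> _) f" "Vector_Spaces.linear sV (*) g"
  shows "Vector_Spaces.linear sV (*) (\<lambda>x. f x - g x)"
proof -
  interpret f: Vector_Spaces.linear sV "(*)" f by fact
  interpret vector_space_pair sV "(*) :: 'a \<Rightarrow> 'a \<Rightarrow> 'a" ..
  show ?thesis by (rule linear_compose_sub[OF assms])
qed

lemma linear_functional_sum:
  assumes "vector_space sV"
    and "\<And>i. i \<in> I \<Longrightarrow> Vector_Spaces.linear sV ((*) :: 'a::field \<Rightarrow> _) (f i)"
  shows "Vector_Spaces.linear sV (*) (\<lambda>x. \<Sum>i\<in>I. f i x)"
proof -
  interpret vector_space sV by fact
  interpret vector_space_pair sV "(*) :: 'a \<Rightarrow> 'a \<Rightarrow> 'a"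
    by (intro vector_space_pair.intro assms vector_space_over_itself.vector_space_axioms)
  show ?thesis by (rule linear_compose_sum) (use assms in blast)
qed

lemma linear_functional_scale:
  assumes "Vector_Spaces.linear sV ((*) :: 'a::field \<Rightarrow> _) f"
  shows "Vector_Spaces.linear sV (*) (\<lambda>x. c * f x)"
proof -
  interpret f: Vector_Spaces.linear sV "(*)" f by fact
  interpret vector_space_pair sV "(*) :: 'a \<Rightarrow> 'a \<Rightarrow> 'a" ..
  show ?thesis by (rule linear_compose_scale_right[OF assms])
qed

lemma alternating_diff:
  assumes "alternating_multilinear sV ((*) :: 'a::field \<Rightarrow> _) k f" "alternating_multilinear sV (*) k g"
  shows "alternating_multilinear sV (*) k (\<lambda>us. f us - g us)"
  using assms unfolding alternating_multilinear_def by (auto intro: linear_functional_diff)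

lemma alternating_scale_form:
  assumes "alternating_multilinear sV ((*) :: 'a::field \<Rightarrow> _) k f"
  shows "alternating_multilinear sV (*) k (\<lambda>us. c * f us)"
  using assms unfolding alternating_multilinear_def by (auto intro: linear_functional_scale)

lemma alternating_sum_form:
  assumes "vector_space sV"
    and "\<And>i. i \<in> I \<Longrightarrow> alternating_multilinear sV ((*) :: 'a::field \<Rightarrow> _) k (f i)"
  shows "alternating_multilinear sV (*) k (\<lambda>us. \<Sum>i\<in>I. f i us)"
  using assms unfolding alternating_multilinear_def by (auto intro!: linear_functional_sum sum.neutral)

lemma alternating_swap:
  assumes f: "alternating_multilinear sV ((*) :: 'a::field \<Rightarrow> _) k f"
    and k: "length xs + length ys + 2 = k"
  shows "f (xs @ a # b # ys) = - f (xs @ b # a # ys)"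
proof -
  have *: "f (xs @ c # c # ys) = 0" for c
    by (rule alternating_not_distinct[OF f]) (use k in auto)
  have "0 = f (xs @ (a + b) # (a + b) # ys)" by (simp add: *)
  also have "\<dots> = f (xs @ a # (a + b) # ys) + f (xs @ b # (a + b) # ys)"
    by (rule alternating_add[OF f]) (use k in simp)
  also have "f (xs @ a # (a + b) # ys) = f (xs @ a # b # ys)"
    using alternating_add[OF f, of "xs @ [a]" ys a b] k by (simp add: *)
  also have "f (xs @ b # (a + b) # ys) = f (xs @ b # a # ys)"
    using alternating_add[OF f, of "xs @ [b]" ys a b] k by (simp add: *)
  finally show ?thesis by (simp add: eq_neg_iff_add_eq_0)
qed

lemma alternating_swap_head:
  assumes "alternating_multilinear sV ((*) :: 'a::field \<Rightarrow> _) k f" and "length ys + 2 = k"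
  shows "f (a # b # ys) = - f (b # a # ys)"
  using alternating_swap[OF assms(1), of "[]" ys a b] assms(2) by simp

lemma alternating_move_front:
  assumes "alternating_multilinear sV ((*) :: 'a::field \<Rightarrow> _) k f"
    and "Suc (length xs + length ys) = k"
  shows "f (xs @ y # ys) = (-1) ^ length xs * f (y # xs @ ys)"
  using assms(2)
proof (induction xs arbitrary: ys rule: rev_induct)
  case (snoc x xs)
  have "f ((xs @ [x]) @ y # ys) = - f (xs @ y # x # ys)"
    using alternating_swap[OF assms(1), of xs ys x y] snoc.prems by simp
  then show ?case using snoc.IH[of "x # ys"] snoc.prems by simp
qed simp

text \<open>The sign is uniform in the form, hence also in parameters on which the form depends.\<close>

lemma alternating_permute:
  assumes "mset xs = mset ys"
  obtains c :: "'a::field" where "c = 1 \<or> c = -1"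
    "\<And>f. alternating_multilinear sV (*) (length ys) f \<Longrightarrow> f xs = c * f ys"
proof -
  have "\<exists>c :: 'a. (c = 1 \<or> c = -1) \<and>
      (\<forall>f. alternating_multilinear sV (*) (length ys) f \<longrightarrow> f xs = c * f ys)"
    using assms
  proof (induction ys arbitrary: xs)
    case Nil
    then show ?case by (intro exI[of _ 1]) simp
  next
    case (Cons y ys)
    have "y \<in> set xs" using Cons.prems by (metis list.set_intros(1) set_mset_mset)
    then obtain as bs where xs: "xs = as @ y # bs" by (meson split_list)
    then have ms: "mset (as @ bs) = mset ys" using Cons.prems by simp
    then have len: "length as + length bs = length ys" by (metis length_append mset_eq_length)
    from Cons.IH[OF ms] obtain c :: 'a where c: "c = 1 \<or> c = -1"
      "\<And>f. alternating_multilinear sV (*) (length ys) f \<Longrightarrow> f (as @ bs) = c * f ys" by blast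
    show ?case
    proof (intro exI[of _ "(-1) ^ length as * c"] conjI allI impI)
      show "(-1) ^ length as * c = 1 \<or> (-1) ^ length as * c = -1"
        using c(1) by (cases "even (length as)") auto
      fix f assume f: "alternating_multilinear sV (*) (length (y # ys)) f"
      then have f': "alternating_multilinear sV (*) (Suc (length ys)) f" by simp
      show "f xs = (-1) ^ length as * c * f (y # ys)"
        using alternating_move_front[OF f', of as bs y] len xs c(2)[OF alternating_Cons[OF f'], of y]
        by simp
    qed
  qed
  then show ?thesis using that by blast
qed

lemma alternating_eq_0_permute:
  assumes "alternating_multilinear sV ((*) :: 'a::field \<Rightarrow> _) k f" and "mset xs = mset ys"
    and "length ys = k" and "f ys = 0"
  shows "f xs = 0"
proof -
  obtain c :: 'a where
    "\<And>f. alternating_multilinear sV (*) (length ys) f \<Longrightarrow> f xs = c * f ys"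
    using alternating_permute[OF assms(2)] by blast
  from this[of f] show ?thesis using assms by simp
qed

text \<open>Multilinearity replaces the arguments from left to right by generators; in the inner
  induction \<open>xs\<close> holds those already replaced.\<close>

lemma alternating_span_eq_0:
  assumes f: "alternating_multilinear sV ((*) :: 'a::field \<Rightarrow> _) k f" and V: "vector_space sV"
    and X: "\<And>zs. length zs = k \<Longrightarrow> set zs \<subseteq> X \<Longrightarrow> distinct zs \<Longrightarrow> f zs = 0"
    and vs: "length vs = k" "set vs \<subseteq> module.span sV X"
  shows "f vs = 0"
proof -
  interpret vector_space sV by fact
  interpret vector_space_pair sV "(*) :: 'a \<Rightarrow> 'a \<Rightarrow> 'a"
    by (intro vector_space_pair.intro V vector_space_over_itself.vector_space_axioms)
  have X': "f zs = 0" if "length zs = k" "set zs \<subseteq> X" for zs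
    using X[OF that] alternating_not_distinct[OF f that(1)] by blast
  have "length xs + length us = k \<Longrightarrow> set xs \<subseteq> X \<Longrightarrow> set us \<subseteq> span X \<Longrightarrow> f (xs @ us) = 0" for xs us
  proof (induction us arbitrary: xs)
    case Nil
    then show ?case using X' by simp
  next
    case (Cons u us)
    have lin: "Vector_Spaces.linear sV (*) (\<lambda>x. f (xs @ x # us))"
      by (rule alternating_linear_append[OF f]) (use Cons.prems in simp)
    have "f (xs @ x # us) = 0" if "x \<in> X" for x
      using Cons.IH[of "xs @ [x]"] Cons.prems that by simp
    then show ?case using linear_eq_0_on_span[OF lin, of X u] Cons.prems by simp
  qed
  from this[of "[]" vs] vs show ?thesis by simp
qed

lemma alternating_span_eq:
  assumes f: "alternating_multilinear sV ((*) :: 'a::field \<Rightarrow> _) k f"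
    and g: "alternating_multilinear sV (*) k g" and V: "vector_space sV"
    and "\<And>zs. length zs = k \<Longrightarrow> set zs \<subseteq> X \<Longrightarrow> distinct zs \<Longrightarrow> f zs = g zs"
    and "length vs = k" "set vs \<subseteq> module.span sV X"
  shows "f vs = g vs"
  using alternating_span_eq_0[OF alternating_diff[OF f g] V, of X vs] assms by simp

section \<open>Nondegenerate subspaces\<close>

text \<open>Only the polar form is kept. Algebraic closedness enters through square roots, which
  give isotropic vectors and vectors of square 1.\<close>

locale quad_space = finite_dimensional_vector_space scale Bas
  for scale :: "'a::alg_closed_field \<Rightarrow> 'v::ab_group_add \<Rightarrow> 'v" (infixr "\<cdot>" 75)
    and Bas :: "'v set" +
  fixes B :: "'v \<Rightarrow> 'v \<Rightarrow> 'a"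
  assumes B_sym: "B x y = B y x"
    and B_add [simp]: "B (x + y) z = B x z + B y z"
    and B_scale [simp]: "B (c \<cdot> x) z = c * B x z"
    and B_nondegenerate: "(\<And>y. B x y = 0) \<Longrightarrow> x = 0"
    and two_neq_0: "(2 :: 'a) \<noteq> 0"
begin

lemma linear_B: "Vector_Spaces.linear scale (*) (\<lambda>x. B x y)"
  by unfold_locales (simp_all add: algebra_simps)

lemma linear_B': "Vector_Spaces.linear scale (*) (B y)"
proof -
  have "(\<lambda>x. B x y) = B y" by (rule ext) (rule B_sym)
  then show ?thesis using linear_B[of y] by simp
qed

lemma B_add' [simp]: "B z (x + y) = B z x + B z y"
  by (simp add: B_sym[of z])

lemma B_scale' [simp]: "B z (c \<cdot> x) = c * B z x"
  by (simp add: B_sym[of z])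

lemma B_0 [simp]: "B 0 z = 0" and B_0' [simp]: "B z 0 = 0"
  using B_scale[of 0 0 z] B_scale'[of z 0 0] by simp_all

lemma B_minus [simp]: "B (- x) z = - B x z" and B_minus' [simp]: "B z (- x) = - B z x"
  using B_scale[of "-1" x z] B_scale'[of z "-1" x] by simp_all

lemma B_diff [simp]: "B (x - y) z = B x z - B y z" and B_diff' [simp]: "B z (x - y) = B z x - B z y"
  using B_add[of x "- y" z] B_add'[of z x "- y"] by simp_all

lemma B_sum: "B (\<Sum>i\<in>I. g i) z = (\<Sum>i\<in>I. B (g i) z)"
  by (induction I rule: infinite_finite_induct) simp_all

lemma B_sum': "B z (\<Sum>i\<in>I. g i) = (\<Sum>i\<in>I. B z (g i))"
  by (induction I rule: infinite_finite_induct) simp_all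

definition perp :: "'v \<Rightarrow> 'v set" where
  "perp x = {y. B x y = 0}"

lemma mem_perp [simp]: "y \<in> perp x \<longleftrightarrow> B x y = 0"
  by (simp add: perp_def)

lemma subspace_perp: "subspace (perp x)"
  by (auto simp: subspace_def)

lemma B_eq_0_span:
  assumes "\<And>y. y \<in> X \<Longrightarrow> B x y = 0" and "y \<in> span X"
  shows "B x y = 0"
proof -
  have "X \<subseteq> perp x" using assms(1) by auto
  then show ?thesis using span_minimal[OF _ subspace_perp] assms(2) by (auto simp: subset_iff)
qed

definition nondeg :: "'v set \<Rightarrow> bool" where
  "nondeg S \<longleftrightarrow> subspace S \<and> (\<forall>x\<in>S. (\<forall>y\<in>S. B x y = 0) \<longrightarrow> x = 0)"

lemma nondeg_UNIV: "nondeg UNIV"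
  using B_nondegenerate by (simp add: nondeg_def)

lemma nondeg_subspace: "nondeg S \<Longrightarrow> subspace S"
  by (simp add: nondeg_def)

lemma nondegD: "nondeg S \<Longrightarrow> x \<in> S \<Longrightarrow> (\<And>y. y \<in> S \<Longrightarrow> B x y = 0) \<Longrightarrow> x = 0"
  by (simp add: nondeg_def)

lemma nondeg_perp:
  assumes S: "nondeg S" and v: "v \<in> S" "B v v \<noteq> 0"
  shows "nondeg (S \<inter> perp v)" and "dim S = Suc (dim (S \<inter> perp v))"
proof -
  have sub: "subspace (S \<inter> perp v)"
    using S by (intro subspace_inter nondeg_subspace subspace_perp)
  \<comment> \<open>Orthogonal projection along \<open>v\<close>, possible since
    \<open>B v v\<close> is nonzero.\<close>
  have proj: "x - (B v x / B v v) \<cdot> v \<in> S \<inter> perp v" if "x \<in> S" for x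
    using that v subspace_diff[OF nondeg_subspace[OF S] that]
      subspace_scale[OF nondeg_subspace[OF S] v(1)] by simp
  show "nondeg (S \<inter> perp v)"
    unfolding nondeg_def
  proof (intro conjI ballI impI sub)
    fix x assume x: "x \<in> S \<inter> perp v" "\<forall>y\<in>S \<inter> perp v. B x y = 0"
    show "x = 0"
    proof (rule nondegD[OF S])
      show "x \<in> S" using x by simp
      fix y assume "y \<in> S"
      have "B x v = 0" using x(1) B_sym[of v x] by simp
      then have "B x y = B x (y - (B v y / B v v) \<cdot> v)" by simp
      also have "\<dots> = 0" using x(2) proj[OF \<open>y \<in> S\<close>] by blast
      finally show "B x y = 0" .
    qed
  qed
  have nin: "v \<notin> span (S \<inter> perp v)"
    unfolding span_eq_iff[THEN iffD2, OF sub] using v(2) by simp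
  have "span (insert v (S \<inter> perp v)) = S"
  proof
    show "span (insert v (S \<inter> perp v)) \<subseteq> S"
      by (rule span_minimal) (use v S in \<open>auto simp: nondeg_subspace\<close>)
    show "S \<subseteq> span (insert v (S \<inter> perp v))"
      unfolding span_insert using span_base[OF proj] by blast
  qed
  then have "dim S = dim (insert v (S \<inter> perp v))" by (metis dim_span)
  also have "\<dots> = Suc (dim (S \<inter> perp v))" using nin by (simp add: dim_insert)
  finally show "dim S = Suc (dim (S \<inter> perp v))" .
qed

text \<open>The last claim gives the orthogonal projection along the plane of \<open>e\<close> and
  \<open>f\<close>; it yields both nondegeneracy and the dimension count.\<close>

lemma hyperbolic_pair_complement:
  assumes S: "nondeg S" and ef: "e \<in> S" "f \<in> S" "B e e = 0" "B f f = 0" "B e f = 1"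
  shows "nondeg (S \<inter> perp e \<inter> perp f)" and "dim S = dim (S \<inter> perp e \<inter> perp f) + 2"
    and "x \<in> S \<Longrightarrow> x - B x f \<cdot> e - B x e \<cdot> f \<in> S \<inter> perp e \<inter> perp f"
proof -
  let ?S = "S \<inter> perp e \<inter> perp f"
  have subS: "subspace S" using S by (rule nondeg_subspace)
  have fe: "B f e = 1" using ef B_sym by metis
  have sub: "subspace ?S" by (intro subspace_inter subS subspace_perp)
  show proj: "x - B x f \<cdot> e - B x e \<cdot> f \<in> ?S" if "x \<in> S" for x
    using that ef fe subspace_diff[OF subS] subspace_scale[OF subS]
    by (simp add: B_sym[of x])
  show "nondeg ?S"
    unfolding nondeg_def
  proof (intro conjI ballI impI sub)
    fix x assume x: "x \<in> ?S" "\<forall>y\<in>?S. B x y = 0"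
    show "x = 0"
    proof (rule nondegD[OF S])
      show "x \<in> S" using x by simp
      fix y assume "y \<in> S"
      have "B x y = B x (y - B y f \<cdot> e - B y e \<cdot> f)"
        using x by (simp add: B_sym[of x e] B_sym[of x f])
      also have "\<dots> = 0" using x(2) proj[OF \<open>y \<in> S\<close>] by blast
      finally show "B x y = 0" .
    qed
  qed
  have span: "span ?S = ?S" by (simp only: span_eq_iff sub)
  have f: "f \<notin> span ?S" unfolding span using ef(5) by simp
  have e: "e \<notin> span (insert f ?S)"
  proof
    assume "e \<in> span (insert f ?S)"
    then obtain k where "e - k \<cdot> f \<in> ?S" unfolding span_insert span by auto
    then have "B e (e - k \<cdot> f) = 0" "B f (e - k \<cdot> f) = 0" by simp_all
    then show False using ef fe by simp
  qed
  have "span (insert e (insert f ?S)) = S"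
  proof
    show "span (insert e (insert f ?S)) \<subseteq> S"
      by (rule span_minimal) (use ef subS in auto)
    have "x \<in> span (insert e (insert f ?S))" if "x \<in> S" for x
      unfolding span_insert[of e] span_insert[of f] using span_base[OF proj[OF that]] by auto
    then show "S \<subseteq> span (insert e (insert f ?S))" by blast
  qed
  then have "dim S = dim (insert e (insert f ?S))" by (metis dim_span)
  also have "\<dots> = dim ?S + 2" using e f by (simp add: dim_insert)
  finally show "dim S = dim ?S + 2" .
qed

text \<open>For orthogonal \<open>z\<close> and \<open>x\<close> with \<open>B x x\<close> nonzero,
  \<open>z + c x\<close> is isotropic as soon as \<open>c\<close> solves a quadratic equation, which
  an algebraically closed field permits.\<close>

lemma ex_isotropic:
  assumes S: "nondeg S" and d: "dim S \<ge> 2"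
  shows "\<exists>e\<in>S. e \<noteq> 0 \<and> B e e = 0"
proof -
  have subS: "subspace S" using S by (rule nondeg_subspace)
  have "\<not> S \<subseteq> {0}" using d dim_eq_0[of S] by linarith
  then obtain x where x: "x \<in> S" "x \<noteq> 0" by blast
  have "\<not> S \<subseteq> span {x}"
  proof
    assume "S \<subseteq> span {x}"
    then have "dim S \<le> dim {x}" by (rule dim_mono)
    then show False using d x by simp
  qed
  then obtain y where y: "y \<in> S" "y \<notin> span {x}" by blast
  show ?thesis
  proof (cases "B x x = 0")
    case False
    define z where "z = y - (B x y / B x x) \<cdot> x"
    obtain c where c: "c ^ 2 = - B z z / B x x"
      using nth_root_exists[of 2 "- B z z / B x x"] by auto
    have xz: "B x z = 0" using False by (simp add: z_def)
    have "z + c \<cdot> x \<noteq> 0"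
    proof
      assume "z + c \<cdot> x = 0"
      then have "y = (B x y / B x x - c) \<cdot> x"
        by (simp add: z_def algebra_simps)
      then show False using y(2) by (metis span_base span_scale singletonI)
    qed
    moreover have "B (z + c \<cdot> x) (z + c \<cdot> x) = 0"
    proof -
      have "B (z + c \<cdot> x) (z + c \<cdot> x) = B z z + c ^ 2 * B x x"
        using xz by (simp add: B_sym[of z x] power2_eq_square algebra_simps)
      then show ?thesis using c False by simp
    qed
    moreover have "z + c \<cdot> x \<in> S"
      unfolding z_def using x y subS by (intro subspace_add subspace_diff subspace_scale)
    ultimately show ?thesis by blast
  qed (use x in blast)
qed

lemma ex_hyperbolic_partner:
  assumes S: "nondeg S" and e: "e \<in> S" "e \<noteq> 0" "B e e = 0"
  shows "\<exists>f\<in>S. B f f = 0 \<and> B e f = 1"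
proof -
  have subS: "subspace S" using S by (rule nondeg_subspace)
  obtain y where y: "y \<in> S" "B e y \<noteq> 0" using nondegD[OF S e(1)] e(2) by blast
  define z where "z = (1 / B e y) \<cdot> y"
  \<comment> \<open>A multiple of \<open>e\<close> does not affect the pairing with
    \<open>e\<close>; the factor is one half because the cross term counts twice.\<close>
  define f where "f = z - (B z z / 2) \<cdot> e"
  have ez: "B e z = 1" using y by (simp add: z_def)
  have "f \<in> S" unfolding f_def z_def
    by (intro subspace_diff subspace_scale subS y e)
  moreover have "B e f = 1" using ez e by (simp add: f_def)
  moreover have "B f f = 0"
  proof -
    have "B f f = B z z - 2 * (B z z / 2)"
      using ez e B_sym[of z e] unfolding f_def by simp
    then show ?thesis using two_neq_0 by simp
  qed
  ultimately show ?thesis by blast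
qed

section \<open>Hyperbolic bases\<close>

definition hyperbolic :: "nat \<Rightarrow> (nat \<Rightarrow> 'v) \<Rightarrow> (nat \<Rightarrow> 'v) \<Rightarrow> bool" where
  "hyperbolic p e f \<longleftrightarrow> (\<forall>i<p. \<forall>j<p. B (e i) (e j) = 0 \<and> B (f i) (f j) = 0 \<and>
     B (e i) (f j) = (if i = j then 1 else 0))"

definition hproj :: "nat \<Rightarrow> (nat \<Rightarrow> 'v) \<Rightarrow> (nat \<Rightarrow> 'v) \<Rightarrow> 'v \<Rightarrow> 'v" where
  "hproj p e f x = (\<Sum>i<p. B x (f i) \<cdot> e i + B x (e i) \<cdot> f i)"

lemma hyperbolicD:
  assumes "hyperbolic p e f" "i < p" "j < p"
  shows "B (e i) (e j) = 0" "B (f i) (f j) = 0" "B (e i) (f j) = (if i = j then 1 else 0)"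
    "B (f i) (e j) = (if i = j then 1 else 0)"
  using assms B_sym[of "f i" "e j"] by (auto simp: hyperbolic_def)

lemma B_hproj:
  assumes "hyperbolic p e f" "j < p"
  shows "B (e j) (hproj p e f x) = B (e j) x" "B (f j) (hproj p e f x) = B (f j) x"
proof -
  have "B (e j) (hproj p e f x) = (\<Sum>i<p. if i = j then B x (e i) else 0)"
    unfolding hproj_def B_sum' by (rule sum.cong) (use assms in \<open>auto simp: hyperbolicD\<close>)
  then show "B (e j) (hproj p e f x) = B (e j) x" using assms by (simp add: B_sym)
  have "B (f j) (hproj p e f x) = (\<Sum>i<p. if i = j then B x (f i) else 0)"
    unfolding hproj_def B_sum' by (rule sum.cong) (use assms in \<open>auto simp: hyperbolicD\<close>)
  then show "B (f j) (hproj p e f x) = B (f j) x" using assms by (simp add: B_sym)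
qed

lemma hproj_in:
  assumes "subspace S" "e ` {..<p} \<subseteq> S" "f ` {..<p} \<subseteq> S"
  shows "hproj p e f x \<in> S"
  unfolding hproj_def using assms by (intro subspace_sum subspace_add subspace_scale) auto

definition hcompl :: "'v set \<Rightarrow> nat \<Rightarrow> (nat \<Rightarrow> 'v) \<Rightarrow> (nat \<Rightarrow> 'v) \<Rightarrow> 'v set" where
  "hcompl S p e f = {x \<in> S. \<forall>i<p. B (e i) x = 0 \<and> B (f i) x = 0}"

lemma hcompl_nondeg:
  assumes "nondeg S" "hyperbolic p e f" "e ` {..<p} \<subseteq> S" "f ` {..<p} \<subseteq> S"
  shows "nondeg (hcompl S p e f) \<and> dim S = dim (hcompl S p e f) + 2 * p"
  using assms
proof (induction p)
  case 0
  then show ?case by (simp add: hcompl_def)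
next
  case (Suc p)
  let ?S = "hcompl S p e f"
  have hyp: "hyperbolic p e f" using Suc.prems(2) by (auto simp: hyperbolic_def)
  have IH: "nondeg ?S" "dim S = dim ?S + 2 * p"
    using Suc.IH[OF Suc.prems(1) hyp] Suc.prems(3,4) by (simp_all add: lessThan_Suc)
  have "e p \<in> ?S" "f p \<in> ?S"
    using Suc.prems by (auto simp: hcompl_def hyperbolicD[OF Suc.prems(2)])
  moreover have "B (e p) (e p) = 0" "B (f p) (f p) = 0" "B (e p) (f p) = 1"
    using hyperbolicD[OF Suc.prems(2), of p p] by auto
  ultimately have "nondeg (?S \<inter> perp (e p) \<inter> perp (f p))"
    "dim ?S = dim (?S \<inter> perp (e p) \<inter> perp (f p)) + 2"
    using hyperbolic_pair_complement[OF IH(1)] by blast+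
  moreover have "?S \<inter> perp (e p) \<inter> perp (f p) = hcompl S (Suc p) e f"
    by (auto simp: hcompl_def less_Suc_eq)
  ultimately show ?case using IH(2) by simp
qed

lemma diff_hproj_in_hcompl:
  assumes "subspace S" "hyperbolic p e f" "e ` {..<p} \<subseteq> S" "f ` {..<p} \<subseteq> S" "x \<in> S"
  shows "x - hproj p e f x \<in> hcompl S p e f"
  using assms by (auto simp: hcompl_def B_hproj intro!: subspace_diff hproj_in)

text \<open>In even dimension \<open>h\<close> is 0 instead of absent, so that a single expansion
  formula serves both parities.\<close>

definition frame :: "'v set \<Rightarrow> nat \<Rightarrow> (nat \<Rightarrow> 'v) \<Rightarrow> (nat \<Rightarrow> 'v) \<Rightarrow> 'v \<Rightarrow> bool" where
  "frame S p e f h \<longleftrightarrow> hyperbolic p e f \<and> e ` {..<p} \<subseteq> S \<and> f ` {..<p} \<subseteq> S \<and>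
     h \<in> hcompl S p e f \<and> dim S div 2 = p \<and> (if odd (dim S) then B h h = 1 else h = 0) \<and>
     (\<forall>x\<in>S. x = hproj p e f x + B x h \<cdot> h)"

lemma frameD:
  assumes "frame S p e f h"
  shows "hyperbolic p e f" "i < p \<Longrightarrow> e i \<in> S" "i < p \<Longrightarrow> f i \<in> S" "h \<in> S"
    "i < p \<Longrightarrow> B h (e i) = 0" "i < p \<Longrightarrow> B h (f i) = 0"
    "i < p \<Longrightarrow> B (e i) h = 0" "i < p \<Longrightarrow> B (f i) h = 0"
    "dim S div 2 = p" "odd (dim S) \<Longrightarrow> B h h = 1" "even (dim S) \<Longrightarrow> h = 0"
    "x \<in> S \<Longrightarrow> x = hproj p e f x + B x h \<cdot> h"
proof -
  have *: "h \<in> hcompl S p e f" using assms by (simp only: frame_def)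
  show "hyperbolic p e f" "i < p \<Longrightarrow> e i \<in> S" "i < p \<Longrightarrow> f i \<in> S"
    using assms unfolding frame_def by blast+
  show "h \<in> S" "i < p \<Longrightarrow> B (e i) h = 0" "i < p \<Longrightarrow> B (f i) h = 0"
    using * by (simp_all add: hcompl_def)
  then show "i < p \<Longrightarrow> B h (e i) = 0" "i < p \<Longrightarrow> B h (f i) = 0"
    by (simp_all only: B_sym[of h "e i"] B_sym[of h "f i"])
  show "dim S div 2 = p" "odd (dim S) \<Longrightarrow> B h h = 1" "even (dim S) \<Longrightarrow> h = 0"
    using assms unfolding frame_def by argo+
  show "x \<in> S \<Longrightarrow> x = hproj p e f x + B x h \<cdot> h"
    using assms unfolding frame_def by blast
qed

text \<open>The complement of the hyperbolic part is nondegenerate of dimension 0 or 1. In the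
  latter case its generator has nonzero square, and a square root normalises it to
  \<open>h\<close>.\<close>

lemma frame_hyperbolic:
  assumes S: "nondeg S" and hyp: "hyperbolic p e f" and in_S: "e ` {..<p} \<subseteq> S" "f ` {..<p} \<subseteq> S"
    and p: "dim S div 2 = p"
  shows "\<exists>h. frame S p e f h"
proof -
  let ?S = "hcompl S p e f"
  have S': "nondeg ?S" and d: "dim S = dim ?S + 2 * p" using hcompl_nondeg[OF assms(1-4)] by auto
  have proj: "x - hproj p e f x \<in> ?S" if "x \<in> S" for x
    using diff_hproj_in_hcompl[OF nondeg_subspace[OF S] hyp in_S that] .
  show ?thesis
  proof (cases "odd (dim S)")
    case False
    then have "2 * (dim S div 2) = dim S" by (simp only: not_not even_two_times_div_two)
    then have "dim ?S = 0" using d p by linarith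
    then have "?S \<subseteq> {0}" by simp
    moreover have "0 \<in> ?S" using nondeg_subspace[OF S'] subspace_0 by blast
    ultimately have "?S = {0}" by blast
    have "hproj p e f x = x" if "x \<in> S" for x
      using proj[OF that] \<open>?S = {0}\<close> by simp
    then have "\<forall>x\<in>S. x = hproj p e f x + B x 0 \<cdot> 0" by simp
    moreover have "if odd (dim S) then B 0 0 = 1 else (0 :: 'v) = 0" using False by simp
    ultimately have "frame S p e f 0"
      using hyp in_S p \<open>0 \<in> ?S\<close> unfolding frame_def by blast
    then show ?thesis by blast
  next
    case True
    then have "2 * (dim S div 2) + 1 = dim S" by (rule odd_two_times_div_two_succ)
    then have d1: "dim ?S = 1" using d p by linarith
    then obtain b where b: "b \<in> ?S" "b \<noteq> 0" using dim_eq_0[of ?S] by fastforce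
    then have bb: "dim ?S \<le> dim {b}" using d1 by simp
    have span: "?S \<subseteq> span {b}"
    proof -
      have "span {b} = span ?S"
        by (rule dim_eq_span) (use b bb in auto)
      then show ?thesis using span_superset by blast
    qed
    have "B b b \<noteq> 0"
    proof
      assume "B b b = 0"
      then have "B b y = 0" if "y \<in> ?S" for y
        using B_eq_0_span[of "{b}" b y] span that by auto
      then show False using nondegD[OF S' b(1)] b(2) by blast
    qed
    obtain c where c: "c ^ 2 = 1 / B b b" using nth_root_exists[of 2 "1 / B b b"] by auto
    then have c0: "c \<noteq> 0" using \<open>B b b \<noteq> 0\<close> by auto
    define h where "h = c \<cdot> b"
    have "h \<in> ?S" unfolding h_def using b(1) nondeg_subspace[OF S'] by (simp add: subspace_scale)
    have hh: "B h h = 1" using c \<open>B b b \<noteq> 0\<close>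
      by (simp add: h_def power2_eq_square mult.assoc[symmetric])
    have *: "y = B y h \<cdot> h" if y: "y \<in> ?S" for y
    proof -
      obtain k where "y = k \<cdot> b" using y span unfolding span_singleton by blast
      then have "y = (k / c) \<cdot> h" using c0 by (simp add: h_def)
      then show ?thesis using hh by simp
    qed
    have "x = hproj p e f x + B x h \<cdot> h" if "x \<in> S" for x
    proof -
      have "B (hproj p e f x) h = 0"
        using \<open>h \<in> ?S\<close> unfolding hproj_def B_sum hcompl_def by simp
      then show ?thesis using *[OF proj[OF that]] by (simp add: algebra_simps)
    qed
    moreover have "if odd (dim S) then B h h = 1 else h = 0" using True hh by simp
    ultimately have "frame S p e f h"
      using hyp in_S p \<open>h \<in> ?S\<close> unfolding frame_def by blast
    then show ?thesis by blast
  qed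
qed

text \<open>Hyperbolic planes are split off as long as the complement has dimension at least 2 and
  hence contains an isotropic vector.\<close>

lemma ex_frame:
  assumes "nondeg S"
  shows "\<exists>e f h. frame S (dim S div 2) e f h"
proof -
  have "\<exists>e f. hyperbolic p e f \<and> e ` {..<p} \<subseteq> S \<and> f ` {..<p} \<subseteq> S"
    if "2 * p \<le> dim S" for p
    using that
  proof (induction p)
    case 0
    then show ?case by (simp add: hyperbolic_def)
  next
    case (Suc p)
    then obtain e f where ef: "hyperbolic p e f" "e ` {..<p} \<subseteq> S" "f ` {..<p} \<subseteq> S" by auto
    let ?S = "hcompl S p e f"
    have S': "nondeg ?S" "dim S = dim ?S + 2 * p" using hcompl_nondeg[OF assms ef] by auto
    obtain e' where e': "e' \<in> ?S" "e' \<noteq> 0" "B e' e' = 0"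
      using ex_isotropic[OF S'(1)] Suc.prems S'(2) by auto
    obtain f' where f': "f' \<in> ?S" "B f' f' = 0" "B e' f' = 1"
      using ex_hyperbolic_partner[OF S'(1) e'] by auto
    have "hyperbolic (Suc p) (e(p := e')) (f(p := f'))"
      using ef(1) e' f' B_sym unfolding hyperbolic_def hcompl_def
      by (auto simp: less_Suc_eq)
    moreover have "e(p := e') ` {..<Suc p} \<subseteq> S" "f(p := f') ` {..<Suc p} \<subseteq> S"
      using ef e' f' by (auto simp: hcompl_def less_Suc_eq)
    ultimately show ?case by blast
  qed
  from this[of "dim S div 2"] obtain e f where
    "hyperbolic (dim S div 2) e f" "e ` {..<dim S div 2} \<subseteq> S" "f ` {..<dim S div 2} \<subseteq> S"
    by auto
  from frame_hyperbolic[OF assms this refl] show ?thesis by blast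
qed

lemma frame_span:
  assumes "frame S p e f h" "x \<in> S"
  shows "x \<in> span (e ` {..<p} \<union> f ` {..<p} \<union> {h})"
proof -
  have "hproj p e f x + B x h \<cdot> h \<in> span (e ` {..<p} \<union> f ` {..<p} \<union> {h})"
    by (intro span_add span_scale hproj_in) (auto intro: span_base)
  then show ?thesis using frameD(12)[OF assms] by simp
qed

lemma riesz:
  assumes S: "nondeg S" and l: "Vector_Spaces.linear scale (*) l"
  shows "\<exists>w\<in>S. \<forall>x\<in>S. B w x = l x"
proof -
  interpret l: Vector_Spaces.linear scale "(*)" l by fact
  obtain p e f h where fr: "frame S p e f h" using ex_frame[OF S] by blast
  \<comment> \<open>As \<open>e\<close> and \<open>f\<close> are dual to each other and
    \<open>h\<close> to itself, each coefficient is the value of \<open>l\<close> at the partner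
    vector.\<close>
  define w where "w = (\<Sum>i<p. l (f i) \<cdot> e i + l (e i) \<cdot> f i) + l h \<cdot> h"
  have "w \<in> S" unfolding w_def using fr nondeg_subspace[OF S]
    by (intro subspace_add subspace_scale subspace_sum) (auto simp: frameD)
  moreover have "B w x = l x" if "x \<in> S" for x
  proof -
    have "l x = l (hproj p e f x) + B x h * l h"
      by (subst frameD(12)[OF fr that]) (simp add: l.add l.scale)
    then show ?thesis
      by (simp add: w_def hproj_def B_sum l.sum l.add l.scale B_sym[of x] algebra_simps)
  qed
  ultimately show ?thesis by blast
qed

end

section \<open>Forms with isotropic support\<close>

context quad_space
begin

section \<open>Gram determinants and forms with isotropic support\<close>

lemma half_add_half: "c / 2 + c / 2 = (c :: 'a)"
  using two_neq_0 by (simp flip: mult_2)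

text \<open>The form that \<open>B\<close> induces on the exterior power, evaluated at the wedge
  products of \<open>vs\<close> and \<open>us\<close>.\<close>

definition gram_det :: "'v list \<Rightarrow> 'v list \<Rightarrow> 'a" where
  "gram_det vs us = det (mat (length vs) (length vs) (\<lambda>(i, j). B (vs ! i) (us ! j)))"

lemma gram_det_sym: "length vs = length us \<Longrightarrow> gram_det vs us = gram_det us vs"
  unfolding gram_det_def
  by (subst det_transpose[symmetric, where n = "length us"])
    (auto intro!: arg_cong[of _ _ det] eq_matI B_sym)

text \<open>Laplace expansion along the column of \<open>x\<close>: the cofactors do not involve
  \<open>x\<close> and become the coefficients of \<open>w\<close>. So the support of a decomposable
  form lies in the span of its factors.\<close>

lemma gram_det_expand:
  assumes "Suc (length xs + length ys) = length vs"
  shows "\<exists>w\<in>span (set vs). \<forall>x. gram_det vs (xs @ x # ys) = B w x"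
proof -
  define A where "A x = mat (length vs) (length vs) (\<lambda>(i, j). B (vs ! i) ((xs @ x # ys) ! j))" for x
  have A: "A x \<in> carrier_mat (length vs) (length vs)" for x by (simp add: A_def)
  have len: "length xs < length vs" using assms by simp
  have cof: "cofactor (A x) i (length xs) = cofactor (A 0) i (length xs)" if "i < length vs" for i x
    unfolding cofactor_def mat_delete_def A_def
    by (auto intro!: arg_cong[of _ _ det] eq_matI simp: nth_append nth_Cons')
  define w where "w = (\<Sum>i<length vs. cofactor (A 0) i (length xs) \<cdot> vs ! i)"
  have "w \<in> span (set vs)"
    unfolding w_def by (intro span_sum span_scale span_base) simp
  moreover have "gram_det vs (xs @ x # ys) = B w x" for x
  proof -
    have "gram_det vs (xs @ x # ys) =
        (\<Sum>i<length vs. A x $$ (i, length xs) * cofactor (A x) i (length xs))"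
      using laplace_expansion_column[OF A len] by (simp add: gram_det_def A_def)
    also have "\<dots> = (\<Sum>i<length vs. B (vs ! i) x * cofactor (A 0) i (length xs))"
    proof (rule sum.cong)
      fix i assume "i \<in> {..<length vs}"
      moreover from this have "A x $$ (i, length xs) = B (vs ! i) x" using len by (simp add: A_def)
      ultimately show "A x $$ (i, length xs) * cofactor (A x) i (length xs) =
          B (vs ! i) x * cofactor (A 0) i (length xs)"
        using cof[of i x] by simp
    qed simp
    finally show ?thesis by (simp add: w_def B_sum mult.commute)
  qed
  ultimately show ?thesis by blast
qed

lemma alternating_gram_det: "alternating_multilinear scale (*) (length vs) (gram_det vs)"
proof (rule alternating_multilinearI)
  fix xs ys :: "'v list" assume "Suc (length xs + length ys) = length vs"
  then obtain w where "\<forall>x. gram_det vs (xs @ x # ys) = B w x" using gram_det_expand by blast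
  then show "Vector_Spaces.linear scale (*) (\<lambda>x. gram_det vs (xs @ x # ys))"
    using linear_B'[of w] by simp
next
  fix us :: "'v list" and i j
  assume *: "length us = length vs" "i < j" "j < length vs" "us ! i = us ! j"
  show "gram_det vs us = 0"
    unfolding gram_det_def
    by (rule det_identical_columns[of _ "length vs" i j])
      (use * in \<open>auto intro!: eq_vecI\<close>)
qed

lemma alternating_gram_det_left:
  "alternating_multilinear scale (*) (length us) (\<lambda>vs. gram_det vs us)"
proof -
  have "gram_det us vs = gram_det vs us" if "length vs = length us" for vs
    by (rule gram_det_sym) (use that in simp)
  then show ?thesis
    using alternating_gram_det[of us] unfolding alternating_multilinear_def by auto
qed

lemma gram_det_eq_0:
  assumes "length us = length vs" "u \<in> set us" "\<And>v. v \<in> set vs \<Longrightarrow> B v u = 0"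
  shows "gram_det vs us = 0"
proof -
  obtain xs ys where us: "us = xs @ u # ys" using assms(2) by (meson split_list)
  then obtain w where w: "w \<in> span (set vs)" "\<forall>x. gram_det vs (xs @ x # ys) = B w x"
    using gram_det_expand[of xs ys vs] assms(1) by auto
  have "B u w = 0" using B_eq_0_span[of "set vs" u w] w(1) assms(3) B_sym by metis
  then show ?thesis using w(2) us B_sym by metis
qed

lemma gram_det_delta:
  assumes "length us = length vs"
    and "\<And>i j. i < length vs \<Longrightarrow> j < length vs \<Longrightarrow> B (vs ! i) (us ! j) = (if i = j then 1 else 0)"
  shows "gram_det vs us = 1"
proof -
  have "mat (length vs) (length vs) (\<lambda>(i, j). B (vs ! i) (us ! j)) = 1\<^sub>m (length vs)"
    by (rule eq_matI) (use assms in auto)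
  then show ?thesis by (simp add: gram_det_def)
qed

lemma gram_det_Cons:
  assumes len: "length us = length vs" and 0: "\<And>x. x \<in> set us \<Longrightarrow> B v x = 0"
  shows "gram_det (v # vs) (u # us) = B v u * gram_det vs us"
proof -
  define A where "A = mat (Suc (length vs)) (Suc (length vs)) (\<lambda>(i, j). B ((v # vs) ! i) ((u # us) ! j))"
  have A: "A \<in> carrier_mat (Suc (length vs)) (Suc (length vs))" by (simp add: A_def)
  have "gram_det (v # vs) (u # us) = det A" by (simp add: gram_det_def A_def)
  also have "\<dots> = (\<Sum>j<Suc (length vs). A $$ (0, j) * cofactor A 0 j)"
    by (rule laplace_expansion_row[OF A]) simp
  also have "\<dots> = A $$ (0, 0) * cofactor A 0 0"
    using 0 len by (subst sum.lessThan_Suc_shift) (simp add: A_def)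
  also have "cofactor A 0 0 = gram_det vs us"
    unfolding cofactor_def mat_delete_def A_def gram_det_def
    by (auto intro!: arg_cong[of _ _ det] eq_matI)
  finally show ?thesis by (simp add: A_def)
qed

text \<open>The vectors \<open>w\<close> representing \<open>\<lambda>x. f (x # us)\<close> on \<open>S\<close> span the support of \<open>f\<close>; the following
  predicate says that this support is isotropic.  Here \<open>f\<close> is a form in \<open>Suc k\<close> arguments.\<close>

definition iso :: "'v set \<Rightarrow> nat \<Rightarrow> ('v list \<Rightarrow> 'a) \<Rightarrow> bool" where
  "iso S k f \<longleftrightarrow> (\<forall>us us' w. length us = k \<longrightarrow> length us' = k \<longrightarrow> set us \<subseteq> S \<longrightarrow> set us' \<subseteq> S \<longrightarrow>
     w \<in> S \<longrightarrow> (\<forall>x\<in>S. B w x = f (x # us)) \<longrightarrow> f (w # us') = 0)"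

lemma isoI:
  assumes "\<And>us us' w. length us = k \<Longrightarrow> length us' = k \<Longrightarrow> set us \<subseteq> S \<Longrightarrow> set us' \<subseteq> S \<Longrightarrow>
     w \<in> S \<Longrightarrow> (\<And>x. x \<in> S \<Longrightarrow> B w x = f (x # us)) \<Longrightarrow> f (w # us') = 0"
  shows "iso S k f"
  using assms unfolding iso_def by blast

lemma isoD:
  assumes "iso S k f" "length us = k" "length us' = k" "set us \<subseteq> S" "set us' \<subseteq> S"
     "w \<in> S" "\<And>x. x \<in> S \<Longrightarrow> B w x = f (x # us)"
   shows "f (w # us') = 0"
  using assms unfolding iso_def by blast

text \<open>The radical of \<open>f\<close> on \<open>S\<close>; \<open>iso S k f\<close> says that
  every representing vector in \<open>S\<close> belongs to it.\<close>

definition kern :: "'v set \<Rightarrow> nat \<Rightarrow> ('v list \<Rightarrow> 'a) \<Rightarrow> 'v set" where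
  "kern S k f = {n \<in> S. \<forall>us. length us = k \<longrightarrow> set us \<subseteq> S \<longrightarrow> f (n # us) = 0}"

lemma linear_head:
  assumes "alternating_multilinear scale (*) (Suc k) f" "length us = k"
  shows "Vector_Spaces.linear scale (*) (\<lambda>x. f (x # us))"
  using alternating_linear_append[OF assms(1), of "[]" us] assms(2) by simp

lemma isoD_scaled:
  assumes f: "alternating_multilinear scale (*) (Suc k) f" and S: "subspace S"
    and "iso S k f" "length us = k" "length us' = k" "set us \<subseteq> S" "set us' \<subseteq> S"
     "w \<in> S" "\<And>x. x \<in> S \<Longrightarrow> B w x = c * f (x # us)" and c: "c \<noteq> 0"
   shows "f (w # us') = 0"
proof -
  interpret l: Vector_Spaces.linear scale "(*)" "\<lambda>x. f (x # us')"
    using linear_head[OF f] assms(5) .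
  have "f (((1 / c) \<cdot> w) # us') = 0"
    by (rule isoD[OF assms(3,4,5,6,7)]) (use assms subspace_scale[OF S] in auto)
  then show ?thesis using c by (simp add: l.scale)
qed

lemma subspace_kern:
  assumes f: "alternating_multilinear scale (*) (Suc k) f" and S: "subspace S"
  shows "subspace (kern S k f)"
proof (rule subspaceI)
  have lin: "f ((x + y) # us) = f (x # us) + f (y # us)" "f ((c \<cdot> x) # us) = c * f (x # us)"
    "f (0 # us) = 0" if "length us = k" for x y c us
  proof -
    interpret l: Vector_Spaces.linear scale "(*)" "\<lambda>x. f (x # us)"
      using linear_head[OF f that] .
    show "f ((x + y) # us) = f (x # us) + f (y # us)" "f ((c \<cdot> x) # us) = c * f (x # us)"
      "f (0 # us) = 0" by (rule l.add l.scale l.zero)+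
  qed
  show "0 \<in> kern S k f" using lin subspace_0[OF S] by (auto simp: kern_def)
  show "x + y \<in> kern S k f" if "x \<in> kern S k f" "y \<in> kern S k f" for x y
    using that lin subspace_add[OF S] by (auto simp: kern_def)
  show "c \<cdot> x \<in> kern S k f" if "x \<in> kern S k f" for c x
    using that lin subspace_scale[OF S] by (auto simp: kern_def)
qed

lemma kern_eq_0:
  assumes f: "alternating_multilinear scale (*) (Suc k) f"
    and "length zs = Suc k" "set zs \<subseteq> S" "n \<in> set zs" "n \<in> kern S k f"
  shows "f zs = 0"
proof -
  have ms: "mset zs = mset (n # remove1 n zs)" using assms(4) by simp
  have len: "length (n # remove1 n zs) = Suc k"
    using ms assms(2) by (metis mset_eq_length)
  have "f (n # remove1 n zs) = 0"
    using assms(3,5) len unfolding kern_def using set_remove1_subset[of n zs] by auto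
  then show ?thesis by (rule alternating_eq_0_permute[OF f ms len])
qed

text \<open>A form descends to the quotient by its radical. The arguments are exchanged one at a
  time, and \<open>pre\<close> collects those already exchanged.\<close>

lemma alternating_shift:
  assumes f: "alternating_multilinear scale (*) (Suc k) f"
    and "list_all2 (\<lambda>x y. x - y \<in> kern S k f) xs ys"
    and "length pre + length xs = Suc k" "set pre \<subseteq> S" "set xs \<subseteq> S" "set ys \<subseteq> S"
  shows "f (pre @ xs) = f (pre @ ys)"
  using assms(2-)
proof (induction arbitrary: pre rule: list_all2_induct)
  case (Cons x xs y ys)
  have "f (pre @ x # xs) = f (pre @ (y + (x - y)) # xs)" by simp
  also have "\<dots> = f (pre @ y # xs) + f (pre @ (x - y) # xs)"
    by (rule alternating_add[OF f]) (use Cons.prems in simp)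
  also have "f (pre @ (x - y) # xs) = 0"
    by (rule kern_eq_0[OF f, where n = "x - y" and S = S])
      (use Cons.prems Cons.hyps in \<open>auto simp: kern_def\<close>)
  also have "f (pre @ y # xs) = f (pre @ y # ys)"
    using Cons.IH[of "pre @ [y]"] Cons.prems by simp
  finally show ?case by simp
qed simp

section \<open>Hyperbolic bases attached to a form with isotropic support\<close>

definition omit :: "(nat \<Rightarrow> 'b) \<Rightarrow> nat \<Rightarrow> nat \<Rightarrow> 'b list" where
  "omit g p i = map g (filter (\<lambda>j. j \<noteq> i) [0..<p])"

lemma upt_split: "i < p \<Longrightarrow> [0..<p] = [0..<i] @ i # [Suc i..<p]"
  using upt_add_eq_append[of 0 i "p - i"] by (simp add: upt_conv_Cons)

lemma omit_eq: "i < p \<Longrightarrow> omit g p i = map g ([0..<i] @ [Suc i..<p])"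
proof -
  assume i: "i < p"
  then have "[0..<p] = [0..<i] @ i # [Suc i..<p]" by (rule upt_split)
  moreover have "filter (\<lambda>j. j \<noteq> i) [0..<i] = [0..<i]" "filter (\<lambda>j. j \<noteq> i) [Suc i..<p] = [Suc i..<p]"
    by (auto simp: filter_id_conv)
  ultimately show ?thesis by (simp add: omit_def)
qed

lemma length_omit: "i < p \<Longrightarrow> length (omit g p i) = p - 1"
  by (simp add: omit_eq)

lemma set_omit: "set (omit g p i) = g ` ({..<p} - {i})"
  by (auto simp: omit_def)

lemma alternating_omit:
  assumes f: "alternating_multilinear scale (*) p f" and i: "i < p"
  shows "f (g i # omit g p i) = (-1) ^ i * f (map g [0..<p])"
proof -
  have "[0..<p] = [0..<i] @ i # [Suc i..<p]"
    using i by (rule upt_split)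
  then have "f (map g [0..<p]) = f (map g [0..<i] @ g i # map g [Suc i..<p])"
    by simp
  also have "\<dots> = (-1) ^ i * f (g i # omit g p i)"
    using alternating_move_front[OF f, of "map g [0..<i]" "map g [Suc i..<p]"] i
    by (simp add: omit_eq)
  finally show ?thesis by (simp flip: mult.assoc power_add)
qed

text \<open>With the signs chosen, the vectors \<open>e i\<close> that represent \<open>f\<close>
  with one argument of \<open>as\<close> omitted are dual to \<open>as\<close>, because
  \<open>f as = 1\<close>. Isotropy of the support puts them into the radical, so they are mutually
  orthogonal, and \<open>as\<close> can be made isotropic by adding combinations of them without
  affecting \<open>f\<close>.\<close>

lemma support_hyperbolic:
  assumes S: "nondeg S" and f: "alternating_multilinear scale (*) (Suc k) f" and iso: "iso S k f"
    and as: "length as = Suc k" "set as \<subseteq> S" "f as = 1"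
  shows "\<exists>e g. hyperbolic (Suc k) e g \<and> e ` {..<Suc k} \<subseteq> S \<and> g ` {..<Suc k} \<subseteq> S \<and>
    e ` {..<Suc k} \<subseteq> kern S k f \<and> f (map g [0..<Suc k]) = 1 \<and>
    (\<forall>i<Suc k. \<forall>x\<in>S. B (e i) x = (-1) ^ i * f (x # omit g (Suc k) i))"
proof -
  let ?p = "Suc k"
  have subS: "subspace S" using S by (rule nondeg_subspace)
  define a where "a i = as ! i" for i
  have a_S: "a i \<in> S" if "i < ?p" for i using as(1,2) that by (simp add: a_def subset_iff)
  have map_a: "map a [0..<?p] = as" using as(1) map_nth[of as] by (simp add: a_def[abs_def])
  have omit_a: "length (omit a ?p i) = k" "set (omit a ?p i) \<subseteq> S" if "i < ?p" for i
    using that a_S by (auto simp: length_omit set_omit)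
  have "\<exists>w\<in>S. \<forall>x\<in>S. B w x = (-1) ^ i * f (x # omit a ?p i)" if "i < ?p" for i
    by (rule riesz[OF S linear_functional_scale[OF linear_head[OF f omit_a(1)[OF that]]]])
  then have "\<exists>e. \<forall>i<?p. e i \<in> S \<and> (\<forall>x\<in>S. B (e i) x = (-1) ^ i * f (x # omit a ?p i))"
    by metis
  then obtain e where "\<forall>i<?p. e i \<in> S \<and> (\<forall>x\<in>S. B (e i) x = (-1) ^ i * f (x # omit a ?p i))"
    by blast
  then have e: "e i \<in> S" "\<And>x. x \<in> S \<Longrightarrow> B (e i) x = (-1) ^ i * f (x # omit a ?p i)"
    if "i < ?p" for i using that by blast+
  have e_kern: "e i \<in> kern S k f" if "i < ?p" for i
    using isoD_scaled[OF f subS iso omit_a(1)[OF that] _ omit_a(2)[OF that] _ e[OF that]] e(1)[OF that]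
    by (simp add: kern_def)
  have ee: "B (e i) (e j) = 0" if "i < ?p" "j < ?p" for i j
    using e(2)[OF that(1) e(1)[OF that(2)]] e_kern[OF that(2)] omit_a[OF that(1)]
    by (simp add: kern_def)
  have ea: "B (e i) (a j) = (if i = j then 1 else 0)" if "i < ?p" "j < ?p" for i j
  proof (cases "i = j")
    case True
    have "f (a i # omit a ?p i) = (-1) ^ i"
      using alternating_omit[OF f that(1), of a] map_a as(3) by simp
    then show ?thesis using True e(2)[OF that(1) a_S[OF that(2)]]
      by (simp flip: power_add)
  next
    case False
    have "f (a j # omit a ?p i) = 0"
      by (rule alternating_not_distinct[OF f]) (use False that in \<open>auto simp: length_omit set_omit\<close>)
    then show ?thesis using False e(2)[OF that(1) a_S[OF that(2)]] by simp
  qed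
  have ae: "B (a j) (e i) = (if i = j then 1 else 0)" if "i < ?p" "j < ?p" for i j
    using ea[OF that] by (simp add: B_sym)
  \<comment> \<open>Half the Gram matrix of \<open>a\<close>: in \<open>B (g i) (g j)\<close> each
    of the two corrections removes one half of \<open>B (a i) (a j)\<close>.\<close>
  define n where "n j = (\<Sum>i<?p. (B (a j) (a i) / 2) \<cdot> e i)" for j
  define g where "g j = a j - n j" for j
  have n_kern: "n j \<in> kern S k f" for j
    unfolding n_def by (intro subspace_sum subspace_scale subspace_kern f subS e_kern) auto
  have n_S: "n j \<in> S" for j using n_kern by (simp add: kern_def)
  have g_S: "g i \<in> S" if "i < ?p" for i
    unfolding g_def using n_S a_S[OF that] by (rule subspace_diff[OF subS, rotated])
  have en: "B (e i) (n j) = 0" if "i < ?p" for i j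
    unfolding n_def B_sum' using ee that by simp
  have an: "B (a i) (n j) = B (a i) (a j) / 2" if "i < ?p" for i j
  proof -
    have "B (a i) (n j) = (\<Sum>l<?p. if l = i then B (a j) (a l) / 2 else 0)"
      unfolding n_def B_sum' by (rule sum.cong) (use ae that in auto)
    then show ?thesis using that by (simp add: B_sym)
  qed
  have nn: "B (n i) (n j) = 0" for i j
    unfolding n_def[of i] B_sum using en by simp
  have gg: "B (g i) (g j) = 0" if "i < ?p" "j < ?p" for i j
  proof -
    have "B (g i) (g j) = B (a i) (a j) - B (a j) (n i) - B (a i) (n j)"
      using nn[of i j] B_sym[of "n i" "a j"] by (simp add: g_def)
    also have "\<dots> = B (a i) (a j) - (B (a i) (a j) / 2 + B (a i) (a j) / 2)"
      unfolding an[OF that(1), of j] an[OF that(2), of i] B_sym[of "a j" "a i"] by (simp only: diff_diff_eq)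
    finally show ?thesis by (simp only: half_add_half diff_self)
  qed
  have eg: "B (e i) (g j) = (if i = j then 1 else 0)" if "i < ?p" "j < ?p" for i j
    using ea[OF that] en[OF that(1)] by (simp add: g_def)
  have "hyperbolic ?p e g" using ee gg eg by (simp add: hyperbolic_def)
  moreover have "f (map g [0..<?p]) = 1"
  proof -
    have "f ([] @ map g [0..<?p]) = f ([] @ map a [0..<?p])"
    proof (rule alternating_shift[OF f])
      show "list_all2 (\<lambda>x y. x - y \<in> kern S k f) (map g [0..<?p]) (map a [0..<?p])"
        using subspace_neg[OF subspace_kern[OF f subS] n_kern]
        by (simp add: list_all2_conv_all_nth g_def del: upt_Suc)
    qed (use g_S a_S in auto)
    then show ?thesis using map_a as(3) by simp
  qed
  moreover have "B (e i) x = (-1) ^ i * f (x # omit g ?p i)" if "i < ?p" "x \<in> S" for i x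
  proof -
    have "f ([x] @ omit g ?p i) = f ([x] @ omit a ?p i)"
    proof (rule alternating_shift[OF f])
      show "list_all2 (\<lambda>x y. x - y \<in> kern S k f) (omit g ?p i) (omit a ?p i)"
        using subspace_neg[OF subspace_kern[OF f subS] n_kern]
        by (simp add: list_all2_conv_all_nth g_def omit_def del: upt_Suc)
    qed (use g_S a_S that in \<open>auto simp: set_omit length_omit\<close>)
    then show ?thesis using e(2)[OF that] by simp
  qed
  moreover have "e ` {..<?p} \<subseteq> S" "g ` {..<?p} \<subseteq> S" "e ` {..<?p} \<subseteq> kern S k f"
    using e(1) e_kern g_S by auto
  ultimately show ?thesis by blast
qed

text \<open>All \<open>e i\<close> and \<open>h\<close> lie in the radical, so \<open>f\<close> is
  determined by its value 1 on the list of the \<open>g i\<close>. The Gram determinant with the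
  \<open>e i\<close> vanishes on the same frame vectors and takes the same value.\<close>

lemma iso_imp_gram_det:
  assumes p: "dim UNIV div 2 = Suc k"
    and f: "alternating_multilinear scale (*) (Suc k) f" and iso: "iso UNIV k f"
    and as: "length as = Suc k" "f as = 1"
  shows "\<exists>vs. length vs = Suc k \<and> (\<forall>u\<in>set vs. \<forall>v\<in>set vs. B u v = 0) \<and>
    (\<forall>us. length us = Suc k \<longrightarrow> f us = gram_det vs us)"
proof -
  let ?p = "Suc k"
  obtain e g where eg: "hyperbolic ?p e g" "e ` {..<?p} \<subseteq> kern UNIV k f"
    "f (map g [0..<?p]) = 1"
    using support_hyperbolic[OF nondeg_UNIV f iso as(1) _ as(2)] by auto
  note hyp = hyperbolicD[OF eg(1)]
  obtain h where fr: "frame UNIV ?p e g h"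
    using frame_hyperbolic[OF nondeg_UNIV eg(1) _ _ p] by auto
  \<comment> \<open>A representing vector \<open>w\<close> has no \<open>g\<close> component, so
    \<open>B w w\<close> is the square of its \<open>h\<close> coefficient; isotropy makes it
    0.\<close>
  have h_kern: "h \<in> kern UNIV k f"
    unfolding kern_def
  proof (intro CollectI conjI allI impI)
    fix us :: "'v list" assume us: "length us = k"
    obtain w where w: "\<forall>x. B w x = f (x # us)"
      using riesz[OF nondeg_UNIV linear_head[OF f us]] by auto
    have we: "B w (e i) = 0" if "i < ?p" for i
      using eg(2) w us that by (auto simp: kern_def)
    have eq: "w = (\<Sum>i<?p. B w (g i) \<cdot> e i) + B w h \<cdot> h"
      using frameD(12)[OF fr, of w] we by (simp add: hproj_def)
    have "B w w = B w h * B w h"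
      by (subst (2) eq) (use we in \<open>simp add: B_sum'\<close>)
    moreover have "B w w = 0"
      using isoD[OF iso us us, of w] w by simp
    ultimately show "f (h # us) = 0" using w by simp
  qed simp
  define vs where "vs = map e [0..<?p]"
  have "f us = gram_det vs us" if us: "length us = ?p" for us
  proof (rule alternating_span_eq[OF f _ vector_space_axioms])
    show "alternating_multilinear scale (*) ?p (gram_det vs)"
      using alternating_gram_det[of vs] by (simp add: vs_def)
    show "set us \<subseteq> span (e ` {..<?p} \<union> g ` {..<?p} \<union> {h})"
      using frame_span[OF fr] by blast
    fix zs assume zs: "length zs = ?p" "set zs \<subseteq> e ` {..<?p} \<union> g ` {..<?p} \<union> {h}" "distinct zs"
    show "f zs = gram_det vs zs"
    proof (cases "set zs \<subseteq> g ` {..<?p}")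
      case False
      then obtain z where z: "z \<in> set zs" "z \<in> e ` {..<?p} \<union> {h}" using zs(2) by blast
      then have "f zs = 0"
        using kern_eq_0[OF f zs(1), of UNIV z] eg(2) h_kern by blast
      moreover have "gram_det vs zs = 0"
        by (rule gram_det_eq_0[OF _ z(1)])
          (use z(2) zs(1) hyp frameD[OF fr] in \<open>auto simp: vs_def less_Suc_eq\<close>)
      ultimately show ?thesis by simp
    next
      case True
      have inj: "inj_on g {..<?p}"
        by (rule inj_onI) (metis hyp(3) lessThan_iff zero_neq_one)
      have "set zs = g ` {..<?p}"
        by (rule card_subset_eq) (use True zs inj in \<open>auto simp: card_image distinct_card\<close>)
      moreover have "distinct (map g [0..<?p])"
        unfolding distinct_map using inj by (simp add: atLeast0LessThan del: upt_Suc)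
      ultimately have ms: "mset zs = mset (map g [0..<?p])"
        using zs(3) by (simp only: set_eq_iff_mset_eq_distinct[symmetric])
          (simp add: atLeast0LessThan del: upt_Suc)
      have "gram_det vs (map g [0..<?p]) = 1"
        by (rule gram_det_delta) (use hyp in \<open>auto simp: vs_def simp del: upt_Suc\<close>)
      then have "f zs - gram_det vs zs = 0"
        using alternating_eq_0_permute[OF alternating_diff[OF f] ms] eg(3)
          alternating_gram_det[of vs] by (simp add: vs_def del: upt_Suc)
      then show ?thesis by simp
    qed
  qed (use us in simp)
  moreover have "\<forall>u\<in>set vs. \<forall>v\<in>set vs. B u v = 0"
    using hyp(1) by (auto simp: vs_def simp del: upt_Suc)
  ultimately show ?thesis by (intro exI[of _ vs]) (simp add: vs_def)
qed

text \<open>By Laplace expansion the representing vectors are combinations of \<open>vs\<close>, and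
  the span of \<open>vs\<close> is isotropic.\<close>

lemma iso_gram_det:
  assumes iso: "\<And>u v. u \<in> set vs \<Longrightarrow> v \<in> set vs \<Longrightarrow> B u v = 0" and len: "length vs = Suc k"
  shows "iso UNIV k (gram_det vs)"
proof (rule isoI)
  fix us us' :: "'v list" and w
  assume *: "length us = k" "length us' = k" "\<And>x. x \<in> UNIV \<Longrightarrow> B w x = gram_det vs (x # us)"
  obtain v where v: "v \<in> span (set vs)" "\<forall>x. gram_det vs (x # us) = B v x"
    using gram_det_expand[of "[]" us vs] * len by auto
  obtain v' where v': "v' \<in> span (set vs)" "\<forall>x. gram_det vs (x # us') = B v' x"
    using gram_det_expand[of "[]" us' vs] * len by auto
  have "B u v = 0" if "u \<in> set vs" for u
    by (rule B_eq_0_span[OF _ v(1)]) (use iso that in blast)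
  then have "B v v' = 0" by (intro B_eq_0_span[OF _ v'(1)]) (simp add: B_sym)
  moreover have "B w v' = B v v'" using * v by simp
  ultimately show "gram_det vs (w # us') = 0" using v' by (simp add: B_sym)
qed

end

section \<open>Contraction with an isotropic vector\<close>

text \<open>Basis monomials become lists of labels: occurrences can be tested without comparing
  vectors, and \<open>IH\<close> remains meaningful when \<open>h\<close> is 0.\<close>

datatype idx = IE nat | IG nat | IH

fun bvec :: "(nat \<Rightarrow> 'v) \<Rightarrow> (nat \<Rightarrow> 'v) \<Rightarrow> 'v \<Rightarrow> idx \<Rightarrow> 'v" where
  "bvec e g h (IE i) = e i"
| "bvec e g h (IG i) = g i"
| "bvec e g h IH = h"

definition idxs :: "nat \<Rightarrow> idx set" where
  "idxs p = IE ` {..<p} \<union> IG ` {..<p} \<union> {IH}"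

lemma mem_idxs [simp]: "IE i \<in> idxs p \<longleftrightarrow> i < p" "IG i \<in> idxs p \<longleftrightarrow> i < p" "IH \<in> idxs p"
  by (auto simp: idxs_def)

text \<open>Pigeonhole: \<open>x\<close> takes one of the \<open>p\<close> places, which leaves too
  few for all \<open>p\<close> labels \<open>IE i\<close>.\<close>

lemma ex_untouched:
  assumes zs: "length zs = p" "x \<in> set zs" "x \<notin> range IE"
  obtains i where "i < p" "IE i \<notin> set zs"
proof -
  have "\<not> insert x (IE ` {..<p}) \<subseteq> set zs"
  proof
    assume "insert x (IE ` {..<p}) \<subseteq> set zs"
    then have "card (insert x (IE ` {..<p})) \<le> card (set zs)" by (intro card_mono) auto
    also have "\<dots> \<le> p" using card_length[of zs] zs(1) by simp
    finally show False using zs(3)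
      by (subst (asm) card_insert_disjoint) (auto simp: card_image inj_on_def)
  qed
  then show ?thesis using that zs(2) by blast
qed

text \<open>A permutation costs only a sign, so for vanishing the labels of interest may be moved to
  the front.\<close>

lemma alternating_reorder:
  assumes f: "alternating_multilinear sV ((*) :: 'a::field \<Rightarrow> _) k f" and "length zs = k" "distinct zs"
    and xs: "distinct xs" "set xs \<subseteq> set zs"
    and 0: "\<And>ys. set ys = set zs - set xs \<Longrightarrow> distinct ys \<Longrightarrow> length xs + length ys = k \<Longrightarrow>
      f (map b (xs @ ys)) = 0"
  shows "f (map b zs) = 0"
proof -
  define ys where "ys = filter (\<lambda>z. z \<notin> set xs) zs"
  have ys: "set ys = set zs - set xs" "distinct ys" using assms(3) by (auto simp: ys_def)
  then have d: "distinct (xs @ ys)" "set (xs @ ys) = set zs"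
    using assms(4,5) by auto
  have ms: "mset zs = mset (xs @ ys)"
    using iffD1[OF set_eq_iff_mset_eq_distinct[OF assms(3) d(1)]] d(2) by simp
  then have len: "length xs + length ys = k" using assms(2) by (metis length_append mset_eq_length)
  then have "f (map b (xs @ ys)) = 0" using 0 ys by blast
  moreover have "mset (map b zs) = mset (map b (xs @ ys))" using ms by (simp only: mset_map)
  ultimately show ?thesis
    using alternating_eq_0_permute[OF f, of "map b zs" "map b (xs @ ys)"] len by simp
qed

context quad_space
begin

lemma bvec_in: "frame S p e g h \<Longrightarrow> x \<in> idxs p \<Longrightarrow> bvec e g h x \<in> S"
  by (cases x) (auto simp: frameD)

lemma B_bvec:
  assumes "frame S p e g h" "i < p" "x \<in> idxs p"
  shows "B (g i) (bvec e g h x) = (if x = IE i then 1 else 0)"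
    "B (e i) (bvec e g h x) = (if x = IG i then 1 else 0)"
  using assms hyperbolicD[OF frameD(1)[OF assms(1)]] frameD[OF assms(1)] by (cases x; auto)+

lemma bvec_span: "frame S p e g h \<Longrightarrow> x \<in> S \<Longrightarrow> x \<in> span (bvec e g h ` idxs p)"
  using frame_span[of S p e g h x] by (simp add: idxs_def image_Un image_image)

lemma alternating_frame_eq_0:
  assumes fr: "frame S p e g h" and f: "alternating_multilinear scale (*) k f"
    and 0: "\<And>zs. length zs = k \<Longrightarrow> distinct zs \<Longrightarrow> set zs \<subseteq> idxs p \<Longrightarrow> f (map (bvec e g h) zs) = 0"
    and us: "length us = k" "set us \<subseteq> S"
  shows "f us = 0"
proof (rule alternating_span_eq_0[OF f vector_space_axioms _ us(1)])
  show "set us \<subseteq> span (bvec e g h ` idxs p)" using bvec_span[OF fr] us(2) by blast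
  fix zs assume zs: "length zs = k" "set zs \<subseteq> bvec e g h ` idxs p" "distinct zs"
  have "zs \<in> lists (bvec e g h ` idxs p)" using zs(2) by auto
  then obtain ixs where "zs = map (bvec e g h) ixs" "set ixs \<subseteq> idxs p"
    unfolding lists_image by auto
  then show "f zs = 0" using 0[of ixs] zs by (auto simp: distinct_map)
qed

text \<open>If all contractions with isotropic vectors vanish, then only basis monomials made of pairs \<open>e\<^sub>i, g\<^sub>i\<close> and \<open>h\<close> survive, and the
  vectors \<open>g\<^sub>i + e\<^sub>j\<close> and \<open>g\<^sub>i + g\<^sub>j\<close> show that exchanging the pair \<open>i\<close> for the pair \<open>j\<close>
  both changes and preserves the sign.\<close>

lemma ex_isotropic_contraction:
  assumes S: "nondeg S" and p: "dim S div 2 = Suc (Suc m)"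
    and f: "alternating_multilinear scale (*) (Suc (Suc m)) f"
    and as: "length as = Suc (Suc m)" "set as \<subseteq> S" "f as \<noteq> 0"
  shows "\<exists>v\<in>S. v \<noteq> 0 \<and> B v v = 0 \<and>
    (\<exists>ys. length ys = Suc m \<and> set ys \<subseteq> S \<inter> perp v \<and> f (v # ys) \<noteq> 0)"
proof (rule ccontr)
  assume "\<not> ?thesis"
  then have 0: "f (v # ys) = 0"
    if "v \<in> S" "v \<noteq> 0" "B v v = 0" "length ys = Suc m" "set ys \<subseteq> S \<inter> perp v" for v ys
    using that by blast
  let ?p = "Suc (Suc m)"
  obtain e g h where fr: "frame S ?p e g h" using ex_frame[OF S] p by auto
  note hyp = hyperbolicD[OF frameD(1)[OF fr]]
  note fr_in = frameD(2-4)[OF fr]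
  have subS: "subspace S" using S by (rule nondeg_subspace)
  define b where "b = bvec e g h"
  have b [simp]: "b (IE i) = e i" "b (IG i) = g i" "b IH = h" for i by (simp_all add: b_def)
  have eg_0: "e i \<noteq> 0" "g i \<noteq> 0" if "i < ?p" for i
    using hyp(3)[OF that that] by auto
  have in_perp: "set (map b ys) \<subseteq> S \<inter> perp (g i)" if "i < ?p" "set ys \<subseteq> idxs ?p" "IE i \<notin> set ys" for i ys
    using that B_bvec[OF fr that(1)] bvec_in[OF fr] unfolding b_def by fastforce
  have in_perp': "set (map b ys) \<subseteq> S \<inter> perp (e i)" if "i < ?p" "set ys \<subseteq> idxs ?p" "IG i \<notin> set ys" for i ys
    using that B_bvec[OF fr that(1)] bvec_in[OF fr] unfolding b_def by fastforce
  have "f (map b zs) = 0" if zs: "length zs = ?p" "distinct zs" "set zs \<subseteq> idxs ?p" for zs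
  proof -
    \<comment> \<open>In the first two cases the unpaired vector is isotropic and orthogonal to the
      remaining ones, so its contraction vanishes by assumption.\<close>
    consider (IG) l where "IG l \<in> set zs" "IE l \<notin> set zs" | (IE) l where "IE l \<in> set zs" "IG l \<notin> set zs"
      | (EF) "\<And>l. IE l \<in> set zs \<longleftrightarrow> IG l \<in> set zs" by blast
    then show ?thesis
    proof cases
      case IG
      then have l: "l < ?p" using zs(3) by auto
      show ?thesis
      proof (rule alternating_reorder[OF f zs(1,2), of "[IG l]"])
        fix ys assume ys: "set ys = set zs - set [IG l]" "length [IG l] + length ys = ?p"
        have "set (map b ys) \<subseteq> S \<inter> perp (g l)"
          by (rule in_perp) (use ys IG l zs in auto)
        then have "f (g l # map b ys) = 0"
          using 0[of "g l" "map b ys"] fr_in(2)[OF l] hyp(2)[OF l l] eg_0[OF l] ys by simp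
        then show "f (map b ([IG l] @ ys)) = 0" by simp
      qed (use IG in auto)
    next
      case IE
      then have l: "l < ?p" using zs(3) by auto
      show ?thesis
      proof (rule alternating_reorder[OF f zs(1,2), of "[IE l]"])
        fix ys assume ys: "set ys = set zs - set [IE l]" "length [IE l] + length ys = ?p"
        have "set (map b ys) \<subseteq> S \<inter> perp (e l)"
          by (rule in_perp') (use ys IE l zs in auto)
        then have "f (e l # map b ys) = 0"
          using 0[of "e l" "map b ys"] fr_in(1)[OF l] hyp(1)[OF l l] eg_0[OF l] ys by simp
        then show "f (map b ([IE l] @ ys)) = 0" by simp
      qed (use IE in auto)
    next
      case EF
      have "\<not> set zs \<subseteq> {IH}"
        using zs(1,2) by (metis card_mono distinct_card finite.emptyI finite.insertI card.empty
            card_insert_disjoint empty_iff Suc_n_not_le_n Suc_le_D old.nat.inject not_less_eq_eq le0)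
      then obtain i where i: "IE i \<in> set zs" "IG i \<in> set zs" using EF by (metis idx.exhaust insertCI subsetI)
      then have ip: "i < ?p" using zs(3) by auto
      \<comment> \<open>Since \<open>IG i\<close> takes a place, some \<open>IE j\<close> is absent,
        and by \<open>EF\<close> so is \<open>IG j\<close>: the remaining vectors are orthogonal to
        the whole pair \<open>j\<close>.\<close>
      obtain j where j: "j < ?p" "IE j \<notin> set zs"
        by (rule ex_untouched[OF zs(1) i(2)]) auto
      then have ij: "i \<noteq> j" and Fj: "IG j \<notin> set zs" using i EF by auto
      show ?thesis
      proof (rule alternating_reorder[OF f zs(1,2), of "[IG i, IE i]"])
        fix ys assume ys: "set ys = set zs - set [IG i, IE i]" "length [IG i, IE i] + length ys = ?p"
        let ?Y = "map b ys"
        have Y: "length ?Y = m" using ys by simp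
        have lin: "f ((x + y) # z # ?Y) = f (x # z # ?Y) + f (y # z # ?Y)"
          "f (z # (x - y) # ?Y) = f (z # x # ?Y) - f (z # y # ?Y)" for x y z
        proof -
          show "f ((x + y) # z # ?Y) = f (x # z # ?Y) + f (y # z # ?Y)"
            using alternating_add[OF f, of "[]" "z # ?Y" x y] Y by simp
          have "f (z # x # ?Y) = f (z # ((x - y) + y) # ?Y)" by simp
          also have "\<dots> = f (z # (x - y) # ?Y) + f (z # y # ?Y)"
            using alternating_add[OF f, of "[z]" ?Y "x - y" y] Y by simp
          finally show "f (z # (x - y) # ?Y) = f (z # x # ?Y) - f (z # y # ?Y)" by simp
        qed
        have Fy: "set ?Y \<subseteq> S \<inter> perp (g i)" "set ?Y \<subseteq> S \<inter> perp (g j)"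
          "set ?Y \<subseteq> S \<inter> perp (e j)" "set ?Y \<subseteq> S \<inter> perp (e i)"
          by (rule in_perp in_perp'; use ys ip j Fj zs in auto)+
        have Y_perp: "y \<in> S" "B (g i) y = 0" "B (g j) y = 0" "B (e j) y = 0" "B (e i) y = 0"
          if "y \<in> set ?Y" for y
          using Fy[THEN subsetD, OF that] by (simp_all only: Int_iff mem_perp)
        \<comment> \<open>Orthogonality holds because the two cross terms cancel. Expanding shows
          that the pair \<open>j\<close> contributes minus what the pair \<open>i\<close> does,
          whereas \<open>l2\<close> shows that both contribute the same.\<close>
        have l1: "f ((g i + e j) # (e i - g j) # ?Y) = 0"
        proof (rule 0)
          show "set ((e i - g j) # ?Y) \<subseteq> S \<inter> perp (g i + e j)"
            using Y_perp fr_in ip j(1) hyp subspace_diff[OF subS] ij by (auto simp del: set_map)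
          show "g i + e j \<noteq> 0"
          proof
            assume "g i + e j = 0"
            then have "B (e i) (g i + e j) = 0" by simp
            then show False using hyp ip j(1) by simp
          qed
        qed (use Y fr_in ip j(1) hyp ij subspace_add[OF subS] in auto)
        have l2: "f ((g i + g j) # (e i - e j) # ?Y) = 0"
        proof (rule 0)
          show "set ((e i - e j) # ?Y) \<subseteq> S \<inter> perp (g i + g j)"
            using Y_perp fr_in ip j(1) hyp subspace_diff[OF subS] ij by (auto simp del: set_map)
          show "g i + g j \<noteq> 0"
          proof
            assume "g i + g j = 0"
            then have "B (e i) (g i + g j) = 0" by simp
            then show False using hyp ip j(1) ij by simp
          qed
        qed (use Y fr_in ip j(1) hyp ij subspace_add[OF subS] in auto)
        have z: "f (x # y # ?Y) = 0" if "x = g i \<or> x = g j \<or> x = e i \<or> x = e j"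
          "y = g i \<or> y = g j \<or> y = e i \<or> y = e j" "B x y = 0" for x y
        proof (rule 0)
          show "x \<in> S" "x \<noteq> 0" "B x x = 0" using that(1) fr_in ip j(1) hyp eg_0 by auto
          have "y \<in> S" using that(2) fr_in ip j(1) by auto
          then show "set (y # ?Y) \<subseteq> S \<inter> perp x"
            using that(1,3) Y_perp by (auto simp del: set_map)
        qed (use Y in simp)
        have z': "f (g i # g j # ?Y) = 0" "f (e j # e i # ?Y) = 0" "f (g i # e j # ?Y) = 0"
          "f (g j # e i # ?Y) = 0"
          using hyp ip j(1) ij by (intro z; simp)+
        have "f (e j # g j # ?Y) = - f (g j # e j # ?Y)"
          by (rule alternating_swap_head[OF f]) (use Y in simp)
        then have "f (g i # e i # ?Y) + f (g j # e j # ?Y) = 0"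
          using l1 unfolding lin z' by simp
        moreover have "f (g i # e i # ?Y) - f (g j # e j # ?Y) = 0"
          using l2 unfolding lin z' by simp
        ultimately have "f (g i # e i # ?Y) + f (g i # e i # ?Y) = 0"
          by (simp only: right_minus_eq)
        then have "2 * f (g i # e i # ?Y) = 0" by (simp only: mult_2)
        then show "f (map b ([IG i, IE i] @ ys)) = 0" using two_neq_0 by simp
      qed (use i in auto)
    qed
  qed
  then have "f as = 0"
    using alternating_frame_eq_0[OF fr f _ as(1,2)] unfolding b_def by blast
  then show False using as(3) by simp
qed

text \<open>As \<open>e\<close> lies in the radical, \<open>f\<close> lives on the quotient of the
  complement of \<open>e\<close> by \<open>e\<close>, and
  \<open>S \<inter> perp e \<inter> perp u\<close> is an isometric copy of that quotient.\<close>

lemma iso_perp_iff: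
  assumes S: "nondeg S" and eu: "e \<in> S" "u \<in> S" "B e e = 0" "B u u = 0" "B e u = 1"
    and f: "alternating_multilinear scale (*) (Suc m) f"
    and e0: "e \<in> kern (S \<inter> perp e) m f"
  shows "iso (S \<inter> perp e) m f \<longleftrightarrow> iso (S \<inter> perp e \<inter> perp u) m f"
proof -
  let ?S = "S \<inter> perp e" let ?T = "S \<inter> perp e \<inter> perp u"
  have subS: "subspace ?S" using S by (intro subspace_inter nondeg_subspace subspace_perp)
  note ker = subspace_kern[OF f subS]
  have dec: "x - B x u \<cdot> e \<in> ?T" "x - (x - B x u \<cdot> e) \<in> kern ?S m f" if "x \<in> ?S" for x
    using hyperbolic_pair_complement(3)[OF S eu, of x] that subspace_scale[OF ker e0]
    by (simp_all add: B_sym[of x e])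
  show ?thesis
  proof
    assume iso: "iso ?S m f"
    show "iso ?T m f"
    proof (rule isoI)
      fix us us' :: "'v list" and w
      assume *: "length us = m" "length us' = m" "set us \<subseteq> ?T" "set us' \<subseteq> ?T" "w \<in> ?T"
        "\<And>x. x \<in> ?T \<Longrightarrow> B w x = f (x # us)"
      show "f (w # us') = 0"
      proof (rule isoD[OF iso *(1,2)])
        fix x assume x: "x \<in> ?S"
        have "B w x = B w (x - B x u \<cdot> e)" using *(5) by (simp add: B_sym[of w e])
        also have "\<dots> = f ([] @ (x - B x u \<cdot> e) # us)" using *(6)[OF dec(1)[OF x]] by simp
        also have "\<dots> = f ([] @ x # us)"
        proof (rule alternating_shift[OF f, symmetric])
          show "list_all2 (\<lambda>x y. x - y \<in> kern ?S m f) (x # us) ((x - B x u \<cdot> e) # us)"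
            using dec(2)[OF x] subspace_0[OF ker] by (simp add: list_all2_same)
        qed (use * x dec(1)[OF x] in auto)
        finally show "B w x = f (x # us)" by simp
      qed (use * in auto)
    qed
  next
    assume iso: "iso ?T m f"
    show "iso ?S m f"
    proof (rule isoI)
      fix us us' :: "'v list" and w
      assume *: "length us = m" "length us' = m" "set us \<subseteq> ?S" "set us' \<subseteq> ?S" "w \<in> ?S"
        "\<And>x. x \<in> ?S \<Longrightarrow> B w x = f (x # us)"
      define pr where "pr x = x - B x u \<cdot> e" for x
      have prT: "pr x \<in> ?T" if "x \<in> ?S" for x using dec(1)[OF that] by (simp add: pr_def)
      have pr: "f (x # ys) = f (pr x # map pr ys)" if "x \<in> ?S" "set ys \<subseteq> ?S" "length ys = m" for x ys
      proof -
        have "f ([] @ x # ys) = f ([] @ map pr (x # ys))"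
        proof (rule alternating_shift[OF f])
          show "list_all2 (\<lambda>x y. x - y \<in> kern ?S m f) (x # ys) (map pr (x # ys))"
            unfolding list_all2_map2
          proof (rule list_all2_all_nthI)
            fix n assume "n < length (x # ys)"
            then have "(x # ys) ! n \<in> ?S" using that nth_mem[of n "x # ys"] by auto
            then show "(x # ys) ! n - pr ((x # ys) ! n) \<in> kern ?S m f"
              using dec(2) unfolding pr_def by blast
          qed simp
          have "set (x # ys) \<subseteq> ?S" using that by simp
          then have "pr ` set (x # ys) \<subseteq> ?S" using prT by blast
          then show "set (map pr (x # ys)) \<subseteq> ?S" by simp
        qed (use that in auto)
        then show ?thesis by simp
      qed
      have prTs: "set (map pr ys) \<subseteq> ?T" if "set ys \<subseteq> ?S" for ys
        unfolding set_map using that prT by blast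
      have "f (pr w # map pr us') = 0"
      proof (rule isoD[OF iso])
        fix x assume x: "x \<in> ?T"
        then have "pr x = x" by (simp add: pr_def B_sym[of x u])
        have "B (pr w) x = B w x" using x by (simp add: pr_def)
        also have "\<dots> = f (pr x # map pr us)" using *(6)[of x] pr[of x us] x *(1,3) by simp
        finally show "B (pr w) x = f (x # map pr us)" using \<open>pr x = x\<close> by simp
      qed (use *(1,2) prTs[OF *(3)] prTs[OF *(4)] prT[OF *(5)] in simp_all)
      then show "f (w # us') = 0" using pr *(2,4,5) by simp
    qed
  qed
qed

text \<open>Since \<open>v\<close> is among the fixed arguments \<open>us0\<close>, the vector
  \<open>w\<close> represents, up to a nonzero factor, a value of the contraction with
  \<open>v\<close>, and so it lies in the radical of that contraction.\<close>

lemma iso_contraction_eq_0: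
  assumes S: "subspace S" and f: "alternating_multilinear scale (*) (Suc (Suc m)) f"
    and iso: "iso (S \<inter> perp v) m (\<lambda>us. f (v # us))"
    and us: "length us = m" "set us \<subseteq> S \<inter> perp v" "mset us0 = mset (v # us)"
    and w: "w \<in> S \<inter> perp v" "\<And>x. x \<in> S \<Longrightarrow> B w x = c * f (x # us0)" "c \<noteq> 0"
    and us': "length us' = m" "set us' \<subseteq> S \<inter> perp v"
  shows "f (v # w # us') = 0"
proof -
  have len: "length (v # us) = Suc m" using us by simp
  obtain d :: 'a where d: "d = 1 \<or> d = -1"
    "\<And>f. alternating_multilinear scale (*) (length (v # us)) f \<Longrightarrow> f us0 = d * f (v # us)"
    using alternating_permute[OF us(3)] by metis
  have "f (x # us0) = - d * f (v # x # us)" for x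
    using d(2)[of "\<lambda>l. f (x # l)"] alternating_Cons[OF f, of x]
      alternating_swap_head[OF f, of us x v] us(1) by simp
  then have "B w x = (- c * d) * f (v # x # us)" if "x \<in> S \<inter> perp v" for x
    using w(2) that by simp
  then show ?thesis
    using isoD_scaled[OF alternating_Cons[OF f] _ iso us(1) us'(1) us(2) us'(2) w(1), of "- c * d"]
      d(1) w(3) subspace_inter[OF S subspace_perp] by fastforce
qed

end

context quad_space
begin

text \<open>For \<open>l\<close> different from \<open>j\<close> the vector \<open>g l\<close>
  occurs in the list that omits \<open>g j\<close>. Hence \<open>w\<close> also belongs to the
  support of the contraction with \<open>g l\<close>, which therefore annihilates it.\<close>

lemma adapted_contraction_eq_0:
  assumes S: "subspace S" and f: "alternating_multilinear scale (*) (Suc (Suc m)) f"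
    and lj: "l < Suc (Suc m)" "j < Suc (Suc m)" "l \<noteq> j"
    and iso: "iso (S \<inter> perp (g l)) m (\<lambda>us. f (g l # us))"
    and g: "\<And>i. i < Suc (Suc m) \<Longrightarrow> g i \<in> S \<inter> perp (g l)"
    and w: "w \<in> S \<inter> perp (g l)" "\<And>x. x \<in> S \<Longrightarrow> B w x = (-1) ^ j * f (x # omit g (Suc (Suc m)) j)"
    and us: "length us = m" "set us \<subseteq> S \<inter> perp (g l)"
  shows "f (g l # w # us) = 0"
proof -
  let ?us0 = "omit g (Suc (Suc m)) j"
  have gl: "g l \<in> set ?us0" using lj by (auto simp: set_omit)
  then have ms: "mset ?us0 = mset (g l # remove1 (g l) ?us0)" by simp
  moreover have "length ?us0 = Suc m" using lj by (simp add: length_omit)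
  ultimately have len: "length (remove1 (g l) ?us0) = m" using gl by (simp add: length_remove1)
  have "set ?us0 \<subseteq> S \<inter> perp (g l)" using g by (auto simp: set_omit)
  then have "set (remove1 (g l) ?us0) \<subseteq> S \<inter> perp (g l)" using set_remove1_subset by fastforce
  then show ?thesis
    using iso_contraction_eq_0[OF S f iso len _ ms w(1) w(2) _ us] by simp
qed

end

text \<open>The situation of \<open>support_hyperbolic\<close> for a form whose own support is not
  yet known to be isotropic, only those of its contractions with isotropic vectors. The form has
  \<open>m + 2\<close> arguments, a contraction \<open>m + 1\<close>, and \<open>iso\<close> counts
  one less.\<close>

locale adapted_frame = quad_space scale Bas B
  for scale :: "'a::alg_closed_field \<Rightarrow> 'v::ab_group_add \<Rightarrow> 'v" (infixr "\<cdot>" 75)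
    and Bas and B +
  fixes S :: "'v set" and m :: nat and f :: "'v list \<Rightarrow> 'a" and e g :: "nat \<Rightarrow> 'v" and h :: 'v
  assumes nondeg_S: "nondeg S"
    and alt_f: "alternating_multilinear scale (*) (Suc (Suc m)) f"
    and frame_S: "frame S (Suc (Suc m)) e g h"
    and B_e: "i < Suc (Suc m) \<Longrightarrow> x \<in> S \<Longrightarrow> B (e i) x = (-1) ^ i * f (x # omit g (Suc (Suc m)) i)"
    and iso_contraction: "v \<in> S \<Longrightarrow> v \<noteq> 0 \<Longrightarrow> B v v = 0 \<Longrightarrow> iso (S \<inter> perp v) m (\<lambda>us. f (v # us))"

context quad_space
begin

text \<open>The vectors \<open>e\<^sub>1, e\<^sub>2, \<dots>\<close> come from the support of the contraction with \<open>v\<close>, corrected by multiples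
  of \<open>v\<close>; the vector \<open>e\<^sub>0\<close> is then forced.\<close>

lemma ex_adapted_frame:
  assumes S: "nondeg S" and p: "dim S div 2 = Suc (Suc m)" and m: "m \<ge> 1"
    and f: "alternating_multilinear scale (*) (Suc (Suc m)) f"
    and as: "length as = Suc (Suc m)" "set as \<subseteq> S" "f as \<noteq> 0"
    and iso: "\<And>v. v \<in> S \<Longrightarrow> v \<noteq> 0 \<Longrightarrow> B v v = 0 \<Longrightarrow> iso (S \<inter> perp v) m (\<lambda>us. f (v # us))"
  shows "\<exists>e g h. adapted_frame scale Bas B S m f e g h"
proof -
  let ?p = "Suc (Suc m)" and ?k = "Suc m"
  have subS: "subspace S" using S by (rule nondeg_subspace)
  obtain v' ys where v': "v' \<in> S" "v' \<noteq> 0" "B v' v' = 0" and ys: "length ys = ?k"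
    "set ys \<subseteq> S \<inter> perp v'" "f (v' # ys) \<noteq> 0"
    using ex_isotropic_contraction[OF S p f as] by blast
  \<comment> \<open>The scaling produces the value 1 that \<open>support_hyperbolic\<close>
    expects.\<close>
  define v where "v = (1 / f (v' # ys)) \<cdot> v'"
  have v: "v \<in> S" "v \<noteq> 0" "B v v = 0" using v' ys subspace_scale[OF subS] by (auto simp: v_def)
  have ys_v: "set ys \<subseteq> S \<inter> perp v" using ys by (auto simp: v_def)
  have f_v: "f (v # ys) = 1"
    using alternating_scale[OF f, of "[]" ys] ys by (simp add: v_def)
  obtain u where u: "u \<in> S" "B u u = 0" "B v u = 1" using ex_hyperbolic_partner[OF S v] by blast
  let ?T = "S \<inter> perp v" and ?S1 = "S \<inter> perp v \<inter> perp u"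
  define f1 where "f1 = (\<lambda>us. f (v # us))"
  have f1: "alternating_multilinear scale (*) ?k f1" unfolding f1_def by (rule alternating_Cons[OF f])
  have v_kern: "v \<in> kern ?T m f1"
    using v by (auto simp: kern_def f1_def intro: alternating_not_distinct[OF f])
  have S1: "nondeg ?S1"
    by (rule hyperbolic_pair_complement(1)[OF S v(1) u(1) v(3) u(2,3)])
  have subT: "subspace ?T" by (intro subspace_inter subS subspace_perp)
  \<comment> \<open>\<open>v\<close> lies in the radical of its own contraction, so isotropy passes
    to the nondegenerate space \<open>?S1\<close>, on which hyperbolic bases are available.\<close>
  have iso1: "iso ?S1 m f1"
    using iso[OF v] iso_perp_iff[OF S v(1) u(1) v(3) u(2,3) f1 v_kern] by (simp add: f1_def)
  define pr where "pr x = x - B x u \<cdot> v" for x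
  have pr: "pr x \<in> ?S1" if "x \<in> ?T" for x
    using hyperbolic_pair_complement(3)[OF S v(1) u(1) v(3) u(2,3), of x] that
    by (simp add: pr_def B_sym[of x v])
  have "f1 ([] @ map pr ys) = f1 ([] @ ys)"
  proof (rule alternating_shift[OF f1, where S = ?T])
    show "list_all2 (\<lambda>x y. x - y \<in> kern ?T m f1) (map pr ys) ys"
      unfolding list_all2_map1
      by (rule list_all2_all_nthI)
        (simp_all add: pr_def subspace_neg[OF subspace_kern[OF f1 subT]]
          subspace_scale[OF subspace_kern[OF f1 subT] v_kern])
    show "set (map pr ys) \<subseteq> ?T" using pr ys_v by fastforce
  qed (use ys ys_v in auto)
  then have f1_ys: "f1 (map pr ys) = 1" using f_v by (simp add: f1_def)
  have ys_S1: "set (map pr ys) \<subseteq> ?S1"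
    unfolding set_map using pr ys_v by (intro image_subsetI) blast
  obtain e1 g1 where hyp1: "hyperbolic ?k e1 g1" and eg1: "e1 ` {..<?k} \<subseteq> ?S1" "g1 ` {..<?k} \<subseteq> ?S1"
    and f1_g1: "f1 (map g1 [0..<?k]) = 1"
    and e1: "\<forall>i<?k. \<forall>x\<in>?S1. B (e1 i) x = (-1) ^ i * f1 (x # omit g1 ?k i)"
    using support_hyperbolic[OF S1 f1 iso1 _ ys_S1 f1_ys] ys by auto
  note hyp1 = hyperbolicD[OF hyp1]
  have e1_S1: "e1 i \<in> S" "B v (e1 i) = 0" "B u (e1 i) = 0" and g1_S1: "g1 i \<in> S" "B v (g1 i) = 0" "B u (g1 i) = 0"
    if "i < ?k" for i using eg1 that by auto
  define g where "g i = (case i of 0 \<Rightarrow> v | Suc i \<Rightarrow> g1 i)" for i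
  have g_simps [simp]: "g 0 = v" "g (Suc i) = g1 i" for i by (simp_all add: g_def)
  have g_S: "g i \<in> S" if "i < ?p" for i using that v g1_S1 by (cases i) auto
  have gg: "B (g i) (g j) = 0" if "i < ?p" "j < ?p" for i j
    using that v g1_S1 hyp1 B_sym[of "g1 _" v] by (cases i; cases j) auto
  have upt_p: "[0..<?p] = 0 # map Suc [0..<?k]"
    unfolding map_Suc_upt by (rule upt_conv_Cons) simp
  have omit_Suc: "omit g ?p (Suc i) = v # omit g1 ?k i" if "i < ?k" for i
  proof -
    show ?thesis unfolding omit_def upt_p by (simp add: filter_map o_def del: upt_Suc)
  qed
  have f_g: "f (map g [0..<?p]) = 1"
  proof -
    have "map g [0..<?p] = v # map g1 [0..<?k]" unfolding upt_p by (simp del: upt_Suc)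
    then show ?thesis using f1_g1 unfolding f1_def by (simp only:)
  qed
  have len_omit: "length (omit g ?p i) = ?k" if "i < ?p" for i using that by (simp add: length_omit)
  obtain e0 where e0: "e0 \<in> S" "\<And>x. x \<in> S \<Longrightarrow> B e0 x = f (x # omit g ?p 0)"
    using riesz[OF S linear_head[OF f len_omit[of 0]]] by auto
  \<comment> \<open>The correction is dictated by the value at \<open>u\<close>: on
    \<open>?S1\<close> the vector \<open>e1 i\<close> already represents the right form, and at
    \<open>v\<close> both sides vanish.\<close>
  define c where "c i = (-1) ^ i * f1 (u # omit g1 ?k i)" for i
  define e where "e i = (case i of 0 \<Rightarrow> e0 | Suc i \<Rightarrow> e1 i + c i \<cdot> v)" for i
  have e_simps [simp]: "e 0 = e0" "e (Suc i) = e1 i + c i \<cdot> v" for i by (simp_all add: e_def)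
  have e_S: "e i \<in> S" if "i < ?p" for i
    using that e0 e1_S1 v subspace_add[OF subS] subspace_scale[OF subS] by (cases i) auto
  have R: "B (e i) x = (-1) ^ i * f (x # omit g ?p i)" if i: "i < ?p" and x: "x \<in> S" for i x
  proof (cases i)
    case 0
    then show ?thesis using e0 x by simp
  next
    case (Suc j)
    then have j: "j < ?k" using i by simp
    have omit: "length (omit g1 ?k j) = m" "set (omit g1 ?k j) \<subseteq> ?T"
      using j g1_S1 by (auto simp: length_omit set_omit)
    interpret l: Vector_Spaces.linear scale "(*)" "\<lambda>x. f1 (x # omit g1 ?k j)"
      using linear_head[OF f1 omit(1)] .
    define x1 where "x1 = x - B x u \<cdot> v - B x v \<cdot> u"
    have x1: "x1 \<in> ?S1" unfolding x1_def
      by (rule hyperbolic_pair_complement(3)[OF S v(1) u(1) v(3) u(2,3) x])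
    have x_eq: "x = x1 + (B x u \<cdot> v + B x v \<cdot> u)" by (simp add: x1_def)
    have "f1 (v # omit g1 ?k j) = 0" using v_kern omit by (simp add: kern_def)
    then have "f1 (x # omit g1 ?k j) = f1 (x1 # omit g1 ?k j) + B x v * f1 (u # omit g1 ?k j)"
      by (subst x_eq) (simp add: l.add l.scale)
    moreover have "B (e i) x = B (e1 j) x1 + B x v * c j"
    proof -
      have "B (e1 j) x = B (e1 j) x1"
        using e1_S1[OF j] B_sym[of "e1 j"] by (subst x_eq) simp
      then show ?thesis by (simp add: Suc B_sym[of v x])
    qed
    moreover have "B (e1 j) x1 = (-1) ^ j * f1 (x1 # omit g1 ?k j)" using e1 j x1 by blast
    ultimately have "B (e i) x = (-1) ^ j * f1 (x # omit g1 ?k j)"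
      by (simp add: c_def algebra_simps)
    \<comment> \<open>In \<open>omit g ?p i\<close> the vector \<open>v\<close> stands behind
      \<open>x\<close>; the swap accounts for the sign between the indices \<open>j\<close> and
      \<open>i = Suc j\<close>.\<close>
    also have "f1 (x # omit g1 ?k j) = - f (x # omit g ?p i)"
      unfolding Suc omit_Suc[OF j] f1_def by (rule alternating_swap_head[OF f]) (use omit in simp)
    finally show ?thesis by (simp add: Suc)
  qed
  have eg: "B (e i) (g j) = (if i = j then 1 else 0)" if "i < ?p" "j < ?p" for i j
  proof (cases "i = j")
    case True
    have "B (e i) (g i) = (-1) ^ i * ((-1) ^ i * 1)"
      using R[OF that(1) g_S[OF that(1)]] alternating_omit[OF f that(1), of g] f_g by simp
    then show ?thesis using True by (simp flip: power_add)
  next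
    case False
    have "f (g j # omit g ?p i) = 0"
      by (rule alternating_not_distinct[OF f]) (use False that in \<open>auto simp: length_omit set_omit\<close>)
    then show ?thesis using False R[OF that(1) g_S[OF that(2)]] by simp
  qed
  have e_killed: "f (e j # us) = 0"
    if "j < ?p" "l < ?p" "l \<noteq> j" "length us = Suc m" "set us \<subseteq> S \<inter> perp (g l)" "g l \<in> set us" for j l us
  proof -
    have gl: "g l \<in> S" "g l \<noteq> 0" "B (g l) (g l) = 0"
      using g_S[OF that(2)] gg[OF that(2,2)] eg[OF that(2,2)] by auto
    have "e j \<in> S \<inter> perp (g l)" using e_S[OF that(1)] eg[OF that(1,2)] that(3) by (simp add: B_sym)
    moreover have "set (remove1 (g l) us) \<subseteq> S \<inter> perp (g l)" using that(5) set_remove1_subset by fastforce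
    moreover have "length (remove1 (g l) us) = m" using that(4,6) by (simp add: length_remove1)
    ultimately have "f (g l # e j # remove1 (g l) us) = 0"
      using adapted_contraction_eq_0[where g = g and l = l and w = "e j" and f = f,
          OF subS f that(2,1,3) iso[OF gl]] R[OF that(1)] g_S gg that(2)
      by auto
    moreover have "mset (e j # us) = mset (g l # e j # remove1 (g l) us)" using that(6) by simp
    moreover have "length (g l # e j # remove1 (g l) us) = ?p"
      using \<open>length (remove1 (g l) us) = m\<close> by simp
    ultimately show ?thesis
      using alternating_eq_0_permute[OF f, of "e j # us" "g l # e j # remove1 (g l) us"] by blast
  qed
  have ee0: "B (e 0) (e j) = 0" if "j < ?p" for j
  proof -
    \<comment> \<open>A further index exists because \<open>m \<ge> 1\<close>. Then
      \<open>g l\<close> occurs in \<open>omit g ?p 0\<close>, and \<open>e_killed\<close> applies,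
      also for \<open>j = 0\<close>.\<close>
    obtain l where l: "l < ?p" "l \<noteq> j" "l \<noteq> 0"
      using m by (cases "j = 1") (use that[of 2] that[of 1] in auto)
    have "f (e j # omit g ?p 0) = 0"
      by (rule e_killed[OF that l(1,2)]) (use l g_S gg in \<open>auto simp: len_omit set_omit\<close>)
    then show ?thesis using R[of 0 "e j"] e_S[OF that] by simp
  qed
  have ee: "B (e i) (e j) = 0" if "i < ?p" "j < ?p" for i j
  proof (cases i)
    case 0
    then show ?thesis using ee0 that by simp
  next
    case i: (Suc i')
    show ?thesis
    proof (cases j)
      case 0
      then show ?thesis using ee0[OF that(1)] by (simp add: B_sym)
    next
      case (Suc j')
      then show ?thesis using i that v e1_S1 hyp1 B_sym[of "e1 _" v] by simp
    qed
  qed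
  have "hyperbolic ?p e g" using ee gg eg by (simp add: hyperbolic_def)
  then obtain h where "frame S ?p e g h"
    using frame_hyperbolic[OF S _ _ _ p, of e g] e_S g_S by (metis image_subset_iff lessThan_iff)
  then show ?thesis
    using S f R iso by (intro exI) (unfold_locales, blast+)
qed

end

context adapted_frame
begin

abbreviation p :: nat where "p \<equiv> Suc (Suc m)"

abbreviation b :: "idx \<Rightarrow> 'v" where "b \<equiv> bvec e g h"

lemma subspace_S: "subspace S"
  using nondeg_S by (rule nondeg_subspace)

lemmas frame_in = frameD(2-4)[OF frame_S]
lemmas frame_B = hyperbolicD[OF frameD(1)[OF frame_S]] frameD(5-8)[OF frame_S]

lemma g_nonzero: "i < p \<Longrightarrow> g i \<noteq> 0"
  using frame_B(3)[of i i] by auto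

lemma b_in_perp:
  assumes "set zs \<subseteq> idxs p" "\<And>x. x \<in> set zs \<Longrightarrow> B v (b x) = 0"
  shows "set (map b zs) \<subseteq> S \<inter> perp v"
  using assms bvec_in[OF frame_S] by auto

text \<open>All other vectors are orthogonal to \<open>g l\<close>. If some \<open>e j\<close>
  occurs, the contraction with \<open>g l\<close> annihilates it. Otherwise \<open>h\<close> occurs,
  and the value is up to sign \<open>B (e i) h\<close>.\<close>

lemma eq_0_lone_g:
  assumes zs: "length zs = p" "set zs \<subseteq> idxs p" and l: "IG l \<in> set zs" "IE l \<notin> set zs"
    and x: "x \<in> set zs" "x = IH \<or> x \<in> range IE"
  shows "f (map b zs) = 0"
proof (cases "distinct zs")
  case False
  then have "\<not> distinct (map b zs)" by (simp add: distinct_map)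
  then show ?thesis using alternating_not_distinct[OF alt_f] zs(1) by simp
next
  case True
  have lp: "l < p" using l(1) zs(2) by auto
  show ?thesis
  proof (cases "\<exists>j. IE j \<in> set zs")
    case True
    then obtain j where j: "IE j \<in> set zs" by blast
    then have jl: "j < p" "j \<noteq> l" using zs(2) l(2) by auto
    show ?thesis
    proof (rule alternating_reorder[OF alt_f zs(1) \<open>distinct zs\<close>, of "[IG l, IE j]"])
      fix ys assume ys: "set ys = set zs - set [IG l, IE j]" "length [IG l, IE j] + length ys = p"
      have "set (map b ys) \<subseteq> S \<inter> perp (g l)"
        by (rule b_in_perp) (use ys zs l B_bvec[OF frame_S lp] in auto)
      then have "f (g l # e j # map b ys) = 0"
        using adapted_contraction_eq_0[where g = g and l = l and w = "e j" and f = f,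
            OF subspace_S alt_f lp jl(1) _ iso_contraction] jl lp ys(2)
          frame_in frame_B g_nonzero B_e[OF jl(1)] by auto
      then show "f (map b ([IG l, IE j] @ ys)) = 0" by simp
    qed (use l j in auto)
  next
    case False
    \<comment> \<open>The other \<open>p - 1\<close> labels are then distinct labels
      \<open>IG\<close>, so exactly one index \<open>i\<close> is missing and \<open>B_e\<close>
      evaluates \<open>f\<close>.\<close>
    then have IH: "IH \<in> set zs" using x by auto
    have sub: "set zs - {IH} \<subseteq> IG ` {..<p}"
    proof
      fix y assume y: "y \<in> set zs - {IH}"
      then show "y \<in> IG ` {..<p}" using False zs(2) by (cases y) auto
    qed
    have card: "card (set zs - {IH}) = Suc m"
      using IH distinct_card[OF True] zs(1) by simp
    have cF: "card (IG ` {..<p}) = p" by (simp add: card_image inj_on_def)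
    have "\<not> IG ` {..<p} \<subseteq> set zs - {IH}"
      using card_mono[of "set zs - {IH}" "IG ` {..<p}"] card cF by auto
    then obtain i where i: "i < p" "IG i \<notin> set zs" by auto
    have "set zs - {IH} = IG ` ({..<p} - {i})"
    proof (rule card_subset_eq)
      show "set zs - {IH} \<subseteq> IG ` ({..<p} - {i})" using sub i by auto
      have "card (IG ` ({..<p} - {i})) = card ({..<p} - {i})" by (rule card_image) (simp add: inj_on_def)
      then show "card (set zs - {IH}) = card (IG ` ({..<p} - {i}))" using card i by simp
    qed simp
    then have set_eq: "set zs = set (IH # omit IG p i)"
      using IH unfolding list.set set_omit by blast
    have "distinct (IH # omit IG p i)"
      unfolding omit_def by (auto simp: distinct_map inj_on_def simp del: upt_Suc)
    then have "mset zs = mset (IH # omit IG p i)"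
      using iffD1[OF set_eq_iff_mset_eq_distinct[OF True]] set_eq by blast
    moreover have "map b (IH # omit IG p i) = h # omit g p i" by (simp add: omit_def o_def del: upt_Suc)
    ultimately have "mset (map b zs) = mset (h # omit g p i)" by (metis mset_map)
    moreover have "length (h # omit g p i) = p" using i(1) by (simp add: length_omit)
    moreover have "f (h # omit g p i) = 0"
      using B_e[OF i(1), of h] frame_in frame_B i(1) by simp
    ultimately show ?thesis
      by (rule alternating_eq_0_permute[OF alt_f])
  qed
qed

definition omit2 :: "nat \<Rightarrow> nat \<Rightarrow> 'v list" where
  "omit2 i k = map g (filter (\<lambda>j. j \<noteq> i \<and> j \<noteq> k) [0..<p])"

lemma omit2:
  assumes "i < p" "k < p" "i \<noteq> k"
  shows "length (omit2 i k) = m" "mset (omit g p k) = mset (g i # omit2 i k)"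
proof -
  have "mset (filter (\<lambda>j. j \<noteq> k) [0..<p]) = mset (i # filter (\<lambda>j. j \<noteq> i \<and> j \<noteq> k) [0..<p])"
    by (rule iffD1[OF set_eq_iff_mset_eq_distinct]) (use assms in \<open>auto simp del: upt_Suc\<close>)
  then show ms: "mset (omit g p k) = mset (g i # omit2 i k)"
    unfolding omit_def omit2_def list.map(2)[symmetric] by (simp only: mset_map)
  show "length (omit2 i k) = m"
    using mset_eq_length[OF ms] assms(2) by (simp add: length_omit)
qed

lemma set_omit2: "set (omit2 i k) = g ` ({..<p} - {i, k})"
  by (auto simp: omit2_def simp del: upt_Suc)

text \<open>Replacing \<open>g\<^sub>i\<close> by \<open>v = g\<^sub>i + a e\<^sub>i + c h\<close> does not change the linear form represented by \<open>\<plusminus>e\<^sub>k\<close>: in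
  every additional monomial some \<open>g\<^sub>l\<close> occurs without \<open>e\<^sub>l\<close>, as at least four indices are available.\<close>

lemma deformed_contraction_eq_0:
  assumes m: "m \<ge> 2" and ik: "i < p" "k < p" "i \<noteq> k"
    and v: "v = g i + (a \<cdot> e i + c \<cdot> h)"
    and iso: "iso (S \<inter> perp v) m (\<lambda>us. f (v # us))"
    and us: "length us = m" "set us \<subseteq> S \<inter> perp v"
  shows "f (v # e k # us) = 0"
proof -
  have len: "length (y # omit2 i k) = Suc m" for y using omit2[OF ik] by simp
  have "f (x # b y # omit2 i k) = 0" if y: "y = IE i \<or> y = IH" and x: "x \<in> S" for x y
  proof -
    have lin: "Vector_Spaces.linear scale (*) (\<lambda>x. f (x # b y # omit2 i k))"
      by (rule linear_head[OF alt_f len])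
    interpret vector_space_pair scale "(*) :: 'a \<Rightarrow> 'a \<Rightarrow> 'a"
      by (intro vector_space_pair.intro vector_space_axioms vector_space_over_itself.vector_space_axioms)
    show ?thesis
    proof (rule linear_eq_0_on_span[OF lin _ bvec_span[OF frame_S x]])
      fix x assume "x \<in> b ` idxs p"
      then obtain z where z: "z \<in> idxs p" "x = b z" by blast
      define zs where "zs = z # y # map IG (filter (\<lambda>j. j \<noteq> i \<and> j \<noteq> k) [0..<p])"
      have map_zs: "map b zs = x # b y # omit2 i k"
        by (simp add: zs_def z omit2_def o_def del: upt_Suc)
      have "\<exists>l<p. l \<noteq> i \<and> l \<noteq> k \<and> z \<noteq> IE l"
      proof -
        \<comment> \<open>The index that \<open>z\<close> forbids; for other labels the default
          \<open>i\<close> repeats an index that is excluded anyway.\<close>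
        define j where "j = (case z of IE j \<Rightarrow> j | _ \<Rightarrow> i)"
        have "\<not> {..<p} \<subseteq> {i, k, j}"
        proof
          assume "{..<p} \<subseteq> {i, k, j}"
          then have "p \<le> card {i, k, j}" using card_mono[of "{i, k, j}" "{..<p}"] by simp
          also have "\<dots> \<le> 3" by (simp add: card_insert_if)
          finally show False using m by simp
        qed
        then obtain l where "l < p" "l \<noteq> i" "l \<noteq> k" "l \<noteq> j" by auto
        then show ?thesis by (intro exI[of _ l]) (auto simp: j_def)
      qed
      then obtain l where l: "l < p" "l \<noteq> i" "l \<noteq> k" "z \<noteq> IE l" by blast
      have "f (map b zs) = 0"
      proof (rule eq_0_lone_g)
        show "length zs = p"
          using len[of x] unfolding omit2_def zs_def by (simp del: upt_Suc)
        show "set zs \<subseteq> idxs p" using z(1) y ik by (auto simp: zs_def)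
        show "IG l \<in> set zs" "IE l \<notin> set zs" using l y by (auto simp: zs_def)
        show "y \<in> set zs" "y = IH \<or> y \<in> range IE" using y by (auto simp: zs_def)
      qed
      then show "f (x # b y # omit2 i k) = 0" using map_zs by simp
    qed
  qed
  from this[of "IE i"] this[of IH] have 0: "f (x # e i # omit2 i k) = 0" "f (x # h # omit2 i k) = 0"
    if "x \<in> S" for x using that by auto
  have f_v: "f (x # v # omit2 i k) = f (x # g i # omit2 i k)" if "x \<in> S" for x
  proof -
    interpret l: Vector_Spaces.linear scale "(*)" "\<lambda>y. f ([x] @ y # omit2 i k)"
      by (rule alternating_linear_append[OF alt_f]) (use omit2[OF ik] in simp)
    have "f ([x] @ v # omit2 i k) = f ([x] @ g i # omit2 i k)"
      unfolding v l.add l.scale using 0[OF that] by simp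
    then show ?thesis by simp
  qed
  obtain d :: 'a where d: "d = 1 \<or> d = -1"
    "\<And>f. alternating_multilinear scale (*) (length (g i # omit2 i k)) f \<Longrightarrow>
      f (omit g p k) = d * f (g i # omit2 i k)"
    using alternating_permute[OF omit2(2)[OF ik]] by metis
  have "B (e k) x = ((-1) ^ k * d) * f (x # v # omit2 i k)" if "x \<in> S" for x
    using B_e[OF ik(2) that] d(2)[of "\<lambda>l. f (x # l)"] alternating_Cons[OF alt_f, of x] f_v[OF that]
      omit2(1)[OF ik] by simp
  moreover have "(-1) ^ k * d \<noteq> 0" using d(1) by auto
  moreover have "set (omit2 i k) \<subseteq> S \<inter> perp v"
    using ik frame_in frame_B by (auto simp: set_omit2 v)
  moreover have "e k \<in> S \<inter> perp v"
    using ik frame_in frame_B by (simp add: v)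
  ultimately show ?thesis
    using iso_contraction_eq_0[where c = "(-1) ^ k * d" and w = "e k" and ?us0.0 = "v # omit2 i k" and f = f and v = v,
        OF subspace_S alt_f iso omit2(1)[OF ik] _ refl _ _ _ us] by blast
qed

text \<open>The label \<open>IH\<close> takes a place, so some \<open>e i\<close> is absent. Either
  \<open>g i\<close> is present and unpaired, or the pair \<open>i\<close> is untouched and
  \<open>K\<close> applies.\<close>

lemma eq_0_with_h:
  assumes K: "\<And>i k R. i < p \<Longrightarrow> k < p \<Longrightarrow> i \<noteq> k \<Longrightarrow> length R = m \<Longrightarrow> set R \<subseteq> idxs p - {IH, IE i, IG i} \<Longrightarrow>
      f (h # e k # map b R) = 0"
    and zs: "length zs = p" "set zs \<subseteq> idxs p" "IH \<in> set zs" "IE k \<in> set zs"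
  shows "f (map b zs) = 0"
proof (cases "distinct zs")
  case False
  then have "\<not> distinct (map b zs)" by (simp add: distinct_map)
  then show ?thesis using alternating_not_distinct[OF alt_f] zs(1) by simp
next
  case True
  obtain i where i: "i < p" "IE i \<notin> set zs" by (rule ex_untouched[OF zs(1,3)]) auto
  show ?thesis
  proof (cases "IG i \<in> set zs")
    case True
    then show ?thesis using eq_0_lone_g[OF zs(1,2) True i(2) zs(3)] by simp
  next
    case False
    show ?thesis
    proof (rule alternating_reorder[OF alt_f zs(1) True, of "[IH, IE k]"])
      fix ys assume ys: "set ys = set zs - set [IH, IE k]" "length [IH, IE k] + length ys = p"
      have "set ys \<subseteq> idxs p - {IH, IE i, IG i}" using ys(1) zs(2) i(2) False by auto
      moreover have "k < p" "i \<noteq> k" using zs i by auto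
      ultimately show "f (map b ([IH, IE k] @ ys)) = 0"
        using K[of i k ys] i(1) ys(2) by simp
    qed (use zs in auto)
  qed
qed

text \<open>The hypotheses cover every monomial containing some \<open>e k\<close>: an unpaired
  \<open>g\<close> or an \<open>h\<close> is treated above, an unpaired \<open>e i\<close> falls
  under \<open>K1\<close>, and complete pairs only fall under \<open>K2\<close>. So all
  \<open>e i\<close> lie in the radical and \<open>h\<close> annihilates \<open>f\<close>; a
  representing vector is then a combination of the \<open>e i\<close>.\<close>

lemma iso_from_vanishing:
  assumes m: "m \<ge> 1"
    and K1: "\<And>i k R. i < p \<Longrightarrow> k < p \<Longrightarrow> i \<noteq> k \<Longrightarrow> length R = m \<Longrightarrow> set R \<subseteq> idxs p - {IH, IE i, IG i} \<Longrightarrow>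
      f (e i # e k # map b R) = 0"
    and K2: "\<And>i k R. i < p \<Longrightarrow> k < p \<Longrightarrow> i \<noteq> k \<Longrightarrow> Suc (length R) = m \<Longrightarrow> set R \<subseteq> idxs p - {IH, IE i, IG i} \<Longrightarrow>
      f (g i # e i # e k # map b R) = 0"
    and K3: "\<And>i k R. i < p \<Longrightarrow> k < p \<Longrightarrow> i \<noteq> k \<Longrightarrow> length R = m \<Longrightarrow> set R \<subseteq> idxs p - {IH, IE i, IG i} \<Longrightarrow>
      f (h # e k # map b R) = 0"
  shows "iso S (Suc m) f"
proof -
  have 0: "f (map b zs) = 0" if zs: "length zs = p" "set zs \<subseteq> idxs p" "distinct zs"
    and k: "IE k \<in> set zs" for zs k
  proof -
    have two: "\<exists>y\<in>set zs. y \<notin> X" if "finite X" "card X < p" for X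
      using card_mono[OF that(1), of "set zs"] distinct_card[OF zs(3)] zs(1) that(2)
      by (metis linorder_not_less subsetI)
    consider (IG) l where "IG l \<in> set zs" "IE l \<notin> set zs"
      | (IH) "IH \<in> set zs"
      | (IE) i where "IE i \<in> set zs" "IG i \<notin> set zs" "\<And>l. IG l \<in> set zs \<Longrightarrow> IE l \<in> set zs" "IH \<notin> set zs"
      | (EF) "\<And>l. IE l \<in> set zs \<longleftrightarrow> IG l \<in> set zs" "IH \<notin> set zs" by blast
    then show ?thesis
    proof cases
      case IG
      then show ?thesis using eq_0_lone_g[OF zs(1,2) IG k] by blast
    next
      case IH
      show ?thesis by (rule eq_0_with_h[OF _ zs(1,2) IH k]) (use K3 in blast)
    next
      case IE
      obtain y where y: "y \<in> set zs" "y \<noteq> IE i" using two[of "{IE i}"] by auto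
      obtain k' where k': "IE k' \<in> set zs" "k' \<noteq> i"
        by (rule idx.exhaust[of y]) (use y IE that in auto)
      show ?thesis
      proof (rule alternating_reorder[OF alt_f zs(1,3), of "[IE i, IE k']"])
        fix ys assume ys: "set ys = set zs - set [IE i, IE k']" "length [IE i, IE k'] + length ys = p"
        have "set ys \<subseteq> idxs p - {IH, IE i, IG i}" using ys(1) zs(2) IE by auto
        moreover have "k' < p" "i < p" using zs k' IE by auto
        ultimately show "f (map b ([IE i, IE k'] @ ys)) = 0"
          using K1[of i k' ys] k'(2) ys(2) by simp
      qed (use IE k' in auto)
    next
      case EF
      obtain y where y: "y \<in> set zs" "y \<notin> {IE k, IG k}"
        using two[of "{IE k, IG k}"] m by auto
      obtain k' where k': "IE k' \<in> set zs" "k' \<noteq> k"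
        by (rule idx.exhaust[of y]) (use EF y that in auto)
      show ?thesis
      proof (rule alternating_reorder[OF alt_f zs(1,3), of "[IG k, IE k, IE k']"])
        fix ys assume ys: "set ys = set zs - set [IG k, IE k, IE k']" "length [IG k, IE k, IE k'] + length ys = p"
        have "set ys \<subseteq> idxs p - {IH, IE k, IG k}" using ys(1) zs(2) EF by auto
        moreover have "k' < p" "k < p" using zs k' k by auto
        ultimately show "f (map b ([IG k, IE k, IE k'] @ ys)) = 0"
          using K2[of k k' ys] k'(2) ys(2) by simp
      qed (use EF k k' in auto)
    qed
  qed
  have e_kern: "e k \<in> kern S (Suc m) f" if k: "k < p" for k
    unfolding kern_def
  proof (intro CollectI conjI allI impI)
    fix us assume us: "length us = Suc m" "set us \<subseteq> S"
    show "f (e k # us) = 0"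
    proof (rule alternating_frame_eq_0[OF frame_S alternating_Cons[OF alt_f] _ us])
      fix zs assume zs: "length zs = Suc m" "distinct zs" "set zs \<subseteq> idxs p"
      show "f (e k # map b zs) = 0"
      proof (cases "IE k \<in> set zs")
        case True
        then have "b (IE k) \<in> b ` set zs" by (rule imageI)
        then show ?thesis by (intro alternating_not_distinct[OF alt_f]) (use zs in auto)
      next
        case False
        then show ?thesis using 0[of "IE k # zs" k] zs k by simp
      qed
    qed
  qed (use frame_in k in blast)
  have fh: "f (h # us) = 0" if us: "length us = Suc m" "set us \<subseteq> S" for us
  proof (rule alternating_frame_eq_0[OF frame_S alternating_Cons[OF alt_f] _ us])
    fix zs assume zs: "length zs = Suc m" "distinct zs" "set zs \<subseteq> idxs p"
    show "f (h # map b zs) = 0"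
    proof (cases "IH \<in> set zs")
      case True
      then have "b IH \<in> b ` set zs" by (rule imageI)
      then show ?thesis by (intro alternating_not_distinct[OF alt_f]) (use zs in auto)
    next
      case False
      have "zs \<noteq> []" using zs(1) by auto
      then obtain y where y: "y \<in> set zs" by (meson list.set_sel(1))
      have zs': "length (IH # zs) = p" "set (IH # zs) \<subseteq> idxs p" "distinct (IH # zs)" using zs False by auto
      show ?thesis
      proof (cases "\<exists>k. IE k \<in> set zs")
        case True
        then show ?thesis using 0[OF zs'] by auto
      next
        case noE: False
        \<comment> \<open>\<open>zs\<close> is nonempty and has neither \<open>IE\<close> labels nor
          \<open>IH\<close>, so an unpaired \<open>g l\<close> accompanies \<open>h\<close>.\<close>
        obtain l where "IG l \<in> set zs" by (rule idx.exhaust[of y]) (use y False noE that in auto)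
        then show ?thesis using eq_0_lone_g[OF zs'(1,2), of l IH] noE by auto
      qed
    qed
  qed
  show ?thesis
  proof (rule isoI)
    fix us us' w
    assume *: "length us = Suc m" "length us' = Suc m" "set us \<subseteq> S" "set us' \<subseteq> S" "w \<in> S"
      "\<And>x. x \<in> S \<Longrightarrow> B w x = f (x # us)"
    have "B w (e i) = 0" if "i < p" for i
      using *(6)[OF frame_in(1)[OF that]] e_kern[OF that] *(1,3) by (simp add: kern_def)
    moreover have "B w h = 0" using *(6)[OF frame_in(3)] fh *(1,3) by simp
    ultimately have w_eq: "w = (\<Sum>i<p. B w (g i) \<cdot> e i)"
      using frameD(12)[OF frame_S *(5)] by (simp add: hproj_def del: sum.lessThan_Suc)
    have "(\<Sum>i<p. B w (g i) \<cdot> e i) \<in> kern S (Suc m) f"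
      using e_kern by (intro subspace_sum subspace_scale subspace_kern[OF alt_f subspace_S]) auto
    then have "w \<in> kern S (Suc m) f" using w_eq by metis
    then show "f (w # us') = 0" using *(2,4) by (simp add: kern_def)
  qed
qed

end

section \<open>Isotropy is detected by contractions\<close>

context adapted_frame
begin

lemma f_head_linear:
  assumes "length us = Suc m"
  shows "f ((x + y) # us) = f (x # us) + f (y # us)" "f ((c \<cdot> x) # us) = c * f (x # us)"
    "f ((x - y) # us) = f (x # us) - f (y # us)" "f (0 # us) = 0"
proof -
  interpret l: Vector_Spaces.linear scale "(*)" "\<lambda>x. f (x # us)"
    using linear_head[OF alt_f assms] .
  show "f ((x + y) # us) = f (x # us) + f (y # us)" "f ((c \<cdot> x) # us) = c * f (x # us)"
    "f ((x - y) # us) = f (x # us) - f (y # us)" "f (0 # us) = 0"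
    by (rule l.add l.scale l.diff l.zero)+
qed

lemma f_third_diff:
  assumes "Suc (length us) = m"
  shows "f (x # y # (u - v) # us) = f (x # y # u # us) - f (x # y # v # us)"
proof -
  interpret l: Vector_Spaces.linear scale "(*)" "\<lambda>u. f ([x, y] @ u # us)"
    by (rule alternating_linear_append[OF alt_f]) (use assms in simp)
  show ?thesis using l.diff[of u v] by simp
qed

lemma f_g_e:
  assumes "i < p" "k < p" "i \<noteq> k" "length R = m" "set R \<subseteq> idxs p - {IE i}"
  shows "f (g i # e k # map b R) = 0"
  using eq_0_lone_g[of "[IG i, IE k] @ R" i "IE k"] assms by auto

lemma B_deformed:
  assumes "i < p" "x \<in> idxs p - {IH, IE i, IG i}"
  shows "B (g i + (a \<cdot> e i + c \<cdot> h)) (b x) = 0"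
proof -
  have "B h (b x) = 0" using assms frame_B by (cases x) auto
  then show ?thesis using B_bvec[OF frame_S assms(1)] assms by auto
qed

lemma deformed_perp:
  assumes "i < p" "set R \<subseteq> idxs p - {IH, IE i, IG i}"
  shows "set (map b R) \<subseteq> S \<inter> perp (g i + (a \<cdot> e i + c \<cdot> h))"
proof (rule b_in_perp)
  show "set R \<subseteq> idxs p" using assms(2) by blast
  show "B (g i + (a \<cdot> e i + c \<cdot> h)) (b x) = 0" if "x \<in> set R" for x
    using B_deformed[OF assms(1)] assms(2) that by blast
qed

text \<open>The vector \<open>h\<close> gives two isotropic deformations of \<open>g i\<close>, for
  \<open>c = 1\<close> and \<open>c = -1\<close>. Comparing them separates the \<open>e i\<close>
  term from the \<open>h\<close> term.\<close>

lemma iso_odd_adapted: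
  assumes odd: "odd (dim S)" and m: "m \<ge> 2"
  shows "iso S (Suc m) f"
proof -
  have hh: "B h h = 1" by (rule frameD(10)[OF frame_S odd])
  \<comment> \<open>The coefficient of \<open>e i\<close> makes
    \<open>B (v i c) (v i c) = c * c - 1\<close>.\<close>
  define v where "v i c = g i + ((- 1 / 2) \<cdot> e i + c \<cdot> h)" for i and c :: 'a
  have v_iso: "iso (S \<inter> perp (v i c)) m (\<lambda>us. f (v i c # us))" if i: "i < p" and c: "c * c = 1" for i c
  proof (rule iso_contraction)
    show "v i c \<in> S"
      unfolding v_def using frame_in i by (intro subspace_add[OF subspace_S] subspace_scale[OF subspace_S]) auto
    have "B (e i) (v i c) = 1" using frame_B i by (simp add: v_def)
    then show "v i c \<noteq> 0" by auto
    have "B (v i c) (v i c) = c * c - (1 / 2 + 1 / 2)"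
      using frame_B i hh by (simp add: v_def)
    then show "B (v i c) (v i c) = 0" unfolding half_add_half c by simp
  qed
  have v0: "f (v i c # e k # us) = 0"
    if "i < p" "k < p" "i \<noteq> k" "c * c = 1" "length us = m" "set us \<subseteq> S \<inter> perp (v i c)" for i k c us
    by (rule deformed_contraction_eq_0[OF m that(1-3) v_def v_iso[OF that(1,4)] that(5,6)])
  have v_expand: "f (v i c # us) = f (g i # us) - f (e i # us) / 2 + c * f (h # us)"
    if "length us = Suc m" for i c us
    unfolding v_def f_head_linear[OF that] by simp
  have K13: "f (e i # e k # map b R) = 0" "f (h # e k # map b R) = 0"
    if ik: "i < p" "k < p" "i \<noteq> k" and R: "length R = m" "set R \<subseteq> idxs p - {IH, IE i, IG i}" for i k R
  proof -
    have Rp: "set (map b R) \<subseteq> S \<inter> perp (v i c)" for c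
      unfolding v_def by (rule deformed_perp[OF ik(1) R(2)])
    have g0: "f (g i # e k # map b R) = 0" using f_g_e[OF ik R(1)] R(2) by auto
    have *: "c * f (h # e k # map b R) - f (e i # e k # map b R) / 2 = 0" if "c * c = 1" for c
      using v0[OF ik that _ Rp] v_expand[of "e k # map b R" i c] g0 R(1) by simp
    have h1: "f (h # e k # map b R) = f (e i # e k # map b R) / 2" using *[of 1] by simp
    have h2: "- f (h # e k # map b R) = f (e i # e k # map b R) / 2" using *[of "-1"] by simp
    have "f (e i # e k # map b R) / 2 + f (e i # e k # map b R) / 2 = 0"
      using h1 h2 by (metis add.right_inverse)
    then show "f (e i # e k # map b R) = 0" by (simp only: half_add_half)
    then show "f (h # e k # map b R) = 0" using h1 by simp
  qed
  have H0: "f (map b zs) = 0" if "length zs = p" "set zs \<subseteq> idxs p" "IH \<in> set zs" "IE k \<in> set zs" for zs k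
    by (rule eq_0_with_h[OF _ that]) (use K13 in blast)
  show ?thesis
  proof (rule iso_from_vanishing)
    show "m \<ge> 1" using m by simp
  next
    fix i k R
    assume *: "i < p" "k < p" "i \<noteq> k" "length R = m" "set R \<subseteq> idxs p - {IH, IE i, IG i}"
    show "f (e i # e k # map b R) = 0" "f (h # e k # map b R) = 0" using K13[OF *] .
  next
    fix i k R
    assume ik: "i < p" "k < p" "i \<noteq> k" and R: "Suc (length R) = m" "set R \<subseteq> idxs p - {IH, IE i, IG i}"
    let ?Y = "map b R"
    have Y: "Suc (length ?Y) = m" using R(1) by simp
    have Rp: "set ?Y \<subseteq> S \<inter> perp (v i 1)"
      unfolding v_def by (rule deformed_perp[OF ik(1) R(2)])
    \<comment> \<open>\<open>h - e i\<close> is orthogonal to \<open>v i 1\<close> and brings in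
      \<open>e i\<close>; all terms with both \<open>h\<close> and \<open>e k\<close> vanish by
      \<open>H0\<close>, so only \<open>f (g i # e k # e i # ?Y)\<close> survives.\<close>
    have "B (v i 1) (h - e i) = 0" using frame_B ik hh by (simp add: v_def)
    then have "set ((h - e i) # ?Y) \<subseteq> S \<inter> perp (v i 1)"
      using Rp frame_in ik subspace_diff[OF subspace_S] by simp
    then have "f (v i 1 # e k # (h - e i) # ?Y) = 0" using v0[OF ik, of 1 "(h - e i) # ?Y"] R by simp
    then have eq: "f (g i # e k # (h - e i) # ?Y) - f (e i # e k # (h - e i) # ?Y) / 2 +
        f (h # e k # (h - e i) # ?Y) = 0"
      using v_expand[of "e k # (h - e i) # ?Y" i 1] R by simp
    have "f (map b ([IG i, IE k, IH] @ R)) = 0" "f (map b ([IE i, IE k, IH] @ R)) = 0"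
      "f (map b ([IH, IE k, IE i] @ R)) = 0"
      by (rule H0[where k = k]; use ik R in auto)+
    moreover have "f (e i # e k # e i # ?Y) = 0" "f (h # e k # h # ?Y) = 0"
      by (rule alternating_not_distinct[OF alt_f]; use R in auto)+
    ultimately have "f (g i # e k # e i # ?Y) = 0"
      using eq unfolding f_third_diff[OF Y] by simp
    then show "f (g i # e i # e k # ?Y) = 0"
      by (rule alternating_eq_0_permute[OF alt_f, rotated 2]) (use R in auto)
  qed
qed

text \<open>With \<open>h = 0\<close> the deformation \<open>g i + e i\<close> has square 2, so
  contractions with nonisotropic vectors are assumed as well; \<open>iso_even\<close> provides
  them.\<close>

lemma iso_even_adapted:
  assumes even: "even (dim S)" and m: "m \<ge> 2"
    and iso: "\<And>v. v \<in> S \<Longrightarrow> B v v \<noteq> 0 \<Longrightarrow> iso (S \<inter> perp v) m (\<lambda>us. f (v # us))"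
  shows "iso S (Suc m) f"
proof -
  have h0: "h = 0" by (rule frameD(11)[OF frame_S even])
  define v where "v i = g i + (1 \<cdot> e i + 0 \<cdot> h)" for i
  have v_S: "v i \<in> S" if "i < p" for i
    unfolding v_def using frame_in that by (intro subspace_add[OF subspace_S] subspace_scale[OF subspace_S]) auto
  have v_iso: "iso (S \<inter> perp (v i)) m (\<lambda>us. f (v i # us))" if i: "i < p" for i
    by (rule iso[OF v_S[OF i]]) (use frame_B i two_neq_0 in \<open>simp add: v_def\<close>)
  have v0: "f (v i # e k # us) = 0"
    if "i < p" "k < p" "i \<noteq> k" "length us = m" "set us \<subseteq> S \<inter> perp (v i)" for i k us
    by (rule deformed_contraction_eq_0[OF m that(1-3) v_def v_iso[OF that(1)] that(4,5)])
  have v_expand: "f (v i # us) = f (g i # us) + f (e i # us)" if "length us = Suc m" for i us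
    unfolding v_def f_head_linear[OF that] by simp
  have Rp: "set (map b R) \<subseteq> S \<inter> perp (v i)" if "i < p" "set R \<subseteq> idxs p - {IH, IE i, IG i}" for i R
    unfolding v_def by (rule deformed_perp[OF that])
  show ?thesis
  proof (rule iso_from_vanishing)
    show "m \<ge> 1" using m by simp
  next
    fix i k R
    assume *: "i < p" "k < p" "i \<noteq> k" "length R = m" "set R \<subseteq> idxs p - {IH, IE i, IG i}"
    have "f (g i # e k # map b R) = 0" using f_g_e[OF *(1-4)] *(5) by auto
    then show "f (e i # e k # map b R) = 0"
      using v0[OF *(1-3) _ Rp[OF *(1,5)]] v_expand[of "e k # map b R" i] *(4) by simp
    show "f (h # e k # map b R) = 0" unfolding h0 by (rule f_head_linear(4)) (use *(4) in simp)
  next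
    fix i k R
    assume ik: "i < p" "k < p" "i \<noteq> k" and R: "Suc (length R) = m" "set R \<subseteq> idxs p - {IH, IE i, IG i}"
    let ?Y = "map b R"
    have Y: "Suc (length ?Y) = m" using R(1) by simp
    \<comment> \<open>Both surviving terms of the expansion equal
      \<open>- f (g i # e k # e i # ?Y)\<close>, so characteristic different from 2
      finishes.\<close>
    have "B (v i) (g i - e i) = 0" using frame_B ik by (simp add: v_def)
    then have "set ((g i - e i) # ?Y) \<subseteq> S \<inter> perp (v i)"
      using Rp[OF ik(1) R(2)] frame_in ik subspace_diff[OF subspace_S] by simp
    then have "f (v i # e k # (g i - e i) # ?Y) = 0" using v0[OF ik, of "(g i - e i) # ?Y"] R by simp
    then have eq: "f (g i # e k # (g i - e i) # ?Y) + f (e i # e k # (g i - e i) # ?Y) = 0"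
      using v_expand[of "e k # (g i - e i) # ?Y" i] R by simp
    have z: "f (e i # e k # e i # ?Y) = 0" "f (g i # e k # g i # ?Y) = 0"
      by (rule alternating_not_distinct[OF alt_f]; use R in auto)+
    have "f (e i # e k # g i # ?Y) = - f (e k # e i # g i # ?Y)"
      by (rule alternating_swap_head[OF alt_f]) (use R in simp)
    also have "f (e k # e i # g i # ?Y) = - f (e k # g i # e i # ?Y)"
      using alternating_swap[OF alt_f, of "[e k]" ?Y "e i" "g i"] R by simp
    also have "f (e k # g i # e i # ?Y) = - f (g i # e k # e i # ?Y)"
      by (rule alternating_swap_head[OF alt_f]) (use R in simp)
    finally have "f (g i # e k # e i # ?Y) + f (g i # e k # e i # ?Y) = 0"
      using eq unfolding f_third_diff[OF Y] z by (simp add: algebra_simps)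
    then have "2 * f (g i # e k # e i # ?Y) = 0" by (simp only: mult_2)
    then have "f (g i # e k # e i # ?Y) = 0" using two_neq_0 by simp
    then show "f (g i # e i # e k # ?Y) = 0"
      by (rule alternating_eq_0_permute[OF alt_f, rotated 2]) (use R in auto)
  qed
qed

end

context quad_space
begin

lemma iso_odd:
  assumes S: "nondeg S" "odd (dim S)" "dim S div 2 = Suc (Suc m)" and m: "m \<ge> 2"
    and f: "alternating_multilinear scale (*) (Suc (Suc m)) f"
    and iso: "\<And>v. v \<in> S \<Longrightarrow> v \<noteq> 0 \<Longrightarrow> B v v = 0 \<Longrightarrow> iso (S \<inter> perp v) m (\<lambda>us. f (v # us))"
  shows "iso S (Suc m) f"
proof (cases "\<exists>as. length as = Suc (Suc m) \<and> set as \<subseteq> S \<and> f as \<noteq> 0")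
  case True
  then obtain as where as: "length as = Suc (Suc m)" "set as \<subseteq> S" "f as \<noteq> 0" by blast
  have "m \<ge> 1" using m by simp
  from ex_adapted_frame[OF S(1,3) this f as iso] obtain e g h where "adapted_frame scale Bas B S m f e g h"
    by blast
  then show ?thesis using S(2) m by (rule adapted_frame.iso_odd_adapted)
next
  case False
  then show ?thesis unfolding iso_def by (metis length_Cons list.set(2) insert_subset)
qed

text \<open>A nonisotropic \<open>v\<close> reduces the even case to the odd one: the contraction with \<open>v\<close> on the odd-dimensional
  space \<open>S \<inter> perp v\<close> inherits the hypothesis.\<close>

lemma iso_even:
  assumes S: "nondeg S" "even (dim S)" "dim S div 2 = Suc (Suc m)" and m: "m \<ge> 3"
    and f: "alternating_multilinear scale (*) (Suc (Suc m)) f"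
    and iso: "\<And>v. v \<in> S \<Longrightarrow> v \<noteq> 0 \<Longrightarrow> B v v = 0 \<Longrightarrow> iso (S \<inter> perp v) m (\<lambda>us. f (v # us))"
  shows "iso S (Suc m) f"
proof (cases "\<exists>as. length as = Suc (Suc m) \<and> set as \<subseteq> S \<and> f as \<noteq> 0")
  case True
  then obtain as where as: "length as = Suc (Suc m)" "set as \<subseteq> S" "f as \<noteq> 0" by blast
  have "m \<ge> 1" using m by simp
  from ex_adapted_frame[OF S(1,3) this f as iso] obtain e g h where ad: "adapted_frame scale Bas B S m f e g h"
    by blast
  show ?thesis
  proof (rule adapted_frame.iso_even_adapted[OF ad S(2)])
    show "m \<ge> 2" using m by simp
    fix v assume v: "v \<in> S" "B v v \<noteq> 0"
    \<comment> \<open>Passing to \<open>?T\<close> loses one hyperbolic pair, and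
      \<open>iso_odd\<close> still needs \<open>n \<ge> 2\<close>; hence
      \<open>m \<ge> 3\<close>.\<close>
    obtain n where n: "m = Suc n" "n \<ge> 2" using m by (cases m) auto
    let ?T = "S \<inter> perp v"
    have dimT: "dim S = Suc (dim ?T)" and T: "nondeg ?T" using nondeg_perp[OF S(1) v] by auto
    have oddT: "odd (dim ?T)" using S(2) unfolding dimT by simp
    have dT: "dim ?T div 2 = Suc (Suc n)"
      using even_two_times_div_two[OF S(2)] odd_two_times_div_two_succ[OF oddT] dimT S(3) n by linarith
    have "iso ?T (Suc n) (\<lambda>us. f (v # us))"
    proof (rule iso_odd[OF T oddT dT n(2)])
      show "alternating_multilinear scale (*) (Suc (Suc n)) (\<lambda>us. f (v # us))"
        using alternating_Cons[OF f] by (simp add: n)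
      fix u assume u: "u \<in> ?T" "u \<noteq> 0" "B u u = 0"
      have uv: "B u v = 0" using u(1) by (simp add: B_sym[of u v])
      have isou: "iso (S \<inter> perp u) (Suc n) (\<lambda>us. f (u # us))" using iso[of u] u by (simp add: n)
      show "iso (?T \<inter> perp u) n (\<lambda>us. f (v # u # us))"
      proof (rule isoI)
        fix us us' :: "'v list" and w
        assume *: "length us = n" "length us' = n" "set us \<subseteq> ?T \<inter> perp u" "set us' \<subseteq> ?T \<inter> perp u"
          "w \<in> ?T \<inter> perp u" "\<And>x. x \<in> ?T \<inter> perp u \<Longrightarrow> B w x = f (v # u # x # us)"
        \<comment> \<open>\<open>v\<close> joins the fixed arguments of the contraction with
          \<open>u\<close>, for which isotropy is known. That \<open>w\<close> represents the form
          on all of \<open>S \<inter> perp u\<close> follows because both sides vanish at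
          \<open>v\<close>.\<close>
        have "f (u # w # v # us') = 0"
        proof (rule isoD[OF isou, of "v # us" "v # us'" w])
          fix x assume x: "x \<in> S \<inter> perp u"
          define x1 where "x1 = x - (B v x / B v v) \<cdot> v"
          have x1: "x1 \<in> ?T \<inter> perp u"
            using x v uv subspace_diff[OF nondeg_subspace[OF S(1)]]
              subspace_scale[OF nondeg_subspace[OF S(1)]] by (simp add: x1_def)
          have "B w x = B w x1" using *(5) by (simp add: x1_def B_sym[of w v])
          also have "\<dots> = f (v # u # x1 # us)" using *(6)[OF x1] .
          also have "\<dots> = - f (u # v # x1 # us)"
            by (rule alternating_swap_head[OF f]) (use * n in simp)
          also have "f (u # v # x1 # us) = - f (u # x1 # v # us)"
            using alternating_swap[OF f, of "[u]" us v x1] * n by simp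
          also have "f (u # x1 # v # us) = f (u # x # v # us)"
          proof -
            interpret l: Vector_Spaces.linear scale "(*)" "\<lambda>x. f ([u] @ x # v # us)"
              by (rule alternating_linear_append[OF f]) (use * n in simp)
            have "f (u # v # v # us) = 0"
              by (rule alternating_not_distinct[OF f]) (use * n in auto)
            then show ?thesis using l.diff[of x "(B v x / B v v) \<cdot> v"] l.scale[of _ v] by (simp add: x1_def)
          qed
          finally show "B w x = f (u # x # v # us)" by simp
        qed (use * uv v in auto)
        then show "f (v # u # w # us') = 0"
          by (rule alternating_eq_0_permute[OF f, rotated 2]) (use * n in auto)
      qed
    qed
    then show "iso ?T m (\<lambda>us. f (v # us))" by (simp add: n)
  qed
next
  case False
  then show ?thesis unfolding iso_def by (metis length_Cons list.set(2) insert_subset)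
qed

text \<open>For isotropic \<open>v\<close>, \<open>iso_perp_iff\<close> moves the contraction to a
  space of dimension two less, where the induction hypothesis applies; \<open>v\<close> is then put
  in front of \<open>gs\<close>. The condition on \<open>span (set gs)\<close> makes
  \<open>gs\<close> span a maximal isotropic subspace of the complement of \<open>T\<close>, as
  \<open>igcp_contraction\<close> requires.\<close>

lemma iso_from_sections:
  assumes "nondeg S" and "dim S div 2 = Suc k + r" and "k \<ge> (if odd (dim S) then 2 else 3)"
    and "alternating_multilinear scale (*) (Suc k + r) f"
    and "\<And>T gs. nondeg T \<Longrightarrow> T \<subseteq> S \<Longrightarrow> dim S = dim T + 2 * r \<Longrightarrow> length gs = r \<Longrightarrow> set gs \<subseteq> S \<Longrightarrow>
      (\<forall>u\<in>set gs. \<forall>v\<in>set gs. B u v = 0) \<Longrightarrow> (\<forall>u\<in>set gs. \<forall>x\<in>T. B u x = 0) \<Longrightarrow>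
      (\<forall>x\<in>S. (\<forall>y\<in>T. B x y = 0) \<longrightarrow> (\<forall>u\<in>set gs. B x u = 0) \<longrightarrow> x \<in> span (set gs)) \<Longrightarrow>
      iso T k (\<lambda>us. f (gs @ us))"
  shows "iso S (k + r) f"
  using assms
proof (induction r arbitrary: S f)
  case 0
  have "iso S k (\<lambda>us. f ([] @ us))"
    by (rule "0.prems"(5)) (use 0 nondegD[OF "0.prems"(1)] in auto)
  then show ?case by simp
next
  case (Suc r)
  note S = Suc.prems(1) and test = Suc.prems(5)
  obtain m where m: "k + r = m" "m \<ge> (if odd (dim S) then 2 else 3)"
    using Suc.prems(3) by (auto split: if_splits)
  have f: "alternating_multilinear scale (*) (Suc (Suc m)) f" using Suc.prems(4) m by simp
  have d: "dim S div 2 = Suc (Suc m)" using Suc.prems(2) m by simp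
  have iso: "iso (S \<inter> perp v) m (\<lambda>us. f (v # us))" if v: "v \<in> S" "v \<noteq> 0" "B v v = 0" for v
  proof -
    obtain u where u: "u \<in> S" "B u u = 0" "B v u = 1" using ex_hyperbolic_partner[OF S v] by blast
    let ?S1 = "S \<inter> perp v \<inter> perp u"
    note pair = hyperbolic_pair_complement[OF S v(1) u(1) v(3) u(2,3)]
    have f1: "alternating_multilinear scale (*) (Suc m) (\<lambda>us. f (v # us))"
      by (rule alternating_Cons[OF f])
    have v_kern: "v \<in> kern (S \<inter> perp v) m (\<lambda>us. f (v # us))"
      using v by (auto simp: kern_def intro: alternating_not_distinct[OF f])
    have "iso ?S1 (k + r) (\<lambda>us. f (v # us))"
    proof (rule Suc.IH)
      show "nondeg ?S1" by (rule pair(1))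
      show "dim ?S1 div 2 = Suc k + r" using pair(2) Suc.prems(2) by simp
      show "k \<ge> (if odd (dim ?S1) then 2 else 3)" using Suc.prems(3) pair(2) by simp
      show "alternating_multilinear scale (*) (Suc k + r) (\<lambda>us. f (v # us))" using f1 m by simp
      fix T gs
      assume T: "nondeg T" "T \<subseteq> ?S1" "dim ?S1 = dim T + 2 * r" and gs: "length gs = r" "set gs \<subseteq> ?S1"
        "\<forall>u\<in>set gs. \<forall>v\<in>set gs. B u v = 0" "\<forall>u\<in>set gs. \<forall>x\<in>T. B u x = 0"
        "\<forall>x\<in>?S1. (\<forall>y\<in>T. B x y = 0) \<longrightarrow> (\<forall>u\<in>set gs. B x u = 0) \<longrightarrow> x \<in> span (set gs)"
      have gsv: "B v y = 0" "B y v = 0" "B u y = 0" if "y \<in> set gs \<or> y \<in> T" for y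
        using that gs(2) T(2) B_sym[of y v] by auto
      have "iso T k (\<lambda>us. f ((v # gs) @ us))"
      proof (rule test[OF T(1)])
        show "T \<subseteq> S" "dim S = dim T + 2 * Suc r" "length (v # gs) = Suc r" "set (v # gs) \<subseteq> S"
          using T gs pair(2) v by auto
        show "\<forall>x\<in>set (v # gs). \<forall>y\<in>set (v # gs). B x y = 0" "\<forall>x\<in>set (v # gs). \<forall>y\<in>T. B x y = 0"
          using gs gsv v by auto
        show "\<forall>x\<in>S. (\<forall>y\<in>T. B x y = 0) \<longrightarrow> (\<forall>y\<in>set (v # gs). B x y = 0) \<longrightarrow> x \<in> span (set (v # gs))"
        proof (intro ballI impI)
          fix x assume x: "x \<in> S" "\<forall>y\<in>T. B x y = 0" "\<forall>y\<in>set (v # gs). B x y = 0"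
          define x1 where "x1 = x - B x u \<cdot> v - B x v \<cdot> u"
          have "x1 \<in> ?S1" unfolding x1_def by (rule pair(3)[OF x(1)])
          moreover have "\<forall>y\<in>T. B x1 y = 0" "\<forall>y\<in>set gs. B x1 y = 0"
            using x gsv by (auto simp: x1_def)
          ultimately have "x1 \<in> span (set gs)" using gs(5) by blast
          then have "x1 \<in> span (set (v # gs))"
            using span_mono[of "set gs" "set (v # gs)"] by auto
          then have "x1 + B x u \<cdot> v \<in> span (set (v # gs))"
            by (intro span_add span_scale) (simp_all add: span_base)
          moreover have "x = x1 + B x u \<cdot> v" using x(3) by (simp add: x1_def)
          ultimately show "x \<in> span (set (v # gs))" by metis
        qed
      qed
      then show "iso T k (\<lambda>us. f (v # gs @ us))" by simp
    qed
    then show ?thesis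
      using iso_perp_iff[OF S v(1) u(1) v(3) u(2,3) f1 v_kern] m by simp
  qed
  show ?case
  proof (cases "odd (dim S)")
    case True
    then have "iso S (Suc m) f" using m(2) by (intro iso_odd[OF S True d _ f iso]) simp_all
    then show ?thesis using m(1) by simp
  next
    case False
    then have "iso S (Suc m) f" using m(2) by (intro iso_even[OF S _ d _ f iso]) simp_all
    then show ?thesis using m(1) by simp
  qed
qed

end

section \<open>Elements of an exterior power as alternating forms\<close>

lemma linear_functionalI:
  fixes s :: "'a::field \<Rightarrow> 'v::ab_group_add \<Rightarrow> 'v"
  assumes "vector_space s" "\<And>x y. l (x + y) = l x + l y" "\<And>c x. l (s c x) = c * l x"
  shows "Vector_Spaces.linear s (*) l"
proof -
  interpret vector_space s by fact
  show ?thesis by unfold_locales (simp_all add: assms)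
qed

locale quad_exterior = quad_space scale Bas B + ext: exterior_power scale sE k wedge
  for scale :: "'a::alg_closed_field \<Rightarrow> 'v::ab_group_add \<Rightarrow> 'v" (infixr "\<cdot>" 75)
    and Bas and B and sE :: "'a \<Rightarrow> 'e::ab_group_add \<Rightarrow> 'e" and k and wedge
begin

text \<open>The uniqueness half of the universal property, used in place of the fact that wedge
  products span.\<close>

lemma functional_eqI:
  assumes "Vector_Spaces.linear sE (*) l1" "Vector_Spaces.linear sE (*) l2"
    and "\<And>vs. length vs = k \<Longrightarrow> l1 (wedge vs) = l2 (wedge vs)"
  shows "l1 x = l2 x"
proof -
  have "alternating_multilinear scale (*) k (\<lambda>vs. l1 (wedge vs))"
    by (rule alternating_multilinear_compose[OF ext.alternating_multilinear_wedge assms(1)])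
  from ext.universal_scalar[OF this] have "l1 = l2" using assms by (metis (no_types, lifting))
  then show ?thesis by simp
qed

text \<open>The universal property extends the Gram determinant with \<open>us\<close> from wedge
  products to the whole exterior power.\<close>

definition hat :: "'e \<Rightarrow> 'v list \<Rightarrow> 'a" where
  "hat x us = (THE l. Vector_Spaces.linear sE (*) l \<and>
     (\<forall>vs. length vs = k \<longrightarrow> l (wedge vs) = gram_det vs us)) x"

lemma
  assumes "length us = k"
  shows linear_hat: "Vector_Spaces.linear sE (*) (\<lambda>x. hat x us)"
    and hat_wedge: "length vs = k \<Longrightarrow> hat (wedge vs) us = gram_det vs us"
proof -
  have "alternating_multilinear scale (*) k (\<lambda>vs. gram_det vs us)"
    using alternating_gram_det_left[of us] assms by simp
  from theI'[OF ext.universal_scalar[OF this]]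
  show "Vector_Spaces.linear sE (*) (\<lambda>x. hat x us)"
    "length vs = k \<Longrightarrow> hat (wedge vs) us = gram_det vs us"
    unfolding hat_def by simp_all
qed

lemma hat_sum: "length us = k \<Longrightarrow> hat (\<Sum>i\<in>I. x i) us = (\<Sum>i\<in>I. hat (x i) us)"
  and hat_scale: "length us = k \<Longrightarrow> hat (sE c y) us = c * hat y us"
  and hat_add: "length us = k \<Longrightarrow> hat (y + z) us = hat y us + hat z us"
  and hat_diff: "length us = k \<Longrightarrow> hat (y - z) us = hat y us - hat z us"
  and hat_zero: "length us = k \<Longrightarrow> hat 0 us = 0"
proof -
  assume us: "length us = k"
  interpret l: Vector_Spaces.linear sE "(*)" "\<lambda>x. hat x us" by (rule linear_hat[OF us])
  show "hat (\<Sum>i\<in>I. x i) us = (\<Sum>i\<in>I. hat (x i) us)" "hat (sE c y) us = c * hat y us"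
    "hat (y + z) us = hat y us + hat z us" "hat (y - z) us = hat y us - hat z us" "hat 0 us = 0"
    by (rule l.sum l.scale l.add l.diff l.zero)+
qed

lemma alternating_hat: "alternating_multilinear scale (*) k (hat x)"
proof (rule alternating_multilinearI)
  fix xs ys :: "'v list" assume len: "Suc (length xs + length ys) = k"
  then have l: "length (xs @ a # ys) = k" for a by simp
  interpret EK: vector_space_pair sE "(*) :: 'a \<Rightarrow> 'a \<Rightarrow> 'a"
    by (intro vector_space_pair.intro ext.E.vector_space_axioms
        vector_space_over_itself.vector_space_axioms)
  have gd: "Vector_Spaces.linear scale (*) (\<lambda>a. gram_det vs (xs @ a # ys))" if "length vs = k" for vs
    by (rule alternating_linear_append[OF alternating_gram_det]) (use len that in simp)
  show "Vector_Spaces.linear scale (*) (\<lambda>a. hat x (xs @ a # ys))"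
  proof (rule linear_functionalI[OF vector_space_axioms])
    fix a b c
    show "hat x (xs @ (a + b) # ys) = hat x (xs @ a # ys) + hat x (xs @ b # ys)"
    proof (rule functional_eqI[of "\<lambda>x. hat x (xs @ (a + b) # ys)"
          "\<lambda>x. hat x (xs @ a # ys) + hat x (xs @ b # ys)"])
      fix vs :: "'v list" assume vs: "length vs = k"
      interpret g: Vector_Spaces.linear scale "(*)" "\<lambda>a. gram_det vs (xs @ a # ys)" by (rule gd[OF vs])
      show "hat (wedge vs) (xs @ (a + b) # ys) = hat (wedge vs) (xs @ a # ys) + hat (wedge vs) (xs @ b # ys)"
        unfolding hat_wedge[OF l vs] by (rule g.add)
    qed (intro EK.linear_compose_add linear_hat l)+
    show "hat x (xs @ (c \<cdot> a) # ys) = c * hat x (xs @ a # ys)"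
    proof (rule functional_eqI[of "\<lambda>x. hat x (xs @ (c \<cdot> a) # ys)" "\<lambda>x. c * hat x (xs @ a # ys)"])
      fix vs :: "'v list" assume vs: "length vs = k"
      interpret g: Vector_Spaces.linear scale "(*)" "\<lambda>a. gram_det vs (xs @ a # ys)" by (rule gd[OF vs])
      show "hat (wedge vs) (xs @ (c \<cdot> a) # ys) = c * hat (wedge vs) (xs @ a # ys)"
        unfolding hat_wedge[OF l vs] by (rule g.scale)
    qed (intro linear_functional_scale linear_hat l)+
  qed
next
  fix us :: "'v list" and i j
  assume us: "length us = k" "i < j" "j < k" "us ! i = us ! j"
  then have nd: "\<not> distinct us" by (metis distinct_conv_nth less_irrefl less_trans)
  \<comment> \<open>The zero functional is written as a multiple of \<open>hat\<close>, which makes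
    its linearity immediate.\<close>
  have "hat x us = 0 * hat x us"
  proof (rule functional_eqI[of "\<lambda>x. hat x us" "\<lambda>x. 0 * hat x us"])
    fix vs :: "'v list" assume "length vs = k"
    then show "hat (wedge vs) us = 0 * hat (wedge vs) us"
      using hat_wedge[OF us(1)] alternating_not_distinct[OF alternating_gram_det _ nd] us(1) by simp
  qed (intro linear_functional_scale linear_hat us(1))+
  then show "hat x us = 0" by simp
qed

end

context quad_space
begin

section \<open>Coordinates: dual bases and the quadratic equations of the cone\<close>

definition dual_bases :: "nat \<Rightarrow> (nat \<Rightarrow> 'v) \<Rightarrow> (nat \<Rightarrow> 'v) \<Rightarrow> bool" where
  "dual_bases n b b' \<longleftrightarrow> (\<forall>i<n. \<forall>j<n. B (b i) (b' j) = (if i = j then 1 else 0)) \<and>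
    (\<forall>x. x = (\<Sum>j<n. B x (b' j) \<cdot> b j)) \<and> (\<forall>x. x = (\<Sum>j<n. B x (b j) \<cdot> b' j))"

lemma ex_dual_bases: "\<exists>n b b'. dual_bases n b b'"
proof -
  define n where "n = card Bas"
  obtain b where b: "bij_betw b {..<n} Bas"
    using ex_bij_betw_nat_finite[OF finite_Basis] unfolding n_def atLeast0LessThan by blast
  have inUNIV: "x \<in> span Bas" for x using span_Basis by simp
  have "Vector_Spaces.linear scale (*) (\<lambda>x. representation Bas x (b j))" for j
    by (rule linear_functionalI[OF vector_space_axioms])
      (simp_all add: representation_add[OF independent_Basis] representation_scale[OF independent_Basis] inUNIV)
  from riesz[OF nondeg_UNIV this] obtain b' where b': "\<And>x j. B (b' j) x = representation Bas x (b j)"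
    by (metis UNIV_I)
  have delta: "B (b i) (b' j) = (if i = j then 1 else 0)" if "i < n" "j < n" for i j
  proof -
    have "b i \<in> Bas" "b i = b j \<longleftrightarrow> i = j"
      using b that by (auto simp: bij_betw_def inj_on_def)
    then show ?thesis
      using b'[of j "b i"] representation_basis[OF independent_Basis, of "b i"] B_sym[of "b i"] by auto
  qed
  have exp: "x = (\<Sum>j<n. B x (b' j) \<cdot> b j)" for x
  proof -
    have "x = (\<Sum>c\<in>Bas. representation Bas x c \<cdot> c)"
      using sum_representation_eq[OF independent_Basis inUNIV finite_Basis order_refl] by simp
    also have "\<dots> = (\<Sum>j<n. representation Bas x (b j) \<cdot> b j)"
      by (rule sum.reindex_bij_betw[OF b, symmetric])
    finally show ?thesis using b' B_sym by simp
  qed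
  have "x = (\<Sum>j<n. B x (b j) \<cdot> b' j)" for x
  proof -
    have "B (x - (\<Sum>j<n. B x (b j) \<cdot> b' j)) y = 0" for y
    proof -
      have "B x y = B x (\<Sum>j<n. B y (b' j) \<cdot> b j)" using exp[of y] by simp
      then show ?thesis by (simp add: B_sum B_sum' B_sym[of y] mult.commute)
    qed
    then have "x - (\<Sum>j<n. B x (b j) \<cdot> b' j) = 0" by (rule B_nondegenerate)
    then show ?thesis by simp
  qed
  with delta exp have "dual_bases n b b'" unfolding dual_bases_def by blast
  then show ?thesis by blast
qed

text \<open>Both sides are alternating, so lists of distinct vectors \<open>b j\<close> suffice.
  After sorting, the Gram determinants are 1 for the matching index set and 0 for all
  others.\<close>

lemma alternating_expansion:
  assumes dual: "dual_bases n b b'"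
    and f: "alternating_multilinear scale (*) k f" and vs: "length vs = k"
  shows "f vs = (\<Sum>I\<in>{I. I \<subseteq> {..<n} \<and> card I = k}.
    f (map b (sorted_list_of_set I)) * gram_det vs (map b' (sorted_list_of_set I)))" (is "_ = ?rhs vs")
proof (rule alternating_span_eq[OF f _ vector_space_axioms _ vs])
  have b: "B (b i) (b' j) = (if i = j then 1 else 0)" if "i < n" "j < n" for i j
    using dual that by (simp add: dual_bases_def)
  have exp: "x = (\<Sum>j<n. B x (b' j) \<cdot> b j)" for x
    using dual by (simp only: dual_bases_def)
  let ?P = "{I. I \<subseteq> {..<n} \<and> card I = k}"
  have fin: "finite I" if "I \<in> ?P" for I using that finite_subset[OF _ finite_lessThan] by auto
  have len: "length (sorted_list_of_set I) = k" if "I \<in> ?P" for I using that by simp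
  show rhs: "alternating_multilinear scale (*) k ?rhs"
  proof (intro alternating_sum_form[OF vector_space_axioms] alternating_scale_form)
    fix I assume "I \<in> ?P"
    then show "alternating_multilinear scale (*) k (\<lambda>us. gram_det us (map b' (sorted_list_of_set I)))"
      using alternating_gram_det_left[of "map b' (sorted_list_of_set I)"] by simp
  qed
  have "x \<in> span (b ` {..<n})" for x
    by (subst exp) (intro span_sum span_scale span_base imageI)
  then show "set vs \<subseteq> span (b ` {..<n})" by auto
  fix zs assume zs: "length zs = k" "set zs \<subseteq> b ` {..<n}" "distinct zs"
  have "zs \<in> lists (b ` {..<n})" using zs(2) by auto
  then obtain js where js: "zs = map b js" "set js \<subseteq> {..<n}" unfolding lists_image by auto
  have djs: "distinct js" using zs(3) js(1) by (simp add: distinct_map)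
  define J where "J = set js"
  have J: "J \<in> ?P" using js zs(1) djs distinct_card[OF djs] by (simp add: J_def)
  let ?bJ = "map b (sorted_list_of_set J)"
  have "mset js = mset (sorted_list_of_set J)"
    by (rule iffD1[OF set_eq_iff_mset_eq_distinct]) (use djs in \<open>auto simp: J_def\<close>)
  then have ms: "mset zs = mset ?bJ" unfolding js(1) mset_map by simp
  have "gram_det ?bJ (map b' (sorted_list_of_set I)) = (if I = J then 1 else 0)" if I: "I \<in> ?P" for I
  proof (cases "I = J")
    case True
    have "gram_det ?bJ (map b' (sorted_list_of_set J)) = 1"
    proof (rule gram_det_delta)
      fix i j assume ij: "i < length ?bJ" "j < length ?bJ"
      then have ij': "i < length (sorted_list_of_set J)" "j < length (sorted_list_of_set J)"
        by (simp_all del: length_sorted_list_of_set)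
      have "sorted_list_of_set J ! i < n" "sorted_list_of_set J ! j < n"
        using nth_mem[OF ij'(1)] nth_mem[OF ij'(2)] J fin[OF J] by auto
      moreover have "sorted_list_of_set J ! i = sorted_list_of_set J ! j \<longleftrightarrow> i = j"
        using ij' nth_eq_iff_index_eq[OF distinct_sorted_list_of_set] by blast
      ultimately show "B (?bJ ! i) (map b' (sorted_list_of_set J) ! j) = (if i = j then 1 else 0)"
        using b ij' by simp
    qed simp
    then show ?thesis using True by simp
  next
    case False
    have "\<not> I \<subseteq> J" using False I J card_subset_eq[OF fin[OF J], of I] by auto
    then obtain i where i: "i \<in> I" "i \<notin> J" by blast
    have "gram_det ?bJ (map b' (sorted_list_of_set I)) = 0"
    proof (rule gram_det_eq_0)
      show "length (map b' (sorted_list_of_set I)) = length ?bJ" using I J by simp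
      show "b' i \<in> set (map b' (sorted_list_of_set I))" using i(1) fin[OF I] by simp
      fix v assume "v \<in> set ?bJ"
      then obtain j where "j \<in> J" "v = b j" using fin[OF J] by auto
      moreover from this have "j < n" "i < n" "j \<noteq> i" using i I J by auto
      ultimately show "B v (b' i) = 0" using b[of j i] by simp
    qed
    then show ?thesis using False by simp
  qed
  then have "?rhs ?bJ = (\<Sum>I\<in>?P. if I = J then f ?bJ else 0)"
    by (intro sum.cong) auto
  also have "\<dots> = f ?bJ" using J finite_subset[of ?P "Pow {..<n}"] by (subst sum.delta) auto
  finally have "f ?bJ - ?rhs ?bJ = 0" by simp
  then have "f zs - ?rhs zs = 0"
    using alternating_eq_0_permute[OF alternating_diff[OF f rhs] ms] len[OF J] by simp
  then show "f zs = ?rhs zs" by simp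
qed

lemma iso_scale_form:
  assumes "alternating_multilinear scale (*) (Suc k) f" "subspace S" "iso S k f"
  shows "iso S k (\<lambda>us. c * f us)"
proof (rule isoI)
  fix us us' w
  assume *: "length us = k" "length us' = k" "set us \<subseteq> S" "set us' \<subseteq> S" "w \<in> S"
    "\<And>x. x \<in> S \<Longrightarrow> B w x = c * f (x # us)"
  show "c * f (w # us') = 0"
    using isoD_scaled[OF assms * ] by (cases "c = 0") auto
qed

lemma iso_cong:
  assumes "iso S k f" and eq: "\<And>us. length us = Suc k \<Longrightarrow> g us = f us"
  shows "iso S k g"
proof (rule isoI)
  fix us us' w
  assume *: "length us = k" "length us' = k" "set us \<subseteq> S" "set us' \<subseteq> S" "w \<in> S"
    "\<And>x. x \<in> S \<Longrightarrow> B w x = g (x # us)"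
  have "f (w # us') = 0"
    by (rule isoD[OF assms(1) *(1-5)]) (use * eq in simp)
  then show "g (w # us') = 0" using eq *(2) by simp
qed

text \<open>The representing vector is eliminated: its coefficient at \<open>b' j\<close> is
  \<open>f (b j # us)\<close>. What remains is quadratic in \<open>f\<close>, hence polynomial in an
  element of the exterior power.\<close>

lemma iso_UNIV_iff:
  assumes dual: "dual_bases n b b'"
    and f: "alternating_multilinear scale (*) (Suc k) f"
  shows "iso UNIV k f \<longleftrightarrow> (\<forall>us us'. length us = k \<longrightarrow> length us' = k \<longrightarrow>
    (\<Sum>j<n. f (b j # us) * f (b' j # us')) = 0)"
proof -
  have *: "f (w # us') = (\<Sum>j<n. f (b j # us) * f (b' j # us'))"
    if us: "length us = k" "length us' = k" and w: "\<And>x. B w x = f (x # us)" for us us' w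
  proof -
    interpret l: Vector_Spaces.linear scale "(*)" "\<lambda>x. f (x # us')" by (rule linear_head[OF f us(2)])
    have "w = (\<Sum>j<n. B w (b j) \<cdot> b' j)" using dual by (simp only: dual_bases_def)
    then have "f (w # us') = f ((\<Sum>j<n. B w (b j) \<cdot> b' j) # us')" by simp
    also have "\<dots> = (\<Sum>j<n. B w (b j) * f (b' j # us'))" unfolding l.sum l.scale ..
    finally show ?thesis using w by simp
  qed
  show ?thesis
  proof
    assume iso: "iso UNIV k f"
    show "\<forall>us us'. length us = k \<longrightarrow> length us' = k \<longrightarrow> (\<Sum>j<n. f (b j # us) * f (b' j # us')) = 0"
    proof (intro allI impI)
      fix us us' :: "'v list" assume us: "length us = k" "length us' = k"
      obtain w where w: "\<And>x. B w x = f (x # us)"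
        using riesz[OF nondeg_UNIV linear_head[OF f us(1)]] by auto
      have "f (w # us') = 0" by (rule isoD[OF iso us]) (use w in auto)
      then show "(\<Sum>j<n. f (b j # us) * f (b' j # us')) = 0" using *[OF us w] by simp
    qed
  next
    assume 0: "\<forall>us us'. length us = k \<longrightarrow> length us' = k \<longrightarrow> (\<Sum>j<n. f (b j # us) * f (b' j # us')) = 0"
    show "iso UNIV k f"
    proof (rule isoI)
      fix us us' :: "'v list" and w
      assume us: "length us = k" "length us' = k" and "\<And>x. x \<in> UNIV \<Longrightarrow> B w x = f (x # us)"
      then have "f (w # us') = (\<Sum>j<n. f (b j # us) * f (b' j # us'))" by (intro *) auto
      then show "f (w # us') = 0" using 0 us by metis
    qed
  qed
qed

end

lemma polynomial_on_sum:
  assumes "\<And>i. i \<in> I \<Longrightarrow> polynomial_on sE (f i)"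
  shows "polynomial_on sE (\<lambda>x. \<Sum>i\<in>I. f i x)"
  using assms
  by (induction I rule: infinite_finite_induct) (auto intro: polynomial_on.intros)

context quad_exterior
begin

text \<open>The coordinate expansion writes every functional on the exterior power as a combination
  of functionals \<open>\<lambda>x. hat x us\<close>, and functionals separate points.\<close>

lemma hat_inject:
  assumes "\<And>us. length us = k \<Longrightarrow> hat x us = hat y us"
  shows "x = y"
proof (rule ccontr)
  assume "x \<noteq> y"
  then have "x - y \<noteq> 0" by simp
  then obtain \<phi> where \<phi>: "Vector_Spaces.linear sE (*) \<phi>" "\<phi> (x - y) \<noteq> 0"
    using ex_linear_functional[OF ext.E.vector_space_axioms] by blast
  obtain n b b' where d: "dual_bases n b b'" using ex_dual_bases by blast
  let ?P = "{I. I \<subseteq> {..<n} \<and> card I = k}"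
  have len: "length (map b' (sorted_list_of_set I)) = k" if "I \<in> ?P" for I using that by simp
  have "\<phi> (x - y) = (\<Sum>I\<in>?P. \<phi> (wedge (map b (sorted_list_of_set I))) *
      hat (x - y) (map b' (sorted_list_of_set I)))"
  proof (rule functional_eqI[OF \<phi>(1)])
    show "Vector_Spaces.linear sE (*) (\<lambda>x. \<Sum>I\<in>?P. \<phi> (wedge (map b (sorted_list_of_set I))) *
      hat x (map b' (sorted_list_of_set I)))"
      by (intro linear_functional_sum[OF ext.E.vector_space_axioms] linear_functional_scale linear_hat len)
    fix vs :: "'v list" assume vs: "length vs = k"
    show "\<phi> (wedge vs) = (\<Sum>I\<in>?P. \<phi> (wedge (map b (sorted_list_of_set I))) *
      hat (wedge vs) (map b' (sorted_list_of_set I)))"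
      using alternating_expansion[OF d alternating_multilinear_compose[OF
            ext.alternating_multilinear_wedge \<phi>(1)] vs] hat_wedge[OF len vs] by simp
  qed
  also have "\<dots> = 0"
    by (rule sum.neutral) (use assms len hat_diff in auto)
  finally show False using \<phi>(2) by simp
qed

lemma hat_surj:
  assumes f: "alternating_multilinear scale (*) k f"
  shows "\<exists>x. \<forall>us. length us = k \<longrightarrow> hat x us = f us"
proof -
  obtain n b b' where d: "dual_bases n b b'" using ex_dual_bases by blast
  let ?P = "{I. I \<subseteq> {..<n} \<and> card I = k}"
  define x where "x = (\<Sum>I\<in>?P. sE (f (map b (sorted_list_of_set I))) (wedge (map b' (sorted_list_of_set I))))"
  have "hat x us = f us" if us: "length us = k" for us
  proof -
    have "hat x us = (\<Sum>I\<in>?P. f (map b (sorted_list_of_set I)) * gram_det us (map b' (sorted_list_of_set I)))"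
      unfolding x_def hat_sum[OF us]
    proof (rule sum.cong)
      fix I assume "I \<in> ?P"
      then have "length (map b' (sorted_list_of_set I)) = k" by simp
      then show "hat (sE (f (map b (sorted_list_of_set I))) (wedge (map b' (sorted_list_of_set I)))) us =
          f (map b (sorted_list_of_set I)) * gram_det us (map b' (sorted_list_of_set I))"
        using hat_scale[OF us] hat_wedge[OF us] gram_det_sym us by metis
    qed simp
    then show ?thesis using alternating_expansion[OF d f us] by simp
  qed
  then show ?thesis by blast
qed

definition cone :: "'e set" where
  "cone = {wedge vs | vs. length vs = k \<and> (\<forall>u\<in>set vs. \<forall>v\<in>set vs. B u v = 0)}"

text \<open>The first vector absorbs the scalar, hence \<open>k \<ge> 1\<close>.\<close>

lemma scale_cone:
  assumes "k \<ge> 1" "x \<in> cone"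
  shows "sE c x \<in> cone"
proof -
  obtain vs where vs: "x = wedge vs" "length vs = k" "\<forall>u\<in>set vs. \<forall>v\<in>set vs. B u v = 0"
    using assms(2) by (auto simp: cone_def)
  obtain v ws where v: "vs = v # ws" using vs(2) assms(1) by (cases vs) auto
  have "wedge ((c \<cdot> v) # ws) = sE c x"
    using alternating_scale[OF ext.alternating_multilinear_wedge, of "[]" ws c v] vs v by simp
  moreover have "\<forall>u\<in>set ((c \<cdot> v) # ws). \<forall>v\<in>set ((c \<cdot> v) # ws). B u v = 0"
    using vs(3) v by auto
  ultimately show ?thesis using vs(2) v unfolding cone_def
    by (intro CollectI exI[of _ "(c \<cdot> v) # ws"]) auto
qed

lemma iso_hat_cone:
  assumes k: "k = Suc j" and x: "x \<in> cone"
  shows "iso UNIV j (hat x)"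
proof -
  obtain vs where vs: "x = wedge vs" "length vs = k" "\<forall>u\<in>set vs. \<forall>v\<in>set vs. B u v = 0"
    using x by (auto simp: cone_def)
  have "hat x us = gram_det vs us" if "length us = k" for us
    using hat_wedge[OF that vs(2)] vs(1) by simp
  moreover have "iso UNIV j (gram_det vs)"
    by (rule iso_gram_det) (use vs k in auto)
  ultimately show ?thesis using iso_cong[of UNIV j "gram_det vs" "hat x"] k by blast
qed

lemma cone_if_iso_hat:
  assumes k: "k = Suc j" and d: "dim UNIV div 2 = k" and iso: "iso UNIV j (hat x)"
  shows "x \<in> cone"
proof (cases "\<exists>as. length as = k \<and> hat x as \<noteq> 0")
  case False
  then have "x = 0" using hat_zero by (intro hat_inject) auto
  moreover have "wedge (replicate k 0) = 0"
    by (rule alternating_zero[OF ext.alternating_multilinear_wedge]) (use k in auto)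
  ultimately show ?thesis unfolding cone_def by (intro CollectI exI[of _ "replicate k 0"]) auto
next
  case True
  then obtain as where as: "length as = k" "hat x as \<noteq> 0" by blast
  define c where "c = hat x as"
  define f where "f us = (1 / c) * hat x us" for us
  have alt: "alternating_multilinear scale (*) (Suc j) (hat x)" using alternating_hat k by simp
  have f: "alternating_multilinear scale (*) (Suc j) f"
    unfolding f_def[abs_def] by (rule alternating_scale_form[OF alt])
  have "iso UNIV j f" unfolding f_def[abs_def] by (rule iso_scale_form[OF alt subspace_UNIV iso])
  moreover have "f as = 1" using as by (simp add: f_def c_def)
  ultimately obtain vs where vs: "length vs = k" "\<forall>u\<in>set vs. \<forall>v\<in>set vs. B u v = 0"
    "\<forall>us. length us = k \<longrightarrow> f us = gram_det vs us"
    using iso_imp_gram_det[OF _ f] d as(1) unfolding k by blast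
  have "x = sE c (wedge vs)"
  proof (rule hat_inject)
    fix us :: "'v list" assume us: "length us = k"
    show "hat x us = hat (sE c (wedge vs)) us"
    proof -
      have "hat x us / c = gram_det vs us" using vs(3) us by (simp add: f_def)
      then have "hat x us = c * gram_det vs us" using as(2) by (simp add: c_def field_simps)
      then show ?thesis using hat_scale[OF us] hat_wedge[OF us vs(1)] by simp
    qed
  qed
  moreover have "wedge vs \<in> cone" using vs by (auto simp: cone_def)
  ultimately show ?thesis using scale_cone k by simp
qed

text \<open>The equations of \<open>iso_UNIV_iff\<close> are polynomials vanishing on the cone, and
  half-dimensionality makes them sufficient.\<close>

lemma cone_closed:
  assumes k: "k = Suc j" and d: "dim UNIV div 2 = k"
    and x: "\<And>F. polynomial_on sE F \<Longrightarrow> (\<forall>y\<in>cone. F y = 0) \<Longrightarrow> F x = 0"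
  shows "x \<in> cone"
proof (rule cone_if_iso_hat[OF k d])
  obtain n b b' where dual: "dual_bases n b b'" using ex_dual_bases by blast
  have alt: "alternating_multilinear scale (*) (Suc j) (hat x)" for x using alternating_hat k by simp
  note iff = iso_UNIV_iff[OF dual alt]
  show "iso UNIV j (hat x)"
    unfolding iff
  proof (intro allI impI)
    fix us us' :: "'v list" assume us: "length us = j" "length us' = j"
    show "(\<Sum>i<n. hat x (b i # us) * hat x (b' i # us')) = 0"
    proof (rule x)
      show "polynomial_on sE (\<lambda>x. \<Sum>i<n. hat x (b i # us) * hat x (b' i # us'))"
        by (intro polynomial_on_sum polynomial_on.mult polynomial_on.linear linear_hat)
          (use us k in auto)
      show "\<forall>y\<in>cone. (\<Sum>i<n. hat y (b i # us) * hat y (b' i # us')) = 0"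
        using iso_hat_cone[OF k] us unfolding iff by blast
    qed
  qed
qed

end

section \<open>Maps between two quadratic spaces\<close>

locale two_quad_exteriors =
  V: quad_exterior sV BasV BV sE p wedgeV + W: quad_exterior sW BasW BW sF q wedgeW
  for sV :: "'a::alg_closed_field \<Rightarrow> 'v::ab_group_add \<Rightarrow> 'v" and BasV BV
    and sE :: "'a \<Rightarrow> 'e::ab_group_add \<Rightarrow> 'e" and p wedgeV
    and sW :: "'a \<Rightarrow> 'w::ab_group_add \<Rightarrow> 'w" and BasW BW
    and sF :: "'a \<Rightarrow> 'f::ab_group_add \<Rightarrow> 'f" and q wedgeW

context quad_space
begin

text \<open>Maps \<open>e', g', h'\<close>, a hyperbolic basis of a space with form \<open>B'\<close>, to \<open>e, g, h\<close>.\<close>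

definition transfer ::
  "('w \<Rightarrow> 'w \<Rightarrow> 'a) \<Rightarrow> nat \<Rightarrow> (nat \<Rightarrow> 'w) \<Rightarrow> (nat \<Rightarrow> 'w) \<Rightarrow> 'w \<Rightarrow> (nat \<Rightarrow> 'v) \<Rightarrow> (nat \<Rightarrow> 'v) \<Rightarrow> 'v \<Rightarrow> 'w \<Rightarrow> 'v" where
  "transfer B' n e' g' h' e g h y =
     (\<Sum>i<n. B' y (g' i) \<cdot> e i + B' y (e' i) \<cdot> g i) + B' y h' \<cdot> h"

lemma B_transfer:
  assumes hyp: "hyperbolic n e g" and h: "\<And>i. i < n \<Longrightarrow> B (e i) h = 0 \<and> B (g i) h = 0"
  shows "i < n \<Longrightarrow> B (transfer B' n e' g' h' e g h y) (e i) = B' y (e' i)"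
    "i < n \<Longrightarrow> B (transfer B' n e' g' h' e g h y) (g i) = B' y (g' i)"
    "B (transfer B' n e' g' h' e g h y) h = B' y h' * B h h"
    "(\<And>j. j < n \<Longrightarrow> B (e j) x = 0 \<and> B (g j) x = 0) \<Longrightarrow> B h x = 0 \<Longrightarrow>
      B (transfer B' n e' g' h' e g h y) x = 0"
proof -
  note H = hyperbolicD[OF hyp]
  {
    assume i: "i < n"
    have hh: "B h (e i) = 0" "B h (g i) = 0" using h[OF i] B_sym[of h] by auto
    have "(\<Sum>j<n. B' y (g' j) * B (e j) (e i) + B' y (e' j) * B (g j) (e i)) =
        (\<Sum>j<n. if j = i then B' y (e' j) else 0)"
      by (rule sum.cong) (use H i in auto)
    then show "B (transfer B' n e' g' h' e g h y) (e i) = B' y (e' i)"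
      using i by (simp add: transfer_def B_sum hh)
    have "(\<Sum>j<n. B' y (g' j) * B (e j) (g i) + B' y (e' j) * B (g j) (g i)) =
        (\<Sum>j<n. if j = i then B' y (g' j) else 0)"
      by (rule sum.cong) (use H i in auto)
    then show "B (transfer B' n e' g' h' e g h y) (g i) = B' y (g' i)"
      using i by (simp add: transfer_def B_sum hh)
  }
  show "B (transfer B' n e' g' h' e g h y) h = B' y h' * B h h"
    using h by (simp add: transfer_def B_sum)
  show "B (transfer B' n e' g' h' e g h y) x = 0"
    if "\<And>j. j < n \<Longrightarrow> B (e j) x = 0 \<and> B (g j) x = 0" "B h x = 0"
    using that by (simp add: transfer_def B_sum)
qed

lemma transfer_in:
  assumes "subspace S" "e ` {..<n} \<subseteq> S" "g ` {..<n} \<subseteq> S" "h \<in> S"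
  shows "transfer B' n e' g' h' e g h y \<in> S"
  unfolding transfer_def using assms by (intro subspace_add subspace_sum subspace_scale) auto

lemma gram_det_append:
  assumes "length gs = length gs'" "length us = length vs"
    and "\<And>i j. i < length gs \<Longrightarrow> j < length gs \<Longrightarrow> B (gs ! i) (gs' ! j) = (if i = j then 1 else 0)"
    and "\<And>x y. x \<in> set gs \<Longrightarrow> y \<in> set us \<Longrightarrow> B x y = 0"
  shows "gram_det (gs @ vs) (gs' @ us) = gram_det vs us"
  using assms
proof (induction gs gs' rule: list_induct2)
  case (Cons x xs y ys)
  have 0: "B x z = 0" if z: "z \<in> set (ys @ us)" for z
  proof (cases "z \<in> set us")
    case True
    then show ?thesis using Cons.prems(3)[of x z] by simp
  next
    case False
    then obtain j where "j < length ys" "z = ys ! j" using z by (auto simp: in_set_conv_nth)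
    then show ?thesis using Cons.prems(2)[of 0 "Suc j"] Cons.hyps by simp
  qed
  have "gram_det ((x # xs) @ vs) ((y # ys) @ us) = B x y * gram_det (xs @ vs) (ys @ us)"
    using gram_det_Cons[of "ys @ us" "xs @ vs" x y] 0 Cons.hyps Cons.prems(1) by simp
  also have "B x y = 1" using Cons.prems(2)[of 0 0] by simp
  also have "gram_det (xs @ vs) (ys @ us) = gram_det vs us"
  proof (rule Cons.IH[OF Cons.prems(1)])
    show "B (xs ! i) (ys ! j) = (if i = j then 1 else 0)" if "i < length xs" "j < length xs" for i j
      using Cons.prems(2)[of "Suc i" "Suc j"] that by simp
  qed (use Cons.prems(3) in simp)
  finally show ?case by simp
qed simp

end

text \<open>The source is a full frame, the target may be part of a larger one: this serves both the
  isometry onto \<open>T\<close> and the embedding into a larger space.\<close>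

lemma transfer_isometry:
  assumes V: "quad_space sV BasV BV" and W: "quad_space sW BasW BW"
    and fr: "quad_space.frame sW BW S n e' g' h'"
    and hyp: "quad_space.hyperbolic BV n e g"
    and h: "\<And>i. i < n \<Longrightarrow> BV (e i) h = 0 \<and> BV (g i) h = 0" "BV h h = BW h' h'"
    and S: "y \<in> S" "z \<in> S"
  shows "BV (quad_space.transfer sV BW n e' g' h' e g h y) (quad_space.transfer sV BW n e' g' h' e g h z)
    = BW y z"
proof -
  interpret V: quad_space sV BasV BV by fact
  interpret W: quad_space sW BasW BW by fact
  let ?t = "V.transfer BW n e' g' h' e g h"
  \<comment> \<open>Either \<open>BW h' h' = 1\<close> or \<open>h' = 0\<close>.\<close>
  have hh: "BW z h' * BW h' h' = BW z h'" for z
    using W.frameD(10,11)[OF fr] by (cases "odd (W.dim S)") auto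
  have "BV (?t y) (?t z) = (\<Sum>i<n. BW z (g' i) * BV (?t y) (e i) + BW z (e' i) * BV (?t y) (g i))
      + BW z h' * BV (?t y) h"
    by (subst (2) V.transfer_def) (simp add: V.B_sum')
  also have "\<dots> = (\<Sum>i<n. BW z (g' i) * BW y (e' i) + BW z (e' i) * BW y (g' i)) + BW z h' * BW y h'"
    using V.B_transfer(1,2)[OF hyp h(1), where B' = BW] V.B_transfer(3)[OF hyp h(1), where B' = BW]
      hh[of y] h(2) by (intro arg_cong2[of _ _ _ _ "(+)"] sum.cong) simp_all
  also have "\<dots> = BW y (W.hproj n e' g' z + sW (BW z h') h')"
    by (simp add: W.hproj_def W.B_sum')
  also have "\<dots> = BW y z" using W.frameD(12)[OF fr S(2)] by simp
  finally show ?thesis .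
qed

lemma linear_transfer:
  assumes V: "quad_space sV BasV BV" and W: "quad_space sW BasW BW"
  shows "Vector_Spaces.linear sW sV (quad_space.transfer sV BW n e' g' h' e g h)"
proof -
  interpret V: quad_space sV BasV BV by fact
  interpret W: quad_space sW BasW BW by fact
  show ?thesis
  proof unfold_locales
    fix x y c
    show "V.transfer BW n e' g' h' e g h (x + y) = V.transfer BW n e' g' h' e g h x + V.transfer BW n e' g' h' e g h y"
      by (simp add: V.transfer_def V.scale_left_distrib sum.distrib algebra_simps)
    show "V.transfer BW n e' g' h' e g h (sW c x) = sV c (V.transfer BW n e' g' h' e g h x)"
      by (simp add: V.transfer_def V.scale_right_distrib V.scale_sum_right)
  qed
qed

context two_quad_exteriors
begin

text \<open>The map contracts with \<open>gs\<close> and pulls back along an isometry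
  \<open>t\<close> onto \<open>T\<close>. For isotropic \<open>vs\<close> its representing vectors
  are the \<open>T\<close> components of vectors in \<open>span (set vs)\<close> orthogonal to
  \<open>gs\<close>; the discarded components lie in the span of \<open>gs\<close> and do not change
  products.\<close>

lemma igcp_contraction:
  assumes q: "q = Suc j" "W.dim UNIV div 2 = q" and p: "p = r + q"
    and T: "V.nondeg T" "V.dim T = W.dim UNIV"
    and gs: "length gs = r" "\<And>u v. u \<in> set gs \<Longrightarrow> v \<in> set gs \<Longrightarrow> BV u v = 0"
      "\<And>u x. u \<in> set gs \<Longrightarrow> x \<in> T \<Longrightarrow> BV u x = 0"
      "\<And>x. (\<And>y. y \<in> T \<Longrightarrow> BV x y = 0) \<Longrightarrow> (\<And>u. u \<in> set gs \<Longrightarrow> BV x u = 0) \<Longrightarrow> x \<in> V.span (set gs)"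
    and \<omega>: "\<And>\<Phi>. Vector_Spaces.linear sE sF \<Phi> \<Longrightarrow> \<Phi> ` V.cone \<subseteq> W.cone \<Longrightarrow> \<Phi> \<omega> \<in> W.cone"
  shows "V.iso T j (\<lambda>us. V.hat \<omega> (gs @ us))"
proof -
  have qV: "quad_space sV BasV BV" and qW: "quad_space sW BasW BW" by unfold_locales
  obtain eT gT hT where frT: "V.frame T q eT gT hT" using V.ex_frame[OF T(1)] q(2) T(2) by auto
  obtain eW gW hW where frW: "W.frame UNIV q eW gW hW" using W.ex_frame[OF W.nondeg_UNIV] q(2) by auto
  have hh: "BV hT hT = BW hW hW"
    using V.frameD(10,11)[OF frT] W.frameD(10,11)[OF frW] T(2) by (cases "odd (V.dim T)") auto
  define t where "t = V.transfer BW q eW gW hW eT gT hT"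
  define s where "s = W.transfer BV q eT gT hT eW gW hW"
  have t_lin: "Vector_Spaces.linear sW sV t" unfolding t_def by (rule linear_transfer[OF qV qW])
  have t_T: "t y \<in> T" for y
    unfolding t_def using V.frameD[OF frT] V.nondeg_subspace[OF T(1)] by (intro V.transfer_in) auto
  have t_iso: "BV (t y) (t z) = BW y z" for y z
    unfolding t_def
    by (rule transfer_isometry[OF qV qW frW V.frameD(1)[OF frT]]) (use V.frameD[OF frT] hh in auto)
  \<comment> \<open>\<open>s\<close> is built with source and target exchanged and inverts
    \<open>t\<close> on \<open>T\<close>.\<close>
  have ts: "t (s x) = x" if "x \<in> T" for x
  proof -
    have hW: "BW (eW i) hW = 0 \<and> BW (gW i) hW = 0" if "i < q" for i using W.frameD[OF frW] that by auto
    have "BV x hT * BW hW hW = BV x hT" using V.frameD(10,11)[OF frT] hh by (cases "odd (V.dim T)") auto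
    moreover have "BW (s x) (gW i) = BV x (gT i)" "BW (s x) (eW i) = BV x (eT i)" if "i < q" for i
      unfolding s_def by (rule W.B_transfer(1,2)[OF W.frameD(1)[OF frW] hW that]; assumption)+
    moreover have "BW (s x) hW = BV x hT * BW hW hW"
      unfolding s_def by (rule W.B_transfer(3)[OF W.frameD(1)[OF frW] hW])
    ultimately have "t (s x) = V.hproj q eT gT x + sV (BV x hT) hT"
      unfolding t_def V.transfer_def V.hproj_def by simp
    then show ?thesis using V.frameD(12)[OF frT that] by simp
  qed
  define \<eta> where "\<eta> vs us = V.gram_det vs (gs @ map t us)" for vs us
  have alt_app: "alternating_multilinear sW (*) q (\<lambda>us. f (gs @ map t us))"
    if "alternating_multilinear sV (*) p f" for f :: "'v list \<Rightarrow> 'a"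
    using alternating_map[OF alternating_append[of sV "(*)" gs q f] t_lin] that gs(1) p by simp
  have len: "length (gs @ map t us) = p" if "length us = q" for us using that gs(1) p by simp
  have \<eta>_alt: "alternating_multilinear sW (*) q (\<eta> vs)" if "length vs = p" for vs
    using alt_app[of "V.gram_det vs"] V.alternating_gram_det[of vs] that by (simp add: \<eta>_def[abs_def])
  \<comment> \<open>\<open>hat\<close> identifies the exterior power of \<open>W\<close> with all
    alternating forms, so \<open>\<theta>\<close> may be prescribed by its form.\<close>
  have "\<exists>y. \<forall>us. length us = q \<longrightarrow> W.hat y us = \<eta> vs us" if "length vs = p" for vs
    by (rule W.hat_surj[OF \<eta>_alt[OF that]])
  then obtain \<theta> where \<theta>: "W.hat (\<theta> vs) us = \<eta> vs us" if "length vs = p" "length us = q" for vs us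
    by metis
  have "alternating_multilinear sV sF p \<theta>"
  proof (rule alternating_multilinearI)
    fix xs ys :: "'v list" assume l: "Suc (length xs + length ys) = p"
    then have l': "length (xs @ a # ys) = p" for a by simp
    have lin: "Vector_Spaces.linear sV (*) (\<lambda>a. \<eta> (xs @ a # ys) us)" if "length us = q" for us
      unfolding \<eta>_def
      by (rule alternating_linear_append[OF V.alternating_gram_det_left]) (use l len[OF that] in simp)
    show "Vector_Spaces.linear sV sF (\<lambda>a. \<theta> (xs @ a # ys))"
    proof unfold_locales
      fix a b c
      show "\<theta> (xs @ (a + b) # ys) = \<theta> (xs @ a # ys) + \<theta> (xs @ b # ys)"
      proof (rule W.hat_inject)
        fix us :: "'w list" assume us: "length us = q"
        interpret l: Vector_Spaces.linear sV "(*)" "\<lambda>a. \<eta> (xs @ a # ys) us" by (rule lin[OF us])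
        show "W.hat (\<theta> (xs @ (a + b) # ys)) us = W.hat (\<theta> (xs @ a # ys) + \<theta> (xs @ b # ys)) us"
          unfolding W.hat_add[OF us] \<theta>[OF l' us] by (rule l.add)
      qed
      show "\<theta> (xs @ sV c a # ys) = sF c (\<theta> (xs @ a # ys))"
      proof (rule W.hat_inject)
        fix us :: "'w list" assume us: "length us = q"
        interpret l: Vector_Spaces.linear sV "(*)" "\<lambda>a. \<eta> (xs @ a # ys) us" by (rule lin[OF us])
        show "W.hat (\<theta> (xs @ sV c a # ys)) us = W.hat (sF c (\<theta> (xs @ a # ys))) us"
          unfolding W.hat_scale[OF us] \<theta>[OF l' us] by (rule l.scale)
      qed
    qed
  next
    fix vs :: "'v list" and i j
    assume vs: "length vs = p" "i < j" "j < p" "vs ! i = vs ! j"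
    then have nd: "\<not> distinct vs" by (metis distinct_conv_nth less_irrefl less_trans)
    show "\<theta> vs = 0"
    proof (rule W.hat_inject)
      fix us :: "'w list" assume us: "length us = q"
      have "\<eta> vs us = 0"
        unfolding \<eta>_def
        by (rule alternating_not_distinct[OF V.alternating_gram_det_left _ nd]) (use vs(1) len[OF us] in simp)
      then show "W.hat (\<theta> vs) us = W.hat 0 us" using \<theta>[OF vs(1) us] W.hat_zero[OF us] by simp
    qed
  qed
  from V.ext.universal_property[OF W.ext.E.vector_space_axioms this]
  obtain \<Phi> where \<Phi>: "Vector_Spaces.linear sE sF \<Phi>" "\<And>vs. length vs = p \<Longrightarrow> \<Phi> (wedgeV vs) = \<theta> vs"
    by blast
  have hat_\<Phi>: "W.hat (\<Phi> x) us = V.hat x (gs @ map t us)" if us: "length us = q" for x us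
  proof (rule V.functional_eqI[of "\<lambda>x. W.hat (\<Phi> x) us" "\<lambda>x. V.hat x (gs @ map t us)"])
    show "Vector_Spaces.linear sE (*) (\<lambda>x. W.hat (\<Phi> x) us)"
      using Vector_Spaces.linear_compose[OF \<Phi>(1) W.linear_hat[OF us]] by (simp add: o_def)
    show "Vector_Spaces.linear sE (*) (\<lambda>x. V.hat x (gs @ map t us))" by (rule V.linear_hat[OF len[OF us]])
    show "W.hat (\<Phi> (wedgeV vs)) us = V.hat (wedgeV vs) (gs @ map t us)" if "length vs = p" for vs
      using \<Phi>(2)[OF that] \<theta>[OF that us] V.hat_wedge[OF len[OF us] that] by (simp add: \<eta>_def)
  qed
  have "\<Phi> x \<in> W.cone" if x: "x \<in> V.cone" for x
  proof (rule W.cone_if_iso_hat[OF q])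
    obtain vs where vs: "x = wedgeV vs" "length vs = p" "\<And>u v. u \<in> set vs \<Longrightarrow> v \<in> set vs \<Longrightarrow> BV u v = 0"
      using x by (auto simp: V.cone_def)
    have hat_x: "W.hat (\<Phi> x) us = V.gram_det vs (gs @ map t us)" if "length us = q" for us
      using hat_\<Phi>[OF that] V.hat_wedge[OF len[OF that] vs(2)] vs(1) by simp
    have rep: "\<exists>v\<in>V.span (set vs). (\<forall>z. V.gram_det vs (gs @ z # map t us) = BV v z) \<and> (\<forall>u\<in>set gs. BV v u = 0)"
      if us: "length us = j" for us
    proof -
      have l: "Suc (length gs + length (map t us)) = length vs" using us gs(1) p q vs(2) by simp
      obtain v where v: "v \<in> V.span (set vs)" "\<forall>z. V.gram_det vs (gs @ z # map t us) = BV v z"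
        using V.gram_det_expand[OF l] by blast
      have "BV v u = 0" if "u \<in> set gs" for u
      proof -
        have "V.gram_det vs (gs @ u # map t us) = 0"
          by (rule alternating_not_distinct[OF V.alternating_gram_det]) (use l that in auto)
        then show ?thesis using v(2) by simp
      qed
      then show ?thesis using v by blast
    qed
    show "W.iso UNIV j (W.hat (\<Phi> x))"
    proof (rule W.isoI)
      fix us us' :: "'w list" and w
      assume us: "length us = j" "length us' = j" and w: "\<And>y. y \<in> UNIV \<Longrightarrow> BW w y = W.hat (\<Phi> x) (y # us)"
      obtain v where v: "v \<in> V.span (set vs)" "\<And>z. V.gram_det vs (gs @ z # map t us) = BV v z"
        "\<And>u. u \<in> set gs \<Longrightarrow> BV v u = 0" using rep[OF us(1)] by blast
      obtain v' where v': "v' \<in> V.span (set vs)" "\<And>z. V.gram_det vs (gs @ z # map t us') = BV v' z"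
        "\<And>u. u \<in> set gs \<Longrightarrow> BV v' u = 0" using rep[OF us(2)] by blast
      have "BV u v = 0" if "u \<in> set vs" for u by (rule V.B_eq_0_span[OF _ v(1)]) (use vs(3) that in blast)
      then have v'v: "BV v v' = 0" by (intro V.B_eq_0_span[OF _ v'(1)]) (simp add: V.B_sym)
      \<comment> \<open>\<open>t w\<close> is the \<open>T\<close> component of \<open>v\<close>.
        The difference is orthogonal to \<open>v'\<close>, so \<open>BV v' (t w)\<close> equals
        \<open>BV v' v\<close>, which is 0.\<close>
      have "v - t w \<in> V.span (set gs)"
      proof (rule gs(4))
        fix z assume z: "z \<in> T"
        have "BV v z = BW w (s z)"
          using w[of "s z"] hat_x[of "s z # us"] v(2)[of z] us(1) q(1) ts[OF z] by simp
        also have "\<dots> = BV (t w) z" using t_iso[of w "s z"] ts[OF z] by simp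
        finally show "BV (v - t w) z = 0" by simp
      next
        fix u assume u: "u \<in> set gs"
        then have "BV (t w) u = 0" using gs(3)[OF u t_T] V.B_sym by metis
        then show "BV (v - t w) u = 0" using v(3)[OF u] by simp
      qed
      then have "BV v' (v - t w) = 0" by (rule V.B_eq_0_span[rotated]) (rule v'(3))
      then have "BV v' (t w) = 0" using v'v by (simp add: V.B_sym)
      then show "W.hat (\<Phi> x) (w # us') = 0" using hat_x[of "w # us'"] v'(2)[of "t w"] us q(1) by simp
    qed
  qed
  then have "W.iso UNIV j (W.hat (\<Phi> \<omega>))"
    using W.iso_hat_cone[OF q(1)] \<omega>[OF \<Phi>(1)] by blast
  then have iso: "W.iso UNIV j (\<lambda>us. V.hat \<omega> (gs @ map t us))"
    using W.iso_cong hat_\<Phi> q(1) by (metis (no_types, lifting))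
  have map_ts: "map t (map s us) = us" if "set us \<subseteq> T" for us
    using that ts by (induction us) auto
  show ?thesis
  proof (rule V.isoI)
    fix us us' w
    assume us: "length us = j" "length us' = j" "set us \<subseteq> T" "set us' \<subseteq> T" "w \<in> T"
      and w: "\<And>x. x \<in> T \<Longrightarrow> BV w x = V.hat \<omega> (gs @ x # us)"
    have "V.hat \<omega> (gs @ map t (s w # map s us')) = 0"
    proof (rule W.isoD[OF iso, of "map s us"])
      fix y :: 'w
      have "BW (s w) y = BV w (t y)" using t_iso[of "s w" y] ts[OF us(5)] by simp
      then show "BW (s w) y = V.hat \<omega> (gs @ map t (y # map s us))"
        using w[OF t_T[of y]] map_ts[OF us(3)] by simp
    qed (use us in auto)
    then show "V.hat \<omega> (gs @ w # us') = 0" using map_ts[OF us(4)] ts[OF us(5)] by simp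
  qed
qed

text \<open>The map embeds \<open>V\<close> isometrically and wedges with the isotropic vectors
  \<open>eW l\<close> for \<open>p \<le> l\<close>, which are orthogonal to the image. Pairing with
  the dual vectors \<open>gW l\<close> recovers the form of the original element, and so the
  isotropy of its support.\<close>

lemma igcp_extension:
  assumes p: "p = Suc i" "V.dim UNIV div 2 = p" and q: "q = Suc j" "W.dim UNIV div 2 = q" and pq: "p \<le> q"
    and par: "odd (V.dim UNIV) \<longleftrightarrow> odd (W.dim UNIV)"
    and \<omega>: "\<And>\<Phi>. Vector_Spaces.linear sE sF \<Phi> \<Longrightarrow> \<Phi> ` V.cone \<subseteq> W.cone \<Longrightarrow> \<Phi> \<omega> \<in> W.cone"
  shows "V.iso UNIV i (V.hat \<omega>)"
proof -
  have qV: "quad_space sV BasV BV" and qW: "quad_space sW BasW BW" by unfold_locales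
  obtain e g h where fr: "V.frame UNIV p e g h" using V.ex_frame[OF V.nondeg_UNIV] p(2) by auto
  obtain eW gW hW where frW: "W.frame UNIV q eW gW hW" using W.ex_frame[OF W.nondeg_UNIV] q(2) by auto
  note hyp = V.hyperbolicD[OF V.frameD(1)[OF fr]] V.frameD(5-8)[OF fr]
  note hypW = W.hyperbolicD[OF W.frameD(1)[OF frW]] W.frameD(5-8)[OF frW]
  have hh: "BW hW hW = BV h h"
    using V.frameD(10,11)[OF fr] W.frameD(10,11)[OF frW] par by (cases "odd (V.dim UNIV)") auto
  have hypp: "W.hyperbolic p eW gW"
    using W.frameD(1)[OF frW] pq by (auto simp: W.hyperbolic_def)
  have hWp: "BW (eW i) hW = 0 \<and> BW (gW i) hW = 0" if "i < p" for i using hypW that pq by simp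
  define t where "t = W.transfer BV p e g h eW gW hW"
  have t_lin: "Vector_Spaces.linear sV sW t" unfolding t_def by (rule linear_transfer[OF qW qV])
  have t_iso: "BW (t y) (t z) = BV y z" for y z
    unfolding t_def by (rule transfer_isometry[OF qW qV fr hypp hWp hh]) auto
  have t_perp: "BW (t y) (eW l) = 0" "BW (t y) (gW l) = 0" if "p \<le> l" "l < q" for y l
    unfolding t_def using that hypW by (intro W.B_transfer(4)[OF hypp hWp]; simp)+
  define r where "r = q - p"
  define gs where "gs = map eW [p..<q]"
  define gs' where "gs' = map gW [p..<q]"
  have len: "length gs = r" "length gs' = r" "r + p = q" using pq by (simp_all add: gs_def gs'_def r_def)
  have in_gs: "\<exists>l. p \<le> l \<and> l < q \<and> x = eW l" if "x \<in> set gs" for x using that by (auto simp: gs_def)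
  have in_gs': "\<exists>l. p \<le> l \<and> l < q \<and> x = gW l" if "x \<in> set gs'" for x using that by (auto simp: gs'_def)
  have gs_t: "BW x (t y) = 0" if "x \<in> set gs" for x y
    using in_gs[OF that] t_perp(1) W.B_sym by metis
  have gs_gs: "BW x y = 0" if "x \<in> set gs" "y \<in> set gs" for x y
    using in_gs[OF that(1)] in_gs[OF that(2)] hypW(1) by auto
  define \<theta> where "\<theta> vs = wedgeW (gs @ map t vs)" for vs
  have "alternating_multilinear sV sF p \<theta>"
    unfolding \<theta>_def[abs_def]
    by (intro alternating_map[OF alternating_append t_lin])
      (use W.ext.alternating_multilinear_wedge len in simp)
  from V.ext.universal_property[OF W.ext.E.vector_space_axioms this]
  obtain \<Phi> where \<Phi>: "Vector_Spaces.linear sE sF \<Phi>" "\<And>vs. length vs = p \<Longrightarrow> \<Phi> (wedgeV vs) = \<theta> vs"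
    by blast
  have lin_\<Phi>: "Vector_Spaces.linear sE (*) (\<lambda>x. W.hat (\<Phi> x) us)" if "length us = q" for us
    using Vector_Spaces.linear_compose[OF \<Phi>(1) W.linear_hat[OF that]] by (simp add: o_def)
  have hat_\<Phi>: "W.hat (\<Phi> x) (gs' @ map t us) = V.hat x us" if us: "length us = p" for x us
  proof (rule V.functional_eqI[of "\<lambda>x. W.hat (\<Phi> x) (gs' @ map t us)" "\<lambda>x. V.hat x us"])
    have l: "length (gs' @ map t us) = q" using us len by simp
    show "Vector_Spaces.linear sE (*) (\<lambda>x. W.hat (\<Phi> x) (gs' @ map t us))" by (rule lin_\<Phi>[OF l])
    show "Vector_Spaces.linear sE (*) (\<lambda>x. V.hat x us)" by (rule V.linear_hat[OF us])
    fix vs :: "'v list" assume vs: "length vs = p"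
    have "W.hat (\<Phi> (wedgeV vs)) (gs' @ map t us) = W.gram_det (gs @ map t vs) (gs' @ map t us)"
      using \<Phi>(2)[OF vs] W.hat_wedge[OF l] vs len by (simp add: \<theta>_def)
    also have "\<dots> = W.gram_det (map t vs) (map t us)"
    proof (rule W.gram_det_append)
      show "BW (gs ! a) (gs' ! b) = (if a = b then 1 else 0)" if "a < length gs" "b < length gs" for a b
        using that hypW(3)[of "p + a" "p + b"] len by (simp add: gs_def gs'_def r_def)
      show "BW x y = 0" if "x \<in> set gs" "y \<in> set (map t us)" for x y using gs_t[OF that(1)] that(2) by auto
    qed (use len us vs in auto)
    also have "\<dots> = V.gram_det vs us"
      unfolding W.gram_det_def V.gram_det_def using us vs t_iso
      by (auto intro!: arg_cong[of _ _ det] eq_matI)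
    finally show "W.hat (\<Phi> (wedgeV vs)) (gs' @ map t us) = V.hat (wedgeV vs) us"
      using V.hat_wedge[OF us vs] by simp
  qed
  have "\<Phi> x \<in> W.cone" if "x \<in> V.cone" for x
  proof -
    obtain vs where vs: "x = wedgeV vs" "length vs = p" "\<forall>u\<in>set vs. \<forall>v\<in>set vs. BV u v = 0"
      using \<open>x \<in> V.cone\<close> by (auto simp: V.cone_def)
    have "\<forall>u\<in>set (gs @ map t vs). \<forall>v\<in>set (gs @ map t vs). BW u v = 0"
      using vs(3) t_iso gs_t gs_gs W.B_sym by auto
    then show ?thesis unfolding W.cone_def using vs \<Phi>(2)[OF vs(2)] len
      by (intro CollectI exI[of _ "gs @ map t vs"]) (simp add: \<theta>_def)
  qed
  then have iso: "W.iso UNIV j (W.hat (\<Phi> \<omega>))"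
    using W.iso_hat_cone[OF q(1)] \<omega>[OF \<Phi>(1)] by blast
  have altW: "alternating_multilinear sW (*) (Suc j) (W.hat (\<Phi> x))" for x
    using W.alternating_hat q(1) by simp
  have move: "V.hat \<omega> (x # us) = (-1) ^ r * W.hat (\<Phi> \<omega>) (t x # gs' @ map t us)" if "length us = i" for x us
    using hat_\<Phi>[of "x # us" \<omega>] alternating_move_front[OF altW[of \<omega>], of gs' "map t us" "t x"] that p(1) q(1) len
    by simp
  show ?thesis
  proof (rule V.isoI)
    fix us us' :: "'v list" and w
    assume us: "length us = i" "length us' = i" and w: "\<And>x. x \<in> UNIV \<Longrightarrow> BV w x = V.hat \<omega> (x # us)"
    let ?L = "gs' @ map t us"
    have lL: "length ?L = j" "length (gs' @ map t us') = j" using us len p(1) q(1) by auto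
    \<comment> \<open>By construction this holds on the image of \<open>t\<close>; the claim is that
      \<open>t w\<close> represents the form on all of \<open>W\<close>, which is checked on the
      remaining frame vectors, where both sides vanish.\<close>
    have eq: "BW (t w) z = (-1) ^ r * W.hat (\<Phi> \<omega>) (z # ?L)" for z
    proof -
      interpret WK: vector_space_pair sW "(*) :: 'a \<Rightarrow> 'a \<Rightarrow> 'a"
        by (intro vector_space_pair.intro W.vector_space_axioms vector_space_over_itself.vector_space_axioms)
      show ?thesis
      proof (rule WK.linear_eq_on[OF W.linear_B' linear_functional_scale[OF W.linear_head[OF altW lL(1)]]
            W.frame_span[OF frW UNIV_I]])
        have t_case: "BW (t w) (t x) = (-1) ^ r * W.hat (\<Phi> \<omega>) (t x # ?L)" for x
          using t_iso[of w x] w[of x] move[OF us(1), of x] by simp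
        have t_e: "t (e l) = eW l" "t (g l) = gW l" if "l < p" for l
        proof -
          have "(\<Sum>a<p. sW (BV (e l) (g a)) (eW a) + sW (BV (e l) (e a)) (gW a)) =
              (\<Sum>a<p. if a = l then eW a else 0)"
            by (rule sum.cong) (use hyp that in auto)
          then show "t (e l) = eW l" using that hyp by (simp add: t_def W.transfer_def)
          have "(\<Sum>a<p. sW (BV (g l) (g a)) (eW a) + sW (BV (g l) (e a)) (gW a)) =
              (\<Sum>a<p. if a = l then gW a else 0)"
            by (rule sum.cong) (use hyp that in auto)
          then show "t (g l) = gW l" using that hyp by (simp add: t_def W.transfer_def)
        qed
        have t_h: "t h = hW"
          using V.frameD(10,11)[OF fr] W.frameD(11)[OF frW] par hyp
          unfolding t_def W.transfer_def by (cases "odd (V.dim UNIV)") auto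
        fix z assume "z \<in> eW ` {..<q} \<union> gW ` {..<q} \<union> {hW}"
        then consider (t) x where "z = t x" | (e) l where "p \<le> l" "l < q" "z = eW l"
          | (g) l where "p \<le> l" "l < q" "z = gW l"
          using t_e t_h by (metis (no_types, lifting) Un_iff imageE lessThan_iff not_le singletonD)
        then show "BW (t w) z = (-1) ^ r * W.hat (\<Phi> \<omega>) (z # ?L)"
        proof cases
          case t
          then show ?thesis using t_case by simp
        next
          case g
          then have "z \<in> set gs'" by (simp add: gs'_def)
          then have "W.hat (\<Phi> \<omega>) (z # ?L) = 0"
            by (intro alternating_not_distinct[OF altW]) (use lL in auto)
          then show ?thesis using t_perp(2)[OF g(1,2)] g(3) by simp
        next
          case e
          have l: "length (z # ?L) = q" using lL q(1) by simp
          have "W.hat (\<Phi> \<omega>) (z # ?L) = 0 * W.hat (\<Phi> \<omega>) (z # ?L)"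
          proof (rule V.functional_eqI[of "\<lambda>x. W.hat (\<Phi> x) (z # ?L)" "\<lambda>x. 0 * W.hat (\<Phi> x) (z # ?L)"])
            fix vs :: "'v list" assume vs: "length vs = p"
            \<comment> \<open>\<open>eW l\<close> is orthogonal to \<open>gs\<close> and to the
              image of \<open>t\<close>, so the determinant has a zero column.\<close>
            have "W.gram_det (gs @ map t vs) (z # ?L) = 0"
            proof (rule W.gram_det_eq_0[of _ _ z])
              show "length (z # ?L) = length (gs @ map t vs)" using l vs len by simp
              fix v assume "v \<in> set (gs @ map t vs)"
              then show "BW v z = 0" using in_gs hypW(1) e t_perp(1)[OF e(1,2)] by auto
            qed simp
            then show "W.hat (\<Phi> (wedgeV vs)) (z # ?L) = 0 * W.hat (\<Phi> (wedgeV vs)) (z # ?L)"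
              using \<Phi>(2)[OF vs] W.hat_wedge[OF l, of "gs @ map t vs"] vs len by (simp add: \<theta>_def)
          qed (intro linear_functional_scale lin_\<Phi>[OF l])+
          then show ?thesis using t_perp(1)[OF e(1,2)] e(3) by simp
        qed
      qed
    qed
    have "W.hat (\<Phi> \<omega>) (t w # gs' @ map t us') = 0"
      by (rule W.isoD_scaled[OF altW W.subspace_UNIV iso lL _ _ UNIV_I eq]) auto
    then show "V.hat \<omega> (w # us') = 0" using move[OF us(2), of w] by simp
  qed
qed

end

lemma quad_space_assoc_form:
  fixes s :: "'a::alg_closed_field \<Rightarrow> 'v::ab_group_add \<Rightarrow> 'v"
  assumes "CHAR('a) \<noteq> 2" "finite_dimensional_vector_space s Bas" "nondegenerate_quadratic_form s Q"
  shows "quad_space s Bas (assoc_form Q)"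
proof -
  interpret finite_dimensional_vector_space s Bas by fact
  have lin: "Vector_Spaces.linear s (*) (assoc_form Q u)" for u
    using assms(3) by (simp add: nondegenerate_quadratic_form_def quadratic_form_def)
  have sym: "assoc_form Q u v = assoc_form Q v u" for u v
    by (simp add: assoc_form_def algebra_simps)
  show ?thesis
  proof unfold_locales
    fix x y z c
    interpret l: Vector_Spaces.linear s "(*)" "assoc_form Q z" by (rule lin)
    show "assoc_form Q x y = assoc_form Q y x" by (rule sym)
    show "assoc_form Q (x + y) z = assoc_form Q x z + assoc_form Q y z"
      unfolding sym[of _ z] by (rule l.add)
    show "assoc_form Q (s c x) z = c * assoc_form Q x z"
      unfolding sym[of _ z] by (rule l.scale)
  next
    fix x assume "\<And>y. assoc_form Q x y = 0"
    then show "x = 0" using assms(3) by (simp add: nondegenerate_quadratic_form_def)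
  next
    have "\<not> CHAR('a) dvd 2"
      using assms(1) CHAR_not_1[where 'a = 'a] prime_nat_iff[of 2] two_is_prime_nat by auto
    then show "(2 :: 'a) \<noteq> 0" using of_nat_eq_0_iff_char_dvd[where 'a = 'a, of 2] by simp
  qed
qed

theorem theorem1p1:
  fixes sV :: "'a::alg_closed_field \<Rightarrow> 'v::ab_group_add \<Rightarrow> 'v"
    and BV :: "'v set"
    and QV :: "'v \<Rightarrow> 'a"
    and sE :: "'a \<Rightarrow> 'e::ab_group_add \<Rightarrow> 'e"
    and wedgeV :: "'v list \<Rightarrow> 'e"
    and QW :: "'a ^ 'm::finite \<Rightarrow> 'a"
    and sF :: "'a \<Rightarrow> 'f::ab_group_add \<Rightarrow> 'f"
    and wedgeW :: "('a ^ 'm) list \<Rightarrow> 'f"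
    and p q :: nat
    and \<omega> :: 'e
  assumes "CHAR('a) \<noteq> 2"
    and "finite_dimensional_vector_space sV BV"
    and "nondegenerate_quadratic_form sV QV"
    and "p = vector_space.dim sV (UNIV :: 'v set) div 2"
    and "(q, CARD('m)) = (if odd (vector_space.dim sV (UNIV :: 'v set)) then (3, 7) else (4, 8))"
    and "nondegenerate_quadratic_form (*s) QW"
    and "exterior_power sV sE p wedgeV"
    and "exterior_power (*s) sF q wedgeW"
    and "\<omega> \<noteq> 0"
  shows "proj_point sE \<omega> \<in> iso_grassmannian sE QV p wedgeV \<longleftrightarrow>
    (\<forall>\<Phi> F. igcp sE QV p wedgeV sF QW q wedgeW \<Phi> \<longrightarrow>
       polynomial_on sF F \<longrightarrow> (\<forall>x\<in>iso_grassmann_cone QW q wedgeW. F x = 0) \<longrightarrow>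
       F (\<Phi> \<omega>) = 0)"
proof -
  interpret two_quad_exteriors sV BV "assoc_form QV" sE p wedgeV "(*s)" cart_basis "assoc_form QW" sF q wedgeW
    by (intro two_quad_exteriors.intro quad_exterior.intro quad_space_assoc_form
        vec.finite_dimensional_vector_space_axioms assms)
  have coneV: "iso_grassmann_cone QV p wedgeV = V.cone"
    unfolding iso_grassmann_cone_def V.cone_def ..
  have coneW: "iso_grassmann_cone QW q wedgeW = W.cone"
    unfolding iso_grassmann_cone_def W.cone_def ..
  have dW: "vec.dim (UNIV :: ('a ^ 'm) set) = CARD('m)" by (rule vec_dim_card)
  note dV = assms(4)[symmetric]
  have par: "odd (V.dim UNIV) \<longleftrightarrow> odd (vec.dim (UNIV :: ('a ^ 'm) set))" and q: "vec.dim (UNIV :: ('a ^ 'm) set) div 2 = q" "q \<ge> 1"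
    and qj: "q \<ge> (if odd (V.dim UNIV) then 3 else 4)"
    using assms(5) unfolding dW by (auto split: if_splits)
  obtain j where j: "q = Suc j" using q(2) by (cases q) auto
  \<comment> \<open>The scalar \<open>c\<close> is kept because the cone is not closed under scaling
    when \<open>p = 0\<close>.\<close>
  have point_iff: "proj_point sE \<omega> \<in> iso_grassmannian sE QV p wedgeV \<longleftrightarrow> (\<exists>c. \<exists>x\<in>V.cone. \<omega> = sE c x)"
  proof
    assume "proj_point sE \<omega> \<in> iso_grassmannian sE QV p wedgeV"
    then obtain x where x: "x \<in> V.cone" "V.ext.E.span {\<omega>} = V.ext.E.span {x}"
      by (auto simp: iso_grassmannian_def coneV proj_point_def)
    have "\<omega> \<in> V.ext.E.span {x}" using x(2) V.ext.E.span_base[of \<omega> "{\<omega>}"] by simp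
    then show "\<exists>c. \<exists>x\<in>V.cone. \<omega> = sE c x" using x(1) unfolding V.ext.E.span_singleton by blast
  next
    assume "\<exists>c. \<exists>x\<in>V.cone. \<omega> = sE c x"
    then obtain c x where x: "x \<in> V.cone" "\<omega> = sE c x" by blast
    then have c: "c \<noteq> 0" "x \<noteq> 0" using assms(9) by auto
    have "V.ext.E.span {sE c x} = V.ext.E.span {x}"
      using V.ext.E.span_image_scale[of "{x}" "\<lambda>_. c"] c by simp
    then show "proj_point sE \<omega> \<in> iso_grassmannian sE QV p wedgeV"
      using x c by (auto simp: iso_grassmannian_def coneV proj_point_def)
  qed
  have "(\<exists>c. \<exists>x\<in>V.cone. \<omega> = sE c x) \<longleftrightarrow>
    (\<forall>\<Phi>. Vector_Spaces.linear sE sF \<Phi> \<longrightarrow> \<Phi> ` V.cone \<subseteq> W.cone \<longrightarrow> \<Phi> \<omega> \<in> W.cone)"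
    (is "?L \<longleftrightarrow> ?R")
  proof
    assume ?L
    then obtain c x where x: "x \<in> V.cone" "\<omega> = sE c x" by blast
    show ?R
    proof (intro allI impI)
      fix \<Phi> assume \<Phi>: "Vector_Spaces.linear sE sF \<Phi>" "\<Phi> ` V.cone \<subseteq> W.cone"
      interpret \<Phi>: Vector_Spaces.linear sE sF \<Phi> by fact
      show "\<Phi> \<omega> \<in> W.cone"
        unfolding x(2) \<Phi>.scale using \<Phi>(2) x(1) q(2) by (intro W.scale_cone) auto
    qed
  next
    assume R: ?R
    show ?L
    proof (cases "p = 0")
      case True
      \<comment> \<open>In degree 0 the exterior power is the line through \<open>wedgeV []\<close>,
        so every nonzero \<open>\<omega>\<close> gives the single point.\<close>
      have "\<omega> = sE (V.hat \<omega> []) (wedgeV [])"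
      proof (rule V.hat_inject)
        fix us :: "'v list" assume us: "length us = p"
        have "V.gram_det [] [] = 1" by (rule V.gram_det_delta) auto
        then show "V.hat \<omega> us = V.hat (sE (V.hat \<omega> []) (wedgeV [])) us"
          using V.hat_scale[OF us] V.hat_wedge[OF us, of "[]"] us True by simp
      qed
      moreover have "wedgeV [] \<in> V.cone" unfolding V.cone_def using True by (intro CollectI exI[of _ "[]"]) simp
      ultimately show ?thesis by blast
    next
      case False
      then obtain i where i: "p = Suc i" by (cases p) auto
      have "V.iso UNIV i (V.hat \<omega>)"
      proof (cases "p \<le> q")
        case True
        show ?thesis
          by (rule igcp_extension[OF i dV j q(1) True par]) (use R in blast)
      next
        case False
        define r where "r = p - q"
        have p: "p = r + q" and i': "i = j + r" using False i j by (auto simp: r_def)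
        have "V.iso UNIV (j + r) (V.hat \<omega>)"
        proof (rule V.iso_from_sections[OF V.nondeg_UNIV])
          show "V.dim UNIV div 2 = Suc j + r" using dV p j by simp
          show "j \<ge> (if odd (V.dim UNIV) then 2 else 3)" using qj j by (auto split: if_splits)
          show "alternating_multilinear sV (*) (Suc j + r) (V.hat \<omega>)"
            using V.alternating_hat p j by (simp add: add.commute)
          fix T gs
          assume T: "V.nondeg T" "V.dim UNIV = V.dim T + 2 * r"
            and gs: "length gs = r" "\<forall>u\<in>set gs. \<forall>v\<in>set gs. assoc_form QV u v = 0"
              "\<forall>u\<in>set gs. \<forall>x\<in>T. assoc_form QV u x = 0"
              "\<forall>x\<in>UNIV. (\<forall>y\<in>T. assoc_form QV x y = 0) \<longrightarrow> (\<forall>u\<in>set gs. assoc_form QV x u = 0) \<longrightarrow>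
                x \<in> V.span (set gs)"
          have "V.dim T div 2 = q" using dV p T(2) by simp
          moreover have "odd (V.dim T) \<longleftrightarrow> odd (vec.dim (UNIV :: ('a ^ 'm) set))" using par T(2) by simp
          \<comment> \<open>Equal halves and equal parity determine the dimension.\<close>
          ultimately have "V.dim T = vec.dim (UNIV :: ('a ^ 'm) set)"
            using q(1) by (metis even_two_times_div_two odd_two_times_div_two_succ)
          then show "V.iso T j (\<lambda>us. V.hat \<omega> (gs @ us))"
            by (intro igcp_contraction[OF j q(1) p T(1)]) (use gs R in blast)+
        qed
        then show ?thesis using i' by simp
      qed
      then have "\<omega> \<in> V.cone" by (rule V.cone_if_iso_hat[OF i dV])
      then show ?thesis by (intro exI[of _ 1] bexI[of _ \<omega>]) simp_all
    qed
  qed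
  also have "\<dots> \<longleftrightarrow> (\<forall>\<Phi> F. igcp sE QV p wedgeV sF QW q wedgeW \<Phi> \<longrightarrow>
       polynomial_on sF F \<longrightarrow> (\<forall>x\<in>iso_grassmann_cone QW q wedgeW. F x = 0) \<longrightarrow> F (\<Phi> \<omega>) = 0)"
  proof -
    \<comment> \<open>Closedness of the target cone turns the vanishing of all polynomials
      \<open>F\<close> into membership.\<close>
    have "\<Phi> \<omega> \<in> W.cone \<longleftrightarrow>
        (\<forall>F. polynomial_on sF F \<longrightarrow> (\<forall>x\<in>W.cone. F x = 0) \<longrightarrow> F (\<Phi> \<omega>) = 0)" for \<Phi>
      using W.cone_closed[OF j q(1), of "\<Phi> \<omega>"] by metis
    then show ?thesis unfolding igcp_def coneV coneW by metis
  qed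
  finally show ?thesis using point_iff by simp
qed

end
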